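(* Let $u\ge d\ge 1$ be integers, $E\in E(u)$ and $C\in C(d;E)$. Then there exist an integer $s$ and functions $\phi_k\in C^\infty(\mathbb{T}^u,\mathbb{R}^d)$, $k=1,\dots,s$, such that for every $f\in C^2(\mathbb{T}^u,\mathbb{R}^d)$ the set of parameters $\mathbf{t}=(t_1,\dots,t_s)\in\mathbb{R}^s$ for which the SRB measure $\mu_{T_{\mathbf t}}$ of $$T_{\mathbf t}(x,y)=(E(x),C(y)+f_{\mathbf t}(x)),\qquad f_{\mathbf t}=f+t_1\phi_1+\cdots+t_s\phi_s,$$ is absolutely continuous with respect to the volume of $\mathbb{T}^u\times\mathbb{R}^d$ has full Lebesgue measure in $\mathbb{R}^s$.
   Context: $\mathbb{T}^u=\mathbb{R}^u/\mathbb{Z}^u$; vectors carry the Euclidean norm and linear maps the operator norm. $E(u)$ is the set of linear expanding maps of $\mathbb{T}^u$: maps induced by a linear map (same letter) $E:\mathbb{R}^u\to\mathbb{R}^u$ with $E(\mathbb{Z}^u)\subset\mathbb{Z}^u$ and $\|E^{-1}\|<1$. $C(d)$ is the set of linear $C:\mathbb{R}^d\to\mathbb{R}^d$ with $\|Cv\|<\|v\|$ for all $v\ne0$. For $E\in E(u)$, $$C(d;E)=\Big\{C\in C(d): |\det C|>|\det E|^{-1}\ \text{ and }\ \|C\|<\frac{\|E^{-1}\|^{-1}}{|\det E|^{\frac{1}{u-d+1}}}\Big\}.$$ A map $T(x,y)=(E(x),C(y)+g(x))$ on $\mathbb{T}^u\times\mathbb{R}^d$ with $g\in C^2(\mathbb{T}^u,\mathbb{R}^d)$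 has a unique SRB measure $\mu_T$: the unique $T$-invariant Borel probability measure such that $\frac1n\sum_{k=0}^{n-1}\delta_{T^k(z)}\to\mu_T$ weakly for volume-almost every $z$. The volume is the product of normalized Lebesgue measure on $\mathbb{T}^u$ and Lebesgue measure on $\mathbb{R}^d$. *)

theory Defs
  imports "HOL-Probability.Probability"
begin

section \<open>The torus\<close>

definition int_lattice :: "(real ^ 'n) set" where
  "int_lattice = {x. \<forall>i. x $ i \<in> \<int>}"

quotient_type 'n torus = "real ^ 'n" / "\<lambda>x y. x - y \<in> int_lattice"
  morphisms rep_torus torus_proj
proof (rule equivpI)
  show "reflp (\<lambda>x y :: real ^ 'n. x - y \<in> int_lattice)"
    by (auto simp: reflp_def int_lattice_def)
  show "symp (\<lambda>x y :: real ^ 'n. x - y \<in> int_lattice)"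
    unfolding symp_def int_lattice_def by (auto simp: Ints_diff) (metis Ints_minus minus_diff_eq)
  show "transp (\<lambda>x y :: real ^ 'n. x - y \<in> int_lattice)"
    unfolding transp_def int_lattice_def
  proof (intro allI impI CollectI)
    fix x y z :: "real ^ 'n" and i
    assume "x - y \<in> {x. \<forall>i. x $ i \<in> \<int>}" "y - z \<in> {x. \<forall>i. x $ i \<in> \<int>}"
    then have "(x $ i - y $ i) + (y $ i - z $ i) \<in> \<int>"
      by (intro Ints_add) auto
    then show "(x - z) $ i \<in> \<int>" by simp
  qed
qed

lemma torus_proj_eq_iff: "torus_proj x = torus_proj y \<longleftrightarrow> x - y \<in> int_lattice"
  by (rule torus.abs_eq_iff)

lemma torus_proj_rep [simp]: "torus_proj (rep_torus p) = p"
  using Quotient_torus by (rule Quotient_abs_rep)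

lemma torus_proj_surj: "range torus_proj = UNIV"
  using torus_proj_rep by (metis surjI)

instantiation torus :: (finite) topological_space
begin

definition open_torus :: "'a torus set \<Rightarrow> bool" where
  "open_torus U \<longleftrightarrow> open (torus_proj -` U)"

instance
  by standard (auto simp: open_torus_def vimage_Union)

end

lemma continuous_torus_proj: "continuous_on UNIV torus_proj"
  by (simp add: continuous_on_open_vimage open_torus_def)

lemma measurable_torus_proj [measurable]: "torus_proj \<in> borel_measurable borel"
  by (rule borel_measurable_continuous_onI[OF continuous_torus_proj])

lemma open_torus_proj_image:
  assumes "open U" shows "open (torus_proj ` U)"
proof -
  have "torus_proj -` (torus_proj ` U) = (\<Union>v\<in>int_lattice. (+) v ` U)"
    by (force simp: torus_proj_eq_iff intro: rev_image_eqI)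
  then show ?thesis
    unfolding open_torus_def using assms by (auto intro: open_translation)
qed

instance torus :: (finite) second_countable_topology
proof
  obtain B :: "(real ^ 'a) set set" where B: "countable B" "topological_basis B"
    using ex_countable_basis by blast
  let ?B = "(`) torus_proj ` B"
  have "topological_basis ?B"
  proof (rule topological_basisI)
    show "open b" if "b \<in> ?B" for b
      using that B(2) open_torus_proj_image topological_basis_open by blast
    show "\<exists>b\<in>?B. p \<in> b \<and> b \<subseteq> U" if "open U" "p \<in> U" for U :: "'a torus set" and p
    proof -
      have "open (torus_proj -` U)" "rep_torus p \<in> torus_proj -` U"
        using that by (auto simp: open_torus_def)
      then obtain b where "b \<in> B" "rep_torus p \<in> b" "b \<subseteq> torus_proj -` U"
        using B(2) topological_basisE by blast
      then show ?thesis
        by (intro bexI[of _ "torus_proj ` b"]) (auto intro: rev_image_eqI)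
    qed
  qed
  then show "\<exists>B :: 'a torus set set. countable B \<and> open = generate_topology B"
    using B(1) topological_basis_imp_subbasis by (intro exI[of _ ?B]) auto
qed


section \<open>Volume on the cylinder\<close>

definition torus_lebesgue :: "('n :: finite) torus measure" where
  "torus_lebesgue =
     distr (restrict_space lborel {x. \<forall>i. 0 \<le> x $ i \<and> x $ i < 1}) borel torus_proj"

definition cylinder_volume :: "(('u :: finite) torus \<times> (real ^ 'd)) measure" where
  "cylinder_volume = torus_lebesgue \<Otimes>\<^sub>M lborel"

lemma sets_cylinder_volume: "sets (cylinder_volume :: (('u :: finite) torus \<times> (real ^ 'd)) measure) = sets borel"
proof -
  have "sets (cylinder_volume :: ('u torus \<times> (real ^ 'd)) measure) =
      sets (borel \<Otimes>\<^sub>M borel :: ('u torus \<times> (real ^ 'd)) measure)"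
    unfolding cylinder_volume_def by (rule sets_pair_measure_cong) (simp_all add: torus_lebesgue_def)
  then show ?thesis by (simp only: borel_prod)
qed

lemma prob_space_torus_lebesgue: "prob_space (torus_lebesgue :: ('n :: finite) torus measure)"
proof -
  let ?Q = "{x :: real ^ 'n. \<forall>i. 0 \<le> x $ i \<and> x $ i < 1}"
  have Q: "?Q \<in> sets lborel" by measurable
  have "box (0 :: real ^ 'n) (\<chi> i. 1) \<subseteq> ?Q" "?Q \<subseteq> cbox 0 (\<chi> i. 1)"
    by (auto simp: mem_box_cart less_imp_le)
  then have "emeasure lborel (box (0 :: real ^ 'n) (\<chi> i. 1)) \<le> emeasure lborel ?Q"
      "emeasure lborel ?Q \<le> emeasure lborel (cbox (0 :: real ^ 'n) (\<chi> i. 1))"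
    using Q by (auto intro: emeasure_mono)
  moreover have "(\<Prod>b\<in>Basis. ((\<chi> i. 1) - 0 :: real ^ 'n) \<bullet> b) = 1"
    by (intro prod.neutral) (auto simp: Basis_vec_def inner_axis)
  moreover have "0 \<bullet> b \<le> ((\<chi> i. 1) :: real ^ 'n) \<bullet> b" if "b \<in> Basis" for b :: "real ^ 'n"
    using that by (auto simp: Basis_vec_def inner_axis)
  ultimately have "emeasure lborel ?Q = 1"
    by (simp add: emeasure_lborel_box emeasure_lborel_cbox)
  then have "prob_space (restrict_space lborel ?Q)"
    using Q by (intro prob_spaceI) (simp add: emeasure_restrict_space space_restrict_space)
  then show ?thesis
    unfolding torus_lebesgue_def
    by (rule prob_space.prob_space_distr) (auto intro!: measurable_restrict_space1)
qed


section \<open>Differentiability classes\<close>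

text \<open>In finite dimension, continuity of the derivative of order \<open>k\<close> is equivalent to continuity
  of all its evaluations at fixed vectors; this avoids passing to spaces of multilinear maps.\<close>

primrec Ck :: "nat \<Rightarrow> ('a :: euclidean_space \<Rightarrow> 'b :: euclidean_space) \<Rightarrow> bool" where
  "Ck 0 f \<longleftrightarrow> continuous_on UNIV f"
| "Ck (Suc k) f \<longleftrightarrow>
     (\<exists>f'. (\<forall>x. (f has_derivative f' x) (at x)) \<and> (\<forall>v. Ck k (\<lambda>x. f' x v)))"

text \<open>The projection is a local diffeomorphism, so regularity is tested on lifts.\<close>

definition torus_Ck :: "nat \<Rightarrow> (('n :: finite) torus \<Rightarrow> 'b :: euclidean_space) \<Rightarrow> bool" where
  "torus_Ck k g \<longleftrightarrow> Ck k (g \<circ> torus_proj)"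

definition torus_Cinf :: "(('n :: finite) torus \<Rightarrow> 'b :: euclidean_space) \<Rightarrow> bool" where
  "torus_Cinf g \<longleftrightarrow> (\<forall>k. torus_Ck k g)"


section \<open>Expanding and contracting linear maps\<close>

definition expanding :: "(real ^ 'u \<Rightarrow> real ^ 'u) \<Rightarrow> bool" where
  "expanding E \<longleftrightarrow> linear E \<and> bij E \<and> E ` int_lattice \<subseteq> int_lattice \<and> onorm (inv E) < 1"

text \<open>For integral linear maps this does not depend on the chosen representative.\<close>

definition torus_map :: "(real ^ 'u \<Rightarrow> real ^ 'u) \<Rightarrow> 'u torus \<Rightarrow> 'u torus" where
  "torus_map E p = torus_proj (E (rep_torus p))"

lemma torus_map_proj:
  assumes "linear E" "E ` int_lattice \<subseteq> int_lattice"
  shows "torus_map E (torus_proj x) = torus_proj (E x)"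
proof -
  have "rep_torus (torus_proj x) - x \<in> int_lattice"
    by (simp flip: torus_proj_eq_iff)
  then have "E (rep_torus (torus_proj x)) - E x \<in> int_lattice"
    using assms by (auto simp flip: linear_diff)
  then show ?thesis by (simp add: torus_map_def torus_proj_eq_iff)
qed

definition contracting :: "(real ^ 'd \<Rightarrow> real ^ 'd) \<Rightarrow> bool" where
  "contracting C \<longleftrightarrow> linear C \<and> (\<forall>v. v \<noteq> 0 \<longrightarrow> norm (C v) < norm v)"

definition contracting_for ::
    "(real ^ 'u \<Rightarrow> real ^ 'u) \<Rightarrow> (real ^ 'd \<Rightarrow> real ^ 'd) \<Rightarrow> bool" where
  "contracting_for E C \<longleftrightarrow> contracting C
     \<and> \<bar>det (matrix C)\<bar> > inverse \<bar>det (matrix E)\<bar>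
     \<and> onorm C < inverse (onorm (inv E)) /
         \<bar>det (matrix E)\<bar> powr (1 / (real CARD('u) - real CARD('d) + 1))"


section \<open>SRB measures of skew products\<close>

definition skew_product ::
    "(real ^ 'u \<Rightarrow> real ^ 'u) \<Rightarrow> (real ^ 'd \<Rightarrow> real ^ 'd) \<Rightarrow> ('u torus \<Rightarrow> real ^ 'd) \<Rightarrow>
     'u torus \<times> (real ^ 'd) \<Rightarrow> 'u torus \<times> (real ^ 'd)" where
  "skew_product E C g = (\<lambda>(x, y). (torus_map E x, C y + g x))"

definition weakly_converges ::
    "(nat \<Rightarrow> 'a :: topological_space measure) \<Rightarrow> 'a measure \<Rightarrow> bool" where
  "weakly_converges M N \<longleftrightarrow>
     (\<forall>h :: 'a \<Rightarrow> real. continuous_on UNIV h \<and> bounded (range h) \<longrightarrow>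
        (\<lambda>n. integral\<^sup>L (M n) h) \<longlonglongrightarrow> integral\<^sup>L N h)"

text \<open>The measure \<open>1/n (\<delta>\<^bsub>z\<^esub> + \<dots> + \<delta>\<^bsub>T^(n-1) z\<^esub>)\<close>.\<close>

definition empirical_measure ::
    "('a :: topological_space \<Rightarrow> 'a) \<Rightarrow> 'a \<Rightarrow> nat \<Rightarrow> 'a measure" where
  "empirical_measure T z n = distr (uniform_count_measure {..<n}) borel (\<lambda>k. (T ^^ k) z)"

lemma integral_empirical_measure:
  fixes h :: "'a :: topological_space \<Rightarrow> real"
  assumes "h \<in> borel_measurable borel"
  shows "integral\<^sup>L (empirical_measure T z n) h = (\<Sum>k<n. h ((T ^^ k) z)) / n"
  unfolding empirical_measure_def using assms
  by (subst integral_distr)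
     (auto simp: integral_uniform_count_measure measurable_def space_uniform_count_measure
        sets_uniform_count_measure)

definition is_SRB_measure ::
    "(('u :: finite) torus \<times> (real ^ 'd) \<Rightarrow> 'u torus \<times> (real ^ 'd)) \<Rightarrow>
     ('u torus \<times> (real ^ 'd)) measure \<Rightarrow> bool" where
  "is_SRB_measure T \<mu> \<longleftrightarrow> sets \<mu> = sets borel \<and> prob_space \<mu> \<and> distr \<mu> borel T = \<mu> \<and>
     (AE z in cylinder_volume. weakly_converges (empirical_measure T z) \<mu>)"

definition SRB_measure ::
    "(('u :: finite) torus \<times> (real ^ 'd) \<Rightarrow> 'u torus \<times> (real ^ 'd)) \<Rightarrow>
     ('u torus \<times> (real ^ 'd)) measure" where
  "SRB_measure T = (THE \<mu>. is_SRB_measure T \<mu>)"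

end

theory Submission
  imports Defs
begin

text \<open>
  Write \<open>g\<close> for the perturbed function and \<open>T(x, y) = (E x, C y + g x)\<close>. The fibres are contracted, so the
  asymptotic height of an orbit over a point \<open>x\<close> of the torus depends only on the past of \<open>x\<close>: along a
  backward orbit \<open>x\<^sub>0, x\<^sub>1, \<dots>\<close> with \<open>E x\<^sub>0 = x\<close> and \<open>E x\<^sub>i\<^sub>+\<^sub>1 = x\<^sub>i\<close> it is the sum of \<open>C^i (g x\<^sub>i)\<close>. Choosing \<open>x\<close> by
  Lebesgue measure and each preimage uniformly among the \<open>N = |det E|\<close> possible ones, the law of
  \<open>(x, height)\<close> is a \<open>T\<close>-invariant probability measure. It is the SRB measure (\<open>SRB_measure_eq\<close>): Lebesgue
  almost every \<open>x\<close> equidistributes under \<open>E\<close>, and fibre contraction turns equidistribution in the base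
  into convergence of the empirical measures from every point above \<open>x\<close>.

  It remains to see that for almost every \<open>x\<close> the law of the height is absolutely continuous on \<open>\<real>\<^sup>d\<close>.
  Two independent backward orbits of \<open>x\<close> coincide for exactly \<open>n\<close> steps with probability at most \<open>N^(-n)\<close>;
  the difference of their heights is then \<open>C^n\<close> applied to a vector \<open>W(t)\<close> that is affine in the parameters
  \<open>t\<close>. If \<open>t \<mapsto> W(t)\<close> maps some block of \<open>d\<close> parameters onto \<open>\<real>\<^sup>d\<close> with determinant at least \<open>\<delta>\<close>, then for
  \<open>t\<close> uniform in a box the difference lies in a ball of radius \<open>r\<close> with probability at most a constant
  times \<open>r^d |det C|^(-n)\<close>. Because \<open>|det E| |det C| > 1\<close>, summing over \<open>n\<close> gives an average energy of order
  \<open>r^d\<close>, uniformly in \<open>x\<close> (\<open>box_energy_recursion\<close>, \<open>box_energy_bound\<close>). By Fatou's lemma, for almost every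
  \<open>t\<close> and almost every \<open>x\<close> the energy at scale \<open>r\<close> is at most a constant times \<open>r^d\<close> along a sequence of
  radii tending to \<open>0\<close>, and this bounds the density of the height in \<open>L\<^sup>2\<close>
  (\<open>bounded_energy_absolutely_continuous\<close>).

  The perturbations are \<open>\<psi> e\<close> with \<open>e\<close> a standard basis vector and \<open>\<psi>\<close> in a finite set of trigonometric
  polynomials, and the onto condition reads: for backward orbits \<open>a\<close>, \<open>b\<close> with \<open>a\<^sub>0 \<noteq> b\<^sub>0\<close> and \<open>E a\<^sub>0 = E b\<^sub>0\<close>, the
  operator \<open>\<Sum>\<^sub>i (\<psi>(a\<^sub>i) - \<psi>(b\<^sub>i)) C^i\<close> is invertible for some \<open>\<psi>\<close> in the set. One of the orbits, say \<open>b\<close>, avoids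
  the first point \<open>p = a\<^sub>0\<close> of the other. As \<open>\<psi>\<close> concentrates at \<open>p\<close> the operator tends to the sum of \<open>C^i\<close>
  over the times at which \<open>a\<close> visits \<open>p\<close>. These times are the multiples of a period up to some
  possibly infinite bound, so the sum is a geometric series and is invertible because \<open>C\<close> is a
  contraction. Pairs of backward orbits form a compact space, hence finitely many \<open>\<psi>\<close> suffice and the
  determinants stay away from \<open>0\<close> (\<open>uniform_transversality\<close>).
\<close>

section \<open>Linear images of Lebesgue measure\<close>

lemma nn_integral_lborel_translate:
  fixes h :: "'a :: euclidean_space \<Rightarrow> ennreal"
  assumes [measurable]: "h \<in> borel_measurable borel"
  shows "(\<integral>\<^sup>+x. h (c + x) \<partial>lborel) = (\<integral>\<^sup>+x. h x \<partial>lborel)"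
proof -
  have "(\<integral>\<^sup>+x. h x \<partial>lborel) = (\<integral>\<^sup>+x. h x \<partial>distr lborel borel ((+) c))"
    by (simp add: lborel_distr_plus)
  also have "\<dots> = (\<integral>\<^sup>+x. h (c + x) \<partial>lborel)" by (subst nn_integral_distr) auto
  finally show ?thesis by simp
qed

text \<open>In coordinates, a shear translates the \<open>m\<close>-th variable by an amount that depends only on the others,
  so it is enough to integrate over that variable first.\<close>

lemma nn_integral_lborel_shear:
  fixes h :: "real ^ 'n \<Rightarrow> ennreal"
  assumes [measurable]: "h \<in> borel_measurable borel" and "m \<noteq> n"
  shows "(\<integral>\<^sup>+x. h (\<chi> i. if i = m then x$m + x$n else x$i) \<partial>lborel) = (\<integral>\<^sup>+x. h x \<partial>lborel)"
proof -
  interpret P: product_sigma_finite "\<lambda>_ :: real ^ 'n. lborel :: real measure" ..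
  let ?B = "Basis :: (real ^ 'n) set" and ?em = "axis m (1 :: real)" and ?en = "axis n (1 :: real)"
  let ?s = "\<lambda>f. \<Sum>b\<in>?B. f b *\<^sub>R b"
  have em: "?em \<in> ?B" "?en \<in> ?B" "?em \<noteq> ?en"
    using assms(2) by (auto simp: Basis_vec_def axis_eq_axis)
  have B: "?B = insert ?em (?B - {?em})" using em by auto
  have shear: "(\<chi> i. if i = m then x$m + x$n else x$i) = x + (x$n) *\<^sub>R ?em" for x :: "real ^ 'n"
    by (auto simp: vec_eq_iff axis_def)
  have upd: "?s (f(?em := y)) = (\<Sum>b\<in>?B - {?em}. f b *\<^sub>R b) + y *\<^sub>R ?em" for f y
  proof -
    have "?s (f(?em := y)) = (\<Sum>b\<in>insert ?em (?B - {?em}). (f(?em := y)) b *\<^sub>R b)"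
      using B by simp
    also have "\<dots> = y *\<^sub>R ?em + (\<Sum>b\<in>?B - {?em}. (f(?em := y)) b *\<^sub>R b)"
      by (subst sum.insert) (auto)
    also have "(\<Sum>b\<in>?B - {?em}. (f(?em := y)) b *\<^sub>R b) = (\<Sum>b\<in>?B - {?em}. f b *\<^sub>R b)"
      by (rule sum.cong) auto
    finally show ?thesis by (simp add: add.commute)
  qed
  have nth: "((\<Sum>b\<in>?B - {?em}. f b *\<^sub>R b) + y *\<^sub>R ?em) $ n = f ?en" for f and y :: real
  proof -
    have "((\<Sum>b\<in>?B - {?em}. f b *\<^sub>R b) + y *\<^sub>R ?em) $ n
        = ((\<Sum>b\<in>?B - {?em}. f b *\<^sub>R b) + y *\<^sub>R ?em) \<bullet> ?en"
      by (simp add: inner_axis)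
    also have "\<dots> = (\<Sum>b\<in>?B - {?em}. f b * (b \<bullet> ?en)) + y * (?em \<bullet> ?en)"
      by (simp add: inner_add_left inner_sum_left)
    also have "?em \<bullet> ?en = 0" using em by (auto simp: inner_Basis)
    also have "(\<Sum>b\<in>?B - {?em}. f b * (b \<bullet> ?en)) = (\<Sum>b\<in>?B - {?em}. if b = ?en then f b else 0)"
      using em by (intro sum.cong) (auto simp: inner_Basis)
    also have "\<dots> = f ?en" using em by (subst sum.delta) auto
    finally show ?thesis by simp
  qed
  have L: "(\<integral>\<^sup>+x. g x \<partial>lborel) =
      (\<integral>\<^sup>+f. \<integral>\<^sup>+y. g ((\<Sum>b\<in>?B - {?em}. f b *\<^sub>R b) + y *\<^sub>R ?em) \<partial>lborel \<partial>(\<Pi>\<^sub>M b\<in>?B - {?em}. lborel))"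
    if [measurable]: "g \<in> borel_measurable borel" for g :: "real ^ 'n \<Rightarrow> ennreal"
  proof -
    have "(\<integral>\<^sup>+x. g x \<partial>lborel) = (\<integral>\<^sup>+f. g (?s f) \<partial>(\<Pi>\<^sub>M b\<in>?B. lborel))"
      by (subst lborel_eq, subst nn_integral_distr) auto
    also have "\<dots> = (\<integral>\<^sup>+f. g (?s f) \<partial>(\<Pi>\<^sub>M b\<in>insert ?em (?B - {?em}). lborel))"
      using B by simp
    also have "\<dots> = (\<integral>\<^sup>+f. \<integral>\<^sup>+y. g (?s (f(?em := y))) \<partial>lborel \<partial>(\<Pi>\<^sub>M b\<in>?B - {?em}. lborel))"
      apply (rule P.product_nn_integral_insert)
      using B by auto
    finally show ?thesis by (simp only: upd)
  qed
  have "(\<integral>\<^sup>+x. h (\<chi> i. if i = m then x$m + x$n else x$i) \<partial>lborel) =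
      (\<integral>\<^sup>+x. h (x + (x$n) *\<^sub>R ?em) \<partial>lborel)" by (simp only: shear)
  also have "\<dots> = (\<integral>\<^sup>+f. \<integral>\<^sup>+y. h ((\<Sum>b\<in>?B - {?em}. f b *\<^sub>R b) + (f ?en + y) *\<^sub>R ?em) \<partial>lborel
      \<partial>(\<Pi>\<^sub>M b\<in>?B - {?em}. lborel))"
    by (subst L) (simp, simp only: nth, simp only: scaleR_add_left add_ac)
  also have "\<dots> = (\<integral>\<^sup>+f. \<integral>\<^sup>+y. h ((\<Sum>b\<in>?B - {?em}. f b *\<^sub>R b) + y *\<^sub>R ?em) \<partial>lborel
      \<partial>(\<Pi>\<^sub>M b\<in>?B - {?em}. lborel))"
    by (intro nn_integral_cong
        nn_integral_lborel_translate[of "\<lambda>y. h ((\<Sum>b\<in>?B - {?em}. f b *\<^sub>R b) + y *\<^sub>R ?em)" "f ?en" for f]) auto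
  also have "\<dots> = (\<integral>\<^sup>+x. h x \<partial>lborel)" by (subst L) auto
  finally show ?thesis .
qed

lemma nn_integral_lborel_swap:
  fixes h :: "real ^ 'n \<Rightarrow> ennreal"
  assumes [measurable]: "h \<in> borel_measurable borel" and p: "p permutes (UNIV :: 'n set)"
  shows "(\<integral>\<^sup>+x. h (\<chi> i. x $ p i) \<partial>lborel) = (\<integral>\<^sup>+x. h x \<partial>lborel)"
proof -
  let ?f = "\<lambda>x :: real ^ 'n. \<chi> i. x $ p i"
  have [measurable]: "?f \<in> borel \<rightarrow>\<^sub>M borel"
    by (intro borel_measurable_continuous_onI continuous_intros)
  have "lborel = distr lborel borel ?f"
  proof (rule lborel_eqI)
    fix l u :: "real ^ 'n" assume "\<And>b. b \<in> Basis \<Longrightarrow> l \<bullet> b \<le> u \<bullet> b"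
    from this[of "axis i 1" for i] have le: "l $ i \<le> u $ i" for i
      by (auto simp: Basis_vec_def inner_axis)
    let ?q = "inv p"
    have q: "p (?q i) = i" "?q (p i) = i" for i using permutes_inverses[OF p] by auto
    have "?f -` box l u = box (\<chi> i. l $ ?q i) (\<chi> i. u $ ?q i)"
      by (auto simp: mem_box_cart) (metis q)+
    then have "emeasure (distr lborel borel ?f) (box l u)
        = emeasure lborel (box (\<chi> i. l $ ?q i) (\<chi> i. u $ ?q i))"
      by (subst emeasure_distr) auto
    also have "\<dots> = (\<Prod>b\<in>Basis. ((\<chi> i. u $ ?q i) - (\<chi> i. l $ ?q i) :: real ^ 'n) \<bullet> b)"
      by (rule emeasure_lborel_box) (auto simp: Basis_vec_def inner_axis le)
    also have "(\<Prod>b\<in>Basis. ((\<chi> i. u $ ?q i) - (\<chi> i. l $ ?q i) :: real ^ 'n) \<bullet> b) =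
        (\<Prod>i\<in>UNIV. u $ ?q i - l $ ?q i)"
      by (subst prod.reindex_bij_betw[symmetric, of "\<lambda>i. axis i 1" UNIV])
        (auto simp: bij_betw_def inj_on_def axis_eq_axis Basis_vec_def inner_axis)
    also have "\<dots> = (\<Prod>i\<in>UNIV. u $ i - l $ i)"
      by (rule prod.reindex_bij_betw[of ?q UNIV]) (use p permutes_inv permutes_bij in blast)
    also have "\<dots> = (\<Prod>b\<in>Basis. (u - l) \<bullet> b)"
      by (subst prod.reindex_bij_betw[symmetric, of "\<lambda>i. axis i 1" UNIV Basis])
        (auto simp: bij_betw_def inj_on_def axis_eq_axis Basis_vec_def inner_axis)
    finally show "emeasure (distr lborel borel ?f) (box l u) = (\<Prod>b\<in>Basis. (u - l) \<bullet> b)" .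
  qed simp
  then have "(\<integral>\<^sup>+x. h x \<partial>lborel) = (\<integral>\<^sup>+x. h x \<partial>distr lborel borel ?f)" by simp
  also have "\<dots> = (\<integral>\<^sup>+x. h (?f x) \<partial>lborel)" by (subst nn_integral_distr) auto
  finally show ?thesis by simp
qed

lemma nn_integral_lborel_stretch:
  fixes h :: "real ^ 'n \<Rightarrow> ennreal" and c :: "'n \<Rightarrow> real"
  assumes [measurable]: "h \<in> borel_measurable borel" and c: "\<And>i. c i \<noteq> 0"
  shows "ennreal \<bar>\<Prod>i\<in>UNIV. c i\<bar> * (\<integral>\<^sup>+x. h (\<chi> i. c i * x $ i) \<partial>lborel) = (\<integral>\<^sup>+x. h x \<partial>lborel)"
proof -
  define c' where "c' b = (THE r. \<forall>i. b = axis i (1::real) \<longrightarrow> r = c i)" for b :: "real ^ 'n"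
  have c'_axis: "c' (axis i 1) = c i" for i
    unfolding c'_def by (rule the_equality) (auto simp: axis_eq_axis)
  let ?T = "\<lambda>x :: real ^ 'n. 0 + (\<Sum>j\<in>Basis. (c' j * (x \<bullet> j)) *\<^sub>R j)"
  have T: "?T x = (\<chi> i. c i * x $ i)" for x
  proof -
    have "?T x = (\<Sum>i\<in>UNIV. (c i * x $ i) *\<^sub>R axis i 1)"
      by (subst sum.reindex_bij_betw[symmetric, of "\<lambda>i. axis i 1" UNIV])
        (auto simp: bij_betw_def inj_on_def axis_eq_axis Basis_vec_def inner_axis c'_axis)
    also have "\<dots> = (\<chi> i. c i * x $ i)"
      using basis_expansion[of "\<chi> i. c i * x $ i"] by (simp add: scalar_mult_eq_scaleR)
    finally show ?thesis .
  qed
  have P: "(\<Prod>j\<in>Basis. \<bar>c' j\<bar>) = \<bar>\<Prod>i\<in>UNIV. c i\<bar>"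
    by (subst prod.reindex_bij_betw[symmetric, of "\<lambda>i. axis i 1" UNIV])
      (auto simp: bij_betw_def inj_on_def axis_eq_axis Basis_vec_def c'_axis abs_prod)
  have [measurable]: "(\<lambda>x :: real ^ 'n. \<chi> i. c i * x $ i) \<in> borel \<rightarrow>\<^sub>M borel"
    by (intro borel_measurable_continuous_onI continuous_intros)
  have "lborel = density (distr lborel borel ?T) (\<lambda>_. (\<Prod>j\<in>Basis. \<bar>c' j\<bar>))"
    by (rule lborel_affine_euclidean) (auto simp: Basis_vec_def c'_axis c)
  then have "(\<integral>\<^sup>+x. h x \<partial>lborel) = (\<integral>\<^sup>+x. h x \<partial>density (distr lborel borel (\<lambda>x. \<chi> i. c i * x $ i)) (\<lambda>_. \<bar>\<Prod>i\<in>UNIV. c i\<bar>))"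
    by (simp only: T P)
  also have "\<dots> = ennreal \<bar>\<Prod>i\<in>UNIV. c i\<bar> * (\<integral>\<^sup>+x. h (\<chi> i. c i * x $ i) \<partial>lborel)"
    by (subst nn_integral_density) (auto simp: nn_integral_cmult nn_integral_distr)
  finally show ?thesis by simp
qed

text \<open>A linear bijection is a composition of stretches, coordinate swaps and elementary shears, and both
  sides are multiplicative under composition.\<close>

lemma nn_integral_lborel_linear:
  fixes h :: "real ^ 'n \<Rightarrow> ennreal"
  assumes "linear f" "inj f" "h \<in> borel_measurable borel"
  shows "ennreal \<bar>det (matrix f)\<bar> * (\<integral>\<^sup>+x. h (f x) \<partial>lborel) = (\<integral>\<^sup>+x. h x \<partial>lborel)"
proof -
  have "inj f \<longrightarrow> (\<forall>h :: real ^ 'n \<Rightarrow> ennreal. h \<in> borel_measurable borel \<longrightarrow>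
    ennreal \<bar>det (matrix f)\<bar> * (\<integral>\<^sup>+x. h (f x) \<partial>lborel) = (\<integral>\<^sup>+x. h x \<partial>lborel))"
    using \<open>linear f\<close>
  proof (rule induct_linear_elementary; intro impI allI)
    fix f g :: "real ^ 'n \<Rightarrow> real ^ 'n" and h :: "real ^ 'n \<Rightarrow> ennreal"
    assume lin: "linear f" "linear g" and h: "h \<in> borel_measurable borel" and inj: "inj (f \<circ> g)"
      and f: "inj f \<longrightarrow> (\<forall>h :: real ^ 'n \<Rightarrow> ennreal. h \<in> borel_measurable borel \<longrightarrow>
        ennreal \<bar>det (matrix f)\<bar> * (\<integral>\<^sup>+x. h (f x) \<partial>lborel) = (\<integral>\<^sup>+x. h x \<partial>lborel))"
      and g: "inj g \<longrightarrow> (\<forall>h :: real ^ 'n \<Rightarrow> ennreal. h \<in> borel_measurable borel \<longrightarrow>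
        ennreal \<bar>det (matrix g)\<bar> * (\<integral>\<^sup>+x. h (g x) \<partial>lborel) = (\<integral>\<^sup>+x. h x \<partial>lborel))"
    have "inj g" using inj inj_on_imageI2 by blast
    then have "surj g" using lin linear_injective_imp_surjective by blast
    then have "inj f" using inj inj_on_imageI[of f g UNIV] by auto
    have hf: "(\<lambda>x. h (f x)) \<in> borel_measurable borel"
      by (rule measurable_compose[OF _ h])
        (use lin(1) in \<open>auto intro!: borel_measurable_continuous_onI linear_continuous_on simp: linear_linear\<close>)
    have "ennreal \<bar>det (matrix (f \<circ> g))\<bar> * (\<integral>\<^sup>+x. h ((f \<circ> g) x) \<partial>lborel) =
      ennreal \<bar>det (matrix f)\<bar> * (ennreal \<bar>det (matrix g)\<bar> * (\<integral>\<^sup>+x. h (f (g x)) \<partial>lborel))"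
      by (simp add: matrix_compose[OF lin(2,1)] det_mul abs_mult ennreal_mult mult.assoc)
    also have "ennreal \<bar>det (matrix g)\<bar> * (\<integral>\<^sup>+x. h (f (g x)) \<partial>lborel) = (\<integral>\<^sup>+x. h (f x) \<partial>lborel)"
      using g \<open>inj g\<close> hf by blast
    also have "ennreal \<bar>det (matrix f)\<bar> * (\<integral>\<^sup>+x. h (f x) \<partial>lborel) = (\<integral>\<^sup>+x. h x \<partial>lborel)"
      using f \<open>inj f\<close> h by blast
    finally show "ennreal \<bar>det (matrix (f \<circ> g))\<bar> * (\<integral>\<^sup>+x. h ((f \<circ> g) x) \<partial>lborel) = (\<integral>\<^sup>+x. h x \<partial>lborel)" .
  next
    fix f :: "real ^ 'n \<Rightarrow> real ^ 'n" and i and h :: "real ^ 'n \<Rightarrow> ennreal"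
    assume "linear f" "\<And>x. f x $ i = 0" "inj f"
    moreover have "surj f" using calculation linear_injective_imp_surjective by blast
    ultimately have False by (metis axis_nth surjD zero_neq_one)
    then show "ennreal \<bar>det (matrix f)\<bar> * (\<integral>\<^sup>+x. h (f x) \<partial>lborel) = (\<integral>\<^sup>+x. h x \<partial>lborel)" ..
  next
    fix c :: "'n \<Rightarrow> real" and h :: "real ^ 'n \<Rightarrow> ennreal"
    assume inj: "inj (\<lambda>x :: real ^ 'n. \<chi> i. c i * x $ i)" and h: "h \<in> borel_measurable borel"
    have "c i \<noteq> 0" for i
    proof
      assume "c i = 0"
      then have "(\<chi> j. c j * axis i 1 $ j) = (\<chi> j. c j * (0 :: real ^ 'n) $ j)"
        by (auto simp: vec_eq_iff axis_def)
      then have "axis i 1 = (0 :: real ^ 'n)" using inj by (meson injD)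
      then show False by (simp add: axis_eq_0_iff)
    qed
    moreover have "det (matrix (\<lambda>x :: real ^ 'n. \<chi> i. c i * x $ i)) = (\<Prod>i\<in>UNIV. c i)"
      by (subst det_diagonal) (auto simp: matrix_def axis_def)
    ultimately show "ennreal \<bar>det (matrix (\<lambda>x :: real ^ 'n. \<chi> i. c i * x $ i))\<bar> *
        (\<integral>\<^sup>+x. h (\<chi> i. c i * x $ i) \<partial>lborel) = (\<integral>\<^sup>+x. h x \<partial>lborel)"
      using nn_integral_lborel_stretch[OF h] by simp
  next
    fix m n :: 'n and h :: "real ^ 'n \<Rightarrow> ennreal"
    assume mn: "m \<noteq> n" and h: "h \<in> borel_measurable borel"
    have p: "Transposition.transpose m n permutes UNIV" by (rule permutes_swap_id) auto
    have "matrix (\<lambda>x :: real ^ 'n. \<chi> i. x $ Transposition.transpose m n i) =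
        (\<chi> i. mat 1 $ Transposition.transpose m n i)"
      by (auto simp: matrix_def mat_def axis_def vec_eq_iff)
    then have "det (matrix (\<lambda>x :: real ^ 'n. \<chi> i. x $ Transposition.transpose m n i)) = - 1"
      using det_permute_rows[OF p, of "mat 1 :: real ^ 'n ^ 'n"] mn by (simp add: sign_swap_id)
    then show "ennreal \<bar>det (matrix (\<lambda>x :: real ^ 'n. \<chi> i. x $ Transposition.transpose m n i))\<bar> *
        (\<integral>\<^sup>+x. h (\<chi> i. x $ Transposition.transpose m n i) \<partial>lborel) = (\<integral>\<^sup>+x. h x \<partial>lborel)"
      using nn_integral_lborel_swap[OF h p] by simp
  next
    fix m n :: 'n and h :: "real ^ 'n \<Rightarrow> ennreal"
    assume mn: "m \<noteq> n" and h: "h \<in> borel_measurable borel"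
    let ?M = "matrix (\<lambda>x :: real ^ 'n. \<chi> i. if i = m then x$m + x$n else x$i)"
    have "?M = (\<chi> i. if i = m then row m (mat 1 :: real ^ 'n ^ 'n) + 1 *s row n (mat 1) else row i (mat 1))"
      by (auto simp: matrix_def mat_def axis_def vec_eq_iff row_def)
    then have "det ?M = 1"
      using det_row_operation[OF mn, of "mat 1 :: real ^ 'n ^ 'n" 1] by simp
    then show "ennreal \<bar>det ?M\<bar> * (\<integral>\<^sup>+x. h (\<chi> i. if i = m then x$m + x$n else x$i) \<partial>lborel) = (\<integral>\<^sup>+x. h x \<partial>lborel)"
      using nn_integral_lborel_shear[OF h mn] by simp
  qed
  then show ?thesis using assms by blast
qed

section \<open>Periodic integrals over fundamental domains\<close>

definition unit_cube :: "(real ^ 'n) set" where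
  "unit_cube = {x. \<forall>i. 0 \<le> x $ i \<and> x $ i < 1}"

definition vfrac :: "real ^ 'n \<Rightarrow> real ^ 'n" where
  "vfrac x = (\<chi> i. frac (x $ i))"

text \<open>The law of a uniform point of the torus, lifted to the unit cube; integrals over the torus become
  integrals of periodic functions on Euclidean space.\<close>

definition cube_lebesgue :: "(real ^ 'n) measure" where
  "cube_lebesgue = density lborel (indicator unit_cube)"

definition periodic :: "(real ^ 'n \<Rightarrow> 'a) \<Rightarrow> bool" where
  "periodic f \<longleftrightarrow> (\<forall>x. \<forall>v\<in>int_lattice. f (x + v) = f x)"

definition fundamental_domain :: "(real ^ 'n) set \<Rightarrow> bool" where
  "fundamental_domain D \<longleftrightarrow> D \<in> sets borel \<and> (\<forall>x. \<exists>!v. v \<in> int_lattice \<and> x + v \<in> D)"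

lemma fundamental_domainE:
  assumes "fundamental_domain D"
  obtains v where "v \<in> int_lattice" "x + v \<in> D"
    "\<forall>w. w \<in> int_lattice \<and> x + w \<in> D \<longrightarrow> w = v"
proof -
  have "\<forall>x. \<exists>!v. v \<in> int_lattice \<and> x + v \<in> D"
    using assms unfolding fundamental_domain_def by (rule conjunct2)
  then have "\<exists>!v. v \<in> int_lattice \<and> x + v \<in> D" by (rule spec)
  then have "\<exists>v. (v \<in> int_lattice \<and> x + v \<in> D) \<and> (\<forall>w. w \<in> int_lattice \<and> x + w \<in> D \<longrightarrow> w = v)"
    by (simp only: Ex1_def)
  then obtain v where vu: "(v \<in> int_lattice \<and> x + v \<in> D) \<and>
      (\<forall>w. w \<in> int_lattice \<and> x + w \<in> D \<longrightarrow> w = v)"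
    by (rule exE)
  note v = conjunct1[OF vu] and u = conjunct2[OF vu]
  from v u show thesis by (elim conjE) (rule that)
qed

lemma fundamental_domainI:
  assumes "D \<in> sets borel"
    and "\<And>x. \<exists>v. v \<in> int_lattice \<and> x + v \<in> D \<and> (\<forall>w. w \<in> int_lattice \<and> x + w \<in> D \<longrightarrow> w = v)"
  shows "fundamental_domain D"
  unfolding fundamental_domain_def Ex1_def
  using assms(1) by (intro conjI allI) (simp_all only: conj_assoc assms(2))

lemma int_lattice_0 [simp]: "0 \<in> int_lattice"
  and int_lattice_add: "v \<in> int_lattice \<Longrightarrow> w \<in> int_lattice \<Longrightarrow> v + w \<in> int_lattice"
  and int_lattice_diff: "v \<in> int_lattice \<Longrightarrow> w \<in> int_lattice \<Longrightarrow> v - w \<in> int_lattice"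
  and int_lattice_minus_iff [simp]: "- v \<in> int_lattice \<longleftrightarrow> v \<in> int_lattice"
  by (simp_all add: int_lattice_def)

lemma axis_int_lattice: "axis i 1 \<in> int_lattice"
  by (auto simp: int_lattice_def axis_def)

lemma periodic_torus_proj: "periodic (\<lambda>x. h (torus_proj x))"
proof -
  have "torus_proj (x + v) = torus_proj x" if "v \<in> int_lattice" for x v :: "real ^ 'a"
    using that by (simp add: torus_proj_eq_iff)
  then show ?thesis by (simp add: periodic_def)
qed

lemma vfrac_in_unit_cube: "vfrac x \<in> unit_cube"
  by (auto simp: vfrac_def unit_cube_def frac_lt_1)

lemma vfrac_diff: "x - vfrac x \<in> int_lattice" "vfrac x - x \<in> int_lattice"
  by (simp_all add: vfrac_def int_lattice_def frac_def)

lemma torus_proj_vfrac [simp]: "torus_proj (vfrac x) = torus_proj x"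
  by (simp add: torus_proj_eq_iff vfrac_diff)

lemma int_lattice_coord_lt_1:
  "v \<in> int_lattice \<Longrightarrow> (\<And>i. \<bar>v $ i\<bar> < 1) \<Longrightarrow> v = 0"
  unfolding int_lattice_def vec_eq_iff by (simp add: Ints_eq_abs_less1)

lemma unit_cube_unique:
  assumes "x \<in> unit_cube" "y \<in> unit_cube" "x - y \<in> int_lattice"
  shows "x = y"
proof -
  have "\<bar>(x - y) $ i\<bar> < 1" for i
  proof -
    have "0 \<le> x $ i" "x $ i < 1" "0 \<le> y $ i" "y $ i < 1"
      using assms(1,2) by (auto simp: unit_cube_def)
    then show ?thesis by simp
  qed
  then have "x - y = 0"
    using assms(3) by (intro int_lattice_coord_lt_1)
  then show ?thesis by simp
qed

lemma norm_int_lattice_ge_1: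
  assumes "v \<in> int_lattice" "v \<noteq> 0" shows "1 \<le> norm v"
proof (rule ccontr)
  assume "\<not> 1 \<le> norm v"
  then have "\<bar>v $ i\<bar> < 1" for i
    using component_le_norm_cart[of v i] by linarith
  then show False using int_lattice_coord_lt_1 assms by blast
qed

lemma unit_cube_borel [measurable]: "unit_cube \<in> sets borel"
proof -
  have "{x :: real ^ 'a. \<forall>i. 0 \<le> x $ i \<and> x $ i < 1} \<in> sets borel" by measurable
  then show ?thesis by (simp add: unit_cube_def)
qed

lemma measurable_vfrac [measurable]: "vfrac \<in> borel \<rightarrow>\<^sub>M borel"
proof -
  have [measurable]: "frac \<in> borel_measurable (borel :: real measure)"
    unfolding frac_def by measurable
  have "(\<lambda>x :: real ^ 'a. vfrac x \<bullet> axis i 1) \<in> borel \<rightarrow>\<^sub>M borel" for i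
    by (simp add: vfrac_def inner_axis)
  then show ?thesis
    by (subst borel_measurable_euclidean_space) (auto simp: Basis_vec_def)
qed

lemma int_lattice_bounded_finite:
  assumes "bounded S" shows "finite (S \<inter> int_lattice)"
proof -
  obtain B where B: "\<And>x. x \<in> S \<Longrightarrow> norm x \<le> B" using assms by (auto simp: bounded_iff)
  let ?I = "of_int ` {- \<lceil>B\<rceil>..\<lceil>B\<rceil>} :: real set"
  have "S \<inter> int_lattice \<subseteq> vec_lambda ` (PiE UNIV (\<lambda>_. ?I))"
  proof
    fix x assume x: "x \<in> S \<inter> int_lattice"
    have "x $ i \<in> ?I" for i
    proof -
      obtain k where k: "x $ i = of_int k" using x by (auto simp: int_lattice_def Ints_def)
      have "\<bar>x $ i\<bar> \<le> B" using B x component_le_norm_cart[of x i] by force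
      then have "\<bar>k\<bar> \<le> \<lceil>B\<rceil>" using k by linarith
      then have "k \<in> {- \<lceil>B\<rceil>..\<lceil>B\<rceil>}" by (auto simp: abs_le_iff)
      then show ?thesis using k by blast
    qed
    then show "x \<in> vec_lambda ` (PiE UNIV (\<lambda>_. ?I))"
      by (intro image_eqI[of _ _ "vec_nth x"]) (auto simp: vec_nth_inverse)
  qed
  moreover have "finite (vec_lambda ` (PiE (UNIV :: 'a set) (\<lambda>_. ?I)))"
    by (intro finite_imageI finite_PiE) auto
  ultimately show ?thesis using finite_subset by blast
qed

lemma countable_int_lattice: "countable (int_lattice :: (real ^ 'n) set)"
proof -
  have "(int_lattice :: (real ^ 'n) set) = (\<Union>n::nat. cball 0 (real n) \<inter> int_lattice)"
  proof safe
    fix x :: "real ^ 'n" assume x: "x \<in> int_lattice"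
    obtain n :: nat where "norm x \<le> real n" using real_arch_simple by blast
    then show "x \<in> (\<Union>n::nat. cball 0 (real n) \<inter> int_lattice)" using x by auto
  qed
  moreover have "countable (\<Union>n::nat. cball 0 (real n) \<inter> (int_lattice :: (real ^ 'n) set))"
    by (intro countable_UN countableI_type countable_finite[OF int_lattice_bounded_finite]) auto
  ultimately show ?thesis by simp
qed

lemma closed_subset_int_lattice: "S \<subseteq> int_lattice \<Longrightarrow> closed S"
proof (rule discrete_imp_closed[of 1])
  assume S: "S \<subseteq> int_lattice"
  show "\<forall>x\<in>S. \<forall>y\<in>S. dist y x < 1 \<longrightarrow> y = x"
  proof (intro ballI impI)
    fix x y assume xy: "x \<in> S" "y \<in> S" "dist y x < 1"
    then have "y - x \<in> int_lattice" using S int_lattice_diff by blast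
    then have "y - x = 0" using norm_int_lattice_ge_1[of "y - x"] xy(3) by (auto simp: dist_norm)
    then show "y = x" by simp
  qed
qed simp

lemma fundamental_domain_unit_cube: "fundamental_domain unit_cube"
proof (rule fundamental_domainI)
  fix x :: "real ^ 'n"
  have 1: "vfrac x - x \<in> int_lattice" "x + (vfrac x - x) \<in> unit_cube"
    by (simp_all add: vfrac_diff vfrac_in_unit_cube)
  have 2: "v = vfrac x - x" if that: "v \<in> int_lattice \<and> x + v \<in> unit_cube" for v
  proof -
    have "x + v - vfrac x \<in> int_lattice"
      using that vfrac_diff(1)[of x] int_lattice_add[of v "x - vfrac x"] by (simp add: algebra_simps)
    then have "x + v = vfrac x" using that unit_cube_unique vfrac_in_unit_cube by blast
    then show ?thesis by (simp add: algebra_simps)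
  qed
  show "\<exists>v. v \<in> int_lattice \<and> x + v \<in> unit_cube \<and>
      (\<forall>w. w \<in> int_lattice \<and> x + w \<in> unit_cube \<longrightarrow> w = v)"
    by (rule exI[of _ "vfrac x - x"], intro conjI allI impI 1) (rule 2)
qed simp

text \<open>Cut the integral over \<open>D\<close> into the pieces that lie in the lattice translates of \<open>D'\<close> and move each piece
  into \<open>D'\<close>: by periodicity nothing changes, and the moved pieces cover \<open>D'\<close> exactly once.\<close>

lemma nn_integral_fundamental_domain:
  fixes f :: "real ^ 'n \<Rightarrow> ennreal"
  assumes "fundamental_domain D" "fundamental_domain D'" "periodic f"
    and f[measurable]: "f \<in> borel_measurable borel"
  shows "(\<integral>\<^sup>+x. indicator D x * f x \<partial>lborel) = (\<integral>\<^sup>+x. indicator D' x * f x \<partial>lborel)"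
proof -
  let ?L = "count_space (int_lattice :: (real ^ 'n) set)"
  interpret L: sigma_finite_measure ?L
    by (rule sigma_finite_measure_count_space_countable[OF countable_int_lattice])
  interpret P: pair_sigma_finite "lborel :: (real ^ 'n) measure" ?L ..
  have [measurable]: "D \<in> sets borel" "D' \<in> sets borel"
    using assms by (auto simp: fundamental_domain_def)
  have one: "(\<integral>\<^sup>+v. indicator B (x + v) \<partial>?L) = 1" "(\<integral>\<^sup>+v. indicator B (x - v) \<partial>?L) = 1"
    if B: "fundamental_domain B" for B and x :: "real ^ 'n"
  proof -
    obtain v where v: "v \<in> int_lattice" "x + v \<in> B"
      and u': "\<forall>w. w \<in> int_lattice \<and> x + w \<in> B \<longrightarrow> w = v"
      by (rule fundamental_domainE[OF B, of x])
    note u = u'[THEN spec, THEN mp, OF conjI]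
    have "indicator B (x + w) = (indicator {v} w :: ennreal)" if "w \<in> int_lattice" for w
    proof (cases "w = v")
      case False
      then have "x + w \<notin> B" using u[OF that] by blast
      then show ?thesis using False by simp
    qed (use v in simp)
    note ind = this
    have "(\<integral>\<^sup>+v. indicator B (x + v) \<partial>?L) = (\<integral>\<^sup>+w. indicator {v} w \<partial>?L)"
      by (rule nn_integral_cong) (simp add: ind)
    then show "(\<integral>\<^sup>+v. indicator B (x + v) \<partial>?L) = 1" using v(1) by simp
    have "indicator B (x - w) = (indicator {- v} w :: ennreal)" if "w \<in> int_lattice" for w
      using ind[of "- w"] that by (simp add: indicator_def equation_minus_iff eq_commute)
    then have "(\<integral>\<^sup>+v. indicator B (x - v) \<partial>?L) = (\<integral>\<^sup>+w. indicator {- v} w \<partial>?L)"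
      by (intro nn_integral_cong) simp
    then show "(\<integral>\<^sup>+v. indicator B (x - v) \<partial>?L) = 1" using v(1) by simp
  qed
  have meas: "(\<lambda>(x, v). g x v) \<in> borel_measurable (lborel \<Otimes>\<^sub>M ?L)"
    if "\<And>v. (\<lambda>x. g x v) \<in> borel_measurable borel" for g :: "real ^ 'n \<Rightarrow> real ^ 'n \<Rightarrow> ennreal"
  proof -
    have "(\<lambda>(v, x). g x v) \<in> borel_measurable (?L \<Otimes>\<^sub>M lborel)"
      using that by (intro measurable_pair_measure_countable1 countable_int_lattice) auto
    from measurable_pair_swap[OF this] show ?thesis by (simp add: case_prod_unfold)
  qed
  have "(\<integral>\<^sup>+x. indicator D x * f x \<partial>lborel)
      = (\<integral>\<^sup>+x. \<integral>\<^sup>+v. indicator D x * f x * indicator D' (x + v) \<partial>?L \<partial>lborel)"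
    using one(1)[OF assms(2)] by (simp add: nn_integral_cmult)
  also have "\<dots> = (\<integral>\<^sup>+v. \<integral>\<^sup>+x. indicator D x * f x * indicator D' (x + v) \<partial>lborel \<partial>?L)"
    by (rule P.Fubini'[symmetric], rule meas) measurable
  also have "\<dots> = (\<integral>\<^sup>+v. \<integral>\<^sup>+x. indicator D (x - v) * f x * indicator D' x \<partial>lborel \<partial>?L)"
  proof (rule nn_integral_cong)
    fix v :: "real ^ 'n" assume "v \<in> space ?L"
    then have "- v \<in> int_lattice" by simp
    then have p: "f (x - v) = f x" for x
      using assms(3) unfolding periodic_def by (metis diff_conv_add_uminus)
    have "(\<integral>\<^sup>+x. indicator D x * f x * indicator D' (x + v) \<partial>lborel)
        = (\<integral>\<^sup>+x. indicator D (- v + x) * f (- v + x) * indicator D' (- v + x + v) \<partial>lborel)"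
      by (rule nn_integral_lborel_translate[symmetric]) measurable
    then show "(\<integral>\<^sup>+x. indicator D x * f x * indicator D' (x + v) \<partial>lborel)
        = (\<integral>\<^sup>+x. indicator D (x - v) * f x * indicator D' x \<partial>lborel)"
      by (simp add: p)
  qed
  also have "\<dots> = (\<integral>\<^sup>+x. \<integral>\<^sup>+v. indicator D (x - v) * f x * indicator D' x \<partial>?L \<partial>lborel)"
    by (rule P.Fubini', rule meas) measurable
  also have "\<dots> = (\<integral>\<^sup>+x. (\<integral>\<^sup>+v. indicator D (x - v) \<partial>?L) * (f x * indicator D' x) \<partial>lborel)"
    by (subst nn_integral_multc[symmetric]) (auto simp: mult.assoc)
  also have "\<dots> = (\<integral>\<^sup>+x. indicator D' x * f x \<partial>lborel)"
    using one(2)[OF assms(1)] by (simp add: mult.commute)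
  finally show ?thesis .
qed

lemma sets_cube_lebesgue [simp, measurable_cong]: "sets cube_lebesgue = sets borel"
  by (simp add: cube_lebesgue_def)

lemma space_cube_lebesgue [simp]: "space cube_lebesgue = UNIV"
  by (simp add: cube_lebesgue_def)

lemma nn_integral_cube_lebesgue:
  assumes "f \<in> borel_measurable borel"
  shows "(\<integral>\<^sup>+x. f x \<partial>cube_lebesgue) = (\<integral>\<^sup>+x. indicator unit_cube x * f x \<partial>lborel)"
  unfolding cube_lebesgue_def using assms by (subst nn_integral_density) auto

lemma torus_lebesgue_eq_distr: "(torus_lebesgue :: ('n :: finite) torus measure) = distr cube_lebesgue borel torus_proj"
proof (rule measure_eqI)
  fix A :: "'n torus set" assume "A \<in> sets torus_lebesgue"
  then have A[measurable]: "A \<in> sets borel" by (simp add: torus_lebesgue_def)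
  have [measurable]: "torus_proj -` A \<in> sets borel"
    using measurable_sets[OF measurable_torus_proj A] by simp
  have "emeasure torus_lebesgue A = emeasure (restrict_space lborel unit_cube) (torus_proj -` A \<inter> unit_cube)"
    unfolding torus_lebesgue_def unit_cube_def[symmetric]
    by (subst emeasure_distr) (auto intro!: measurable_restrict_space1 simp: space_restrict_space)
  also have "\<dots> = emeasure lborel (torus_proj -` A \<inter> unit_cube)"
    by (subst emeasure_restrict_space) auto
  also have "\<dots> = emeasure (distr cube_lebesgue borel torus_proj) A"
    unfolding cube_lebesgue_def
    by (subst emeasure_distr) (auto simp: emeasure_density indicator_inter_arith[symmetric] Int_commute)
  finally show "emeasure torus_lebesgue A = emeasure (distr cube_lebesgue borel torus_proj) A" .
qed (simp add: torus_lebesgue_def)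

lemma prob_space_cube_lebesgue: "prob_space (cube_lebesgue :: (real ^ 'n) measure)"
proof -
  have "emeasure (torus_lebesgue :: 'n torus measure) UNIV = 1"
    using prob_space.emeasure_space_1[OF prob_space_torus_lebesgue] by (simp add: torus_lebesgue_def)
  then show ?thesis
    unfolding torus_lebesgue_eq_distr by (intro prob_spaceI) (simp add: emeasure_distr)
qed

interpretation cube: prob_space "cube_lebesgue :: (real ^ 'n) measure"
  by (rule prob_space_cube_lebesgue)

lemma AE_cube_lebesgue_iff: "(AE x in cube_lebesgue. P x) \<longleftrightarrow> (AE x in lborel. x \<in> unit_cube \<longrightarrow> P x)"
  unfolding cube_lebesgue_def by (subst AE_density) (auto simp: indicator_def)

lemma AE_cube_in_unit_cube: "AE x in cube_lebesgue. x \<in> unit_cube"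
  by (simp add: AE_cube_lebesgue_iff)

lemma cube_lebesgue_translate:
  fixes f :: "real ^ 'n \<Rightarrow> ennreal"
  assumes "periodic f" and [measurable]: "f \<in> borel_measurable borel"
  shows "(\<integral>\<^sup>+x. f (c + x) \<partial>cube_lebesgue) = (\<integral>\<^sup>+x. f x \<partial>cube_lebesgue)"
proof -
  let ?D = "(\<lambda>x. x - c) -` (unit_cube :: (real ^ 'n) set)"
  have [measurable]: "?D \<in> sets borel"
    by (rule measurable_sets_borel[of _ borel]) measurable
  have "fundamental_domain ?D"
  proof (rule fundamental_domainI)
    fix x
    obtain v where v: "v \<in> int_lattice" "x - c + v \<in> unit_cube"
      and u': "\<forall>w. w \<in> int_lattice \<and> x - c + w \<in> unit_cube \<longrightarrow> w = v"
      by (rule fundamental_domainE[OF fundamental_domain_unit_cube, of "x - c"])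
    note u = u'[THEN spec, THEN mp, OF conjI]
    have eq: "x + w - c = x - c + w" for w by simp
    show "\<exists>v. v \<in> int_lattice \<and> x + v \<in> ?D \<and> (\<forall>w. w \<in> int_lattice \<and> x + w \<in> ?D \<longrightarrow> w = v)"
      unfolding vimage_eq eq using v u' by (intro exI[of _ v] conjI)
  qed simp
  have "(\<integral>\<^sup>+x. f (c + x) \<partial>cube_lebesgue) = (\<integral>\<^sup>+x. indicator ?D (c + x) * f (c + x) \<partial>lborel)"
    by (subst nn_integral_cube_lebesgue) (auto intro!: nn_integral_cong split: split_indicator)
  also have "\<dots> = (\<integral>\<^sup>+x. indicator ?D x * f x \<partial>lborel)"
    by (rule nn_integral_lborel_translate) measurable
  also have "\<dots> = (\<integral>\<^sup>+x. f x \<partial>cube_lebesgue)"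
    using nn_integral_fundamental_domain[OF \<open>fundamental_domain ?D\<close> fundamental_domain_unit_cube assms]
    by (simp add: nn_integral_cube_lebesgue)
  finally show ?thesis .
qed

section \<open>Inverse branches of an expanding toral endomorphism\<close>

locale toral_expansion =
  fixes E :: "real ^ 'u \<Rightarrow> real ^ 'u"
  assumes E: "expanding E"
begin

abbreviation "iE \<equiv> inv E"

text \<open>Representatives of the lattice modulo its image under \<open>E\<close>: the image of the unit cube is a
  fundamental domain for that sublattice.\<close>

definition digits :: "(real ^ 'u) set" where
  "digits = int_lattice \<inter> E ` unit_cube"

lemma linear_E: "linear E" and bij_E: "bij E"
  and E_int: "v \<in> int_lattice \<Longrightarrow> E v \<in> int_lattice" and onorm_iE: "onorm iE < 1"
  using E by (auto simp: expanding_def)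

lemma iE_E [simp]: "iE (E x) = x" and E_iE [simp]: "E (iE x) = x"
  using bij_E by (auto simp: bij_def surj_f_inv_f)

lemma linear_iE: "linear iE"
  by (rule inj_linear_imp_inv_linear[OF linear_E]) (use bij_E bij_is_inj in blast)

lemma E_eq_iff [simp]: "E x = E y \<longleftrightarrow> x = y"
  by (metis iE_E)

lemma norm_iE_less: "x \<noteq> 0 \<Longrightarrow> norm (iE x) < norm x"
proof -
  assume "x \<noteq> 0"
  have "norm (iE x) \<le> onorm iE * norm x"
    using linear_iE by (intro onorm) (simp add: linear_linear)
  also have "\<dots> < 1 * norm x" using onorm_iE \<open>x \<noteq> 0\<close> by (intro mult_strict_right_mono) auto
  finally show ?thesis by simp
qed

lemma measurable_E [measurable]: "E \<in> borel \<rightarrow>\<^sub>M borel"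
  and measurable_iE [measurable]: "iE \<in> borel \<rightarrow>\<^sub>M borel"
  using linear_E linear_iE
  by (auto intro!: borel_measurable_continuous_onI linear_continuous_on simp: linear_linear)

lemma finite_digits: "finite digits"
proof -
  have "bounded (unit_cube :: (real ^ 'u) set)"
    by (rule bounded_subset[of "cbox 0 1"]) (auto simp: unit_cube_def mem_box_cart less_imp_le)
  then have "bounded (E ` unit_cube)"
    using linear_E by (intro bounded_linear_image) (simp_all add: linear_linear)
  then show ?thesis unfolding digits_def using int_lattice_bounded_finite[of "E ` unit_cube"]
    by (simp add: Int_commute)
qed

lemma digits_int: "a \<in> digits \<Longrightarrow> a \<in> int_lattice"
  by (simp add: digits_def)

lemma digit_ex:
  assumes "w \<in> int_lattice"
  obtains a v where "a \<in> digits" "v \<in> int_lattice" "w = a + E v"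
proof
  let ?y = "iE w"
  have "E (vfrac ?y) = w - E (?y - vfrac ?y)"
    using linear_E by (simp add: linear_diff)
  then have "E (vfrac ?y) \<in> int_lattice"
    using int_lattice_diff[OF assms E_int[OF vfrac_diff(1)[of ?y]]] by simp
  then show "E (vfrac ?y) \<in> digits"
    unfolding digits_def using vfrac_in_unit_cube by blast
  show "?y - vfrac ?y \<in> int_lattice" by (rule vfrac_diff)
  show "w = E (vfrac ?y) + E (?y - vfrac ?y)"
    using linear_E by (simp add: linear_diff)
qed

lemma digit_unique:
  assumes "a \<in> digits" "b \<in> digits" "a - b = E v" "v \<in> int_lattice"
  shows "a = b"
proof -
  obtain x y where x: "x \<in> unit_cube" "a = E x" and y: "y \<in> unit_cube" "b = E y"
    using assms by (auto simp: digits_def)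
  then have "E (x - y) = E v" using assms(3) linear_E by (simp add: linear_diff)
  then have "x - y \<in> int_lattice" using assms(4) by simp
  then show ?thesis using unit_cube_unique x y by blast
qed

text \<open>A unit vector of the lattice is not in the image of the lattice, because its preimage is shorter
  than \<open>1\<close>; so there is a digit besides \<open>0\<close>.\<close>

lemma card_digits_ge_2: "2 \<le> card digits"
proof -
  have "axis (undefined :: 'u) (1 :: real) \<in> int_lattice" by (rule axis_int_lattice)
  then obtain a v where a: "a \<in> digits" "v \<in> int_lattice" "axis (undefined :: 'u) 1 = a + E v"
    by (rule digit_ex)
  have 0: "0 \<in> digits"
    unfolding digits_def using linear_0[OF linear_E] by (auto simp: unit_cube_def intro!: image_eqI[of _ _ 0])
  have "a \<noteq> 0"
  proof
    assume "a = 0"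
    have n1: "norm (axis (undefined :: 'u) (1 :: real)) = 1" by simp
    have "v = iE (axis (undefined :: 'u) 1)" using a \<open>a = 0\<close> by simp
    moreover have "axis (undefined :: 'u) (1 :: real) \<noteq> 0" by (simp add: axis_eq_0_iff)
    ultimately have "norm v < 1" "v \<noteq> 0"
      using norm_iE_less[of "axis (undefined :: 'u) 1"] n1 a \<open>a = 0\<close> linear_0[OF linear_E] by force+
    then show False using norm_int_lattice_ge_1 a by fastforce
  qed
  then have "card {0, a} \<le> card digits" using a 0 finite_digits by (intro card_mono) auto
  then show ?thesis using \<open>a \<noteq> 0\<close> by simp
qed

lemma det_E: "det (matrix E) \<noteq> 0"
  using linear_E bij_E det_nz_iff_inj bij_is_inj by blast

text \<open>The sets \<open>E\<^sup>-\<^sup>1(Q + a)\<close>, for the unit cube \<open>Q\<close> and the digits \<open>a\<close>, together form a fundamental domain.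
  Comparing it with \<open>Q\<close> gives the transfer formula and, for the constant function, the number of digits.\<close>

lemma nn_integral_inverse_branches':
  fixes f :: "real ^ 'u \<Rightarrow> ennreal"
  assumes "periodic f" and [measurable]: "f \<in> borel_measurable borel"
  shows "ennreal \<bar>det (matrix E)\<bar> * (\<integral>\<^sup>+x. f x \<partial>cube_lebesgue) =
    (\<Sum>a\<in>digits. \<integral>\<^sup>+x. f (iE (x + a)) \<partial>cube_lebesgue)"
proof -
  let ?D = "\<Union>a\<in>digits. {x. E x - a \<in> unit_cube}"
  have [measurable]: "{x. E x - a \<in> unit_cube} \<in> sets borel" for a by measurable
  have "fundamental_domain ?D"
  proof (rule fundamental_domainI)
    show "?D \<in> sets borel" using finite_digits by (intro sets.finite_UN) auto
    fix x
    obtain w where w: "w \<in> int_lattice" "E x + w \<in> unit_cube"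
      and u': "\<forall>w'. w' \<in> int_lattice \<and> E x + w' \<in> unit_cube \<longrightarrow> w' = w"
      by (rule fundamental_domainE[OF fundamental_domain_unit_cube, of "E x"])
    note w_unique = u'[THEN spec, THEN mp, OF conjI]
    obtain a v where av: "a \<in> digits" "v \<in> int_lattice" "- w = a + E v"
      using digit_ex[of "- w"] w by auto
    have w_eq: "w = E (- v) - a"
      using arg_cong[OF av(3), of uminus] by (simp add: linear_neg[OF linear_E])
    have "E (x + - v) - a = E x + w" using w_eq linear_E by (simp only: linear_add) simp
    then have "E (x + - v) - a \<in> unit_cube" using w(2) by simp
    then have 1: "- v \<in> int_lattice" "x + - v \<in> ?D" using av(1,2) by auto
    have 2: "v' = - v" if v': "v' \<in> int_lattice \<and> x + v' \<in> ?D" for v'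
    proof -
      obtain b where b: "b \<in> digits" "E (x + v') - b \<in> unit_cube" using v' by auto
      have e: "E (x + v') - b = E x + (E v' - b)" using linear_E by (simp add: linear_add)
      have i: "E v' - b \<in> int_lattice" using b v' E_int int_lattice_diff digits_int by blast
      have "E v' - b = w" by (rule w_unique[OF i b(2)[unfolded e]])
      then have "b - a = E (v' + v)"
        using w_eq by (simp add: linear_add[OF linear_E] linear_neg[OF linear_E] algebra_simps)
      moreover have "v' + v \<in> int_lattice" using v' av int_lattice_add by blast
      ultimately have "b = a" using digit_unique[of b a "v' + v"] b av by blast
      then have "E (v' + v) = E 0" using \<open>b - a = E (v' + v)\<close> linear_0[OF linear_E] by simp
      then show "v' = - v" by (simp add: eq_neg_iff_add_eq_0)
    qed
    show "\<exists>v. v \<in> int_lattice \<and> x + v \<in> ?D \<and> (\<forall>w. w \<in> int_lattice \<and> x + w \<in> ?D \<longrightarrow> w = v)"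
      by (rule exI[of _ "- v"], intro conjI allI impI 1) (rule 2)
  qed
  have ind: "indicator ?D x = (\<Sum>a\<in>digits. indicator {x. E x - a \<in> unit_cube} x :: ennreal)" for x
  proof -
    have disj: "a = b" if "a \<in> digits" "b \<in> digits" "E x - a \<in> unit_cube" "E x - b \<in> unit_cube" for a b
      using unit_cube_unique[OF that(3,4)] that(1,2) int_lattice_diff[of b a] digits_int by simp
    show ?thesis
    proof (cases "x \<in> ?D")
      case True
      then obtain a where a: "a \<in> digits" "E x - a \<in> unit_cube" by auto
      have one: "indicator {x. E x - b \<in> unit_cube} x = (if b = a then 1 else 0 :: ennreal)"
        if b: "b \<in> digits" for b
      proof (cases "b = a")
        case False
        then have "E x - b \<notin> unit_cube" using disj[OF b a(1) _ a(2)] by blast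
        then show ?thesis using False by simp
      qed (use a in simp)
      have "(\<Sum>b\<in>digits. indicator {x. E x - b \<in> unit_cube} x) = (1 :: ennreal)"
        using a(1) finite_digits by (simp add: one cong: sum.cong)
      then show ?thesis using True by simp
    qed simp
  qed
  have "ennreal \<bar>det (matrix E)\<bar> * (\<integral>\<^sup>+x. f x \<partial>cube_lebesgue)
      = ennreal \<bar>det (matrix E)\<bar> * (\<integral>\<^sup>+x. indicator ?D x * f x \<partial>lborel)"
    using nn_integral_fundamental_domain[OF \<open>fundamental_domain ?D\<close> fundamental_domain_unit_cube assms]
    by (simp add: nn_integral_cube_lebesgue)
  also have "\<dots> = (\<Sum>a\<in>digits. ennreal \<bar>det (matrix E)\<bar> *
      (\<integral>\<^sup>+x. indicator {x. E x - a \<in> unit_cube} x * f x \<partial>lborel))"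
    unfolding ind by (simp add: sum_distrib_right nn_integral_sum sum_distrib_left)
  also have "\<dots> = (\<Sum>a\<in>digits. \<integral>\<^sup>+x. f (iE (x + a)) \<partial>cube_lebesgue)"
  proof (rule sum.cong[OF refl])
    fix a assume "a \<in> digits"
    have "ennreal \<bar>det (matrix E)\<bar> * (\<integral>\<^sup>+x. indicator {x. E x - a \<in> unit_cube} x * f x \<partial>lborel) =
      ennreal \<bar>det (matrix E)\<bar> * (\<integral>\<^sup>+x. indicator unit_cube (E x - a) * f (iE (E x)) \<partial>lborel)"
      by (simp add: indicator_def)
    also have "\<dots> = (\<integral>\<^sup>+x. indicator unit_cube (x - a) * f (iE x) \<partial>lborel)"
      by (rule nn_integral_lborel_linear[OF linear_E]) (use bij_E bij_is_inj in auto)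
    also have "\<dots> = (\<integral>\<^sup>+x. indicator unit_cube (a + x - a) * f (iE (a + x)) \<partial>lborel)"
      by (rule nn_integral_lborel_translate[symmetric]) measurable
    finally show "ennreal \<bar>det (matrix E)\<bar> * (\<integral>\<^sup>+x. indicator {x. E x - a \<in> unit_cube} x * f x \<partial>lborel)
        = (\<integral>\<^sup>+x. f (iE (x + a)) \<partial>cube_lebesgue)"
      by (simp add: nn_integral_cube_lebesgue add.commute)
  qed
  finally show ?thesis .
qed

lemma card_digits: "real (card digits) = \<bar>det (matrix E)\<bar>"
proof -
  have "periodic (\<lambda>_ :: real ^ 'u. 1 :: ennreal)" by (simp add: periodic_def)
  from nn_integral_inverse_branches'[OF this]
  have "ennreal \<bar>det (matrix E)\<bar> = of_nat (card digits)" by (simp add: cube.emeasure_space_1[simplified])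
  then show ?thesis by (simp add: ennreal_of_nat_eq_real_of_nat)
qed

lemma nn_integral_inverse_branches:
  fixes f :: "real ^ 'u \<Rightarrow> ennreal"
  assumes "periodic f" "f \<in> borel_measurable borel"
  shows "(\<Sum>a\<in>digits. \<integral>\<^sup>+x. f (iE (x + a)) \<partial>cube_lebesgue) = of_nat (card digits) * (\<integral>\<^sup>+x. f x \<partial>cube_lebesgue)"
  using nn_integral_inverse_branches'[OF assms] card_digits by (simp add: ennreal_of_nat_eq_real_of_nat)

end

section \<open>The torus as a topological space\<close>

lemma continuous_on_torus_iff:
  fixes h :: "('n :: finite) torus \<Rightarrow> 'b :: topological_space"
  shows "continuous_on UNIV h \<longleftrightarrow> continuous_on UNIV (\<lambda>x. h (torus_proj x))"
proof
  assume "continuous_on UNIV h"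
  then show "continuous_on UNIV (\<lambda>x. h (torus_proj x))"
    using continuous_on_compose2[OF _ continuous_torus_proj] by blast
next
  assume "continuous_on UNIV (\<lambda>x. h (torus_proj x))"
  then have "open (torus_proj -` (h -` V))" if "open V" for V
    using that by (auto simp: continuous_on_open_vimage vimage_def)
  then show "continuous_on UNIV h"
    by (auto simp: continuous_on_open_vimage open_torus_def)
qed

lemma torus_proj_image_cbox: "torus_proj ` cbox 0 1 = (UNIV :: ('n :: finite) torus set)"
proof -
  have "p \<in> torus_proj ` cbox 0 1" for p :: "'n torus"
  proof (rule image_eqI)
    show "p = torus_proj (vfrac (rep_torus p))" by simp
    show "vfrac (rep_torus p) \<in> cbox 0 1"
      using vfrac_in_unit_cube[of "rep_torus p"] by (auto simp: unit_cube_def mem_box_cart less_imp_le)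
  qed
  then show ?thesis by auto
qed

lemma compact_torus: "compact (UNIV :: ('n :: finite) torus set)"
  unfolding torus_proj_image_cbox[symmetric]
  by (rule compact_continuous_image[OF continuous_on_subset[OF continuous_torus_proj]]) auto

lemma bounded_on_torus:
  fixes g :: "('n :: finite) torus \<Rightarrow> 'b :: real_normed_vector"
  assumes "continuous_on UNIV g"
  obtains B where "B \<ge> 0" "\<And>p. norm (g p) \<le> B"
proof -
  have "bounded (range g)" using compact_continuous_image[OF assms compact_torus] by (rule compact_imp_bounded)
  then obtain B where B: "\<And>p. norm (g p) \<le> B" by (auto simp: bounded_iff)
  then show thesis using that[of B] norm_ge_zero order_trans by metis
qed

section \<open>Random backward orbits and the invariant measure\<close>

text \<open>By compactness of the unit sphere the pointwise strict inequality is uniform.\<close>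

lemma contracting_bound:
  assumes "contracting C"
  obtains r where "0 \<le> r" "r < 1" "\<And>v. norm (C v) \<le> r * norm v"
proof -
  have lin: "linear C" using assms by (simp add: contracting_def)
  have "compact (sphere (0 :: real ^ 'a) 1)" by simp
  moreover have "sphere (0 :: real ^ 'a) 1 \<noteq> {}" by simp
  moreover have "continuous_on (sphere 0 1) (\<lambda>v. norm (C v))"
    using lin by (intro continuous_on_norm linear_continuous_on) (simp add: linear_linear)
  ultimately obtain v0 where v0: "v0 \<in> sphere 0 1" "\<And>v. v \<in> sphere 0 1 \<Longrightarrow> norm (C v) \<le> norm (C v0)"
    using continuous_attains_sup by metis
  have "norm (C v0) < 1"
  proof -
    have "v0 \<noteq> 0" "norm v0 = 1" using v0(1) by auto
    then show ?thesis using assms unfolding contracting_def by metis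
  qed
  moreover have "norm (C v) \<le> norm (C v0) * norm v" for v
  proof (cases "v = 0")
    case True
    then show ?thesis using linear_0[OF lin] by simp
  next
    case False
    have "norm (C ((1 / norm v) *\<^sub>R v)) \<le> norm (C v0)" using False by (intro v0(2)) simp
    then have "norm (C v) / norm v \<le> norm (C v0)" by (simp add: linear_scale[OF lin])
    then show ?thesis using False by (simp add: divide_le_eq)
  qed
  ultimately show thesis using that[of "norm (C v0)"] by simp
qed

locale skew_system = toral_expansion E for E :: "real ^ 'u \<Rightarrow> real ^ 'u" +
  fixes C :: "real ^ 'd \<Rightarrow> real ^ 'd"
  assumes C: "contracting C"
begin

definition rate :: real where
  "rate = (SOME r. 0 \<le> r \<and> r < 1 \<and> (\<forall>v. norm (C v) \<le> r * norm v))"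

lemma rate: "0 \<le> rate" "rate < 1" "norm (C v) \<le> rate * norm v"
proof -
  have "\<exists>r. 0 \<le> r \<and> r < 1 \<and> (\<forall>v. norm (C v) \<le> r * norm v)"
    using contracting_bound[OF C] by metis
  from someI_ex[OF this] show "0 \<le> rate" "rate < 1" "norm (C v) \<le> rate * norm v"
    unfolding rate_def by auto
qed

lemma linear_C: "linear C"
  using C by (simp add: contracting_def)

lemma linear_Cpow: "linear (C ^^ n)"
proof (induction n)
  case (Suc n)
  show ?case unfolding funpow.simps by (rule linear_compose[OF Suc linear_C])
qed (simp add: id_def[symmetric] linear_id)

lemma norm_Cpow: "norm ((C ^^ n) v) \<le> rate ^ n * norm v"
proof (induction n)
  case (Suc n)
  have "norm ((C ^^ Suc n) v) \<le> rate * norm ((C ^^ n) v)" using rate(3) by simp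
  also have "\<dots> \<le> rate * (rate ^ n * norm v)" using Suc rate(1) by (intro mult_left_mono)
  finally show ?case by (simp add: mult.assoc)
qed simp

lemma continuous_C: "continuous_on A C" and continuous_Cpow: "continuous_on A (C ^^ n)"
  using linear_C linear_Cpow by (auto intro!: linear_continuous_on simp: linear_linear)

lemma summable_rate: "summable (\<lambda>i. rate ^ i * B)"
  using rate by (intro summable_mult2 summable_geometric) auto

text \<open>Transported to the Borel sets, so that the entries of a random stream of digits are Borel measurable.\<close>

definition digit_measure :: "(real ^ 'u) measure" where
  "digit_measure = distr (measure_pmf (pmf_of_set digits)) borel (\<lambda>a. a)"

abbreviation "Str \<equiv> stream_space digit_measure"

lemma sets_digit_measure [simp, measurable_cong]: "sets digit_measure = sets borel"
  by (simp add: digit_measure_def)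

lemma space_digit_measure [simp]: "space digit_measure = UNIV"
  by (simp add: digit_measure_def)

lemma space_Str [simp]: "space Str = UNIV"
  by (simp add: space_stream_space)

sublocale D: prob_space digit_measure
  unfolding digit_measure_def
  by (rule prob_space.prob_space_distr) (auto intro: prob_space_measure_pmf)

sublocale Str: prob_space Str
  by (rule D.prob_space_stream_space)

sublocale QStr: pair_prob_space cube_lebesgue Str ..

lemma digits_nonempty: "digits \<noteq> {}"
  using card_digits_ge_2 by auto

lemma nn_integral_digit_measure:
  assumes "f \<in> borel_measurable borel"
  shows "(\<integral>\<^sup>+a. f a \<partial>digit_measure) = (\<Sum>a\<in>digits. f a) / of_nat (card digits)"
  unfolding digit_measure_def using assms finite_digits digits_nonempty
  by (subst nn_integral_distr) (auto simp: nn_integral_pmf_of_set)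

text \<open>Folding the preimage back into the unit cube fixes one lift of each point of the torus. Otherwise the
  digits along a backward orbit would depend on the lattice translate reached by the inverse branches.\<close>

definition branch :: "real ^ 'u \<Rightarrow> real ^ 'u \<Rightarrow> real ^ 'u" where
  "branch x a = vfrac (iE (x + a))"

primrec backward :: "nat \<Rightarrow> real ^ 'u \<Rightarrow> (real ^ 'u) stream \<Rightarrow> real ^ 'u" where
  "backward 0 x \<omega> = branch x (shd \<omega>)"
| "backward (Suc n) x \<omega> = backward n (branch x (shd \<omega>)) (stl \<omega>)"

definition height :: "('u torus \<Rightarrow> real ^ 'd) \<Rightarrow> real ^ 'u \<Rightarrow> (real ^ 'u) stream \<Rightarrow> real ^ 'd" where
  "height g x \<omega> = (\<Sum>i. (C ^^ i) (g (torus_proj (backward i x \<omega>))))"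

text \<open>The law of the limiting position over a uniform point whose past is chosen at random; it is shown to be
  the SRB measure.\<close>

definition graph_measure :: "('u torus \<Rightarrow> real ^ 'd) \<Rightarrow> ('u torus \<times> (real ^ 'd)) measure" where
  "graph_measure g = distr (cube_lebesgue \<Otimes>\<^sub>M Str) borel (\<lambda>(x, \<omega>). (torus_proj x, height g x \<omega>))"

lemma measurable_branch [measurable]: "(\<lambda>(x, a). branch x a) \<in> borel \<Otimes>\<^sub>M borel \<rightarrow>\<^sub>M borel"
  unfolding branch_def by measurable

lemma measurable_backward [measurable]: "(\<lambda>(x, \<omega>). backward n x \<omega>) \<in> borel \<Otimes>\<^sub>M Str \<rightarrow>\<^sub>M borel"
proof (induction n)
  case (Suc n)
  note [measurable] = Suc
  have "(\<lambda>z. (\<lambda>(x, \<omega>). backward n x \<omega>) ((\<lambda>(x, a). branch x a) (fst z, shd (snd z)), stl (snd z)))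
      \<in> borel \<Otimes>\<^sub>M Str \<rightarrow>\<^sub>M borel"
    by measurable
  then show ?case by (simp add: case_prod_unfold)
next
  case 0
  have "(\<lambda>z. (\<lambda>(x, a). branch x a) (fst z, shd (snd z))) \<in> borel \<Otimes>\<^sub>M Str \<rightarrow>\<^sub>M borel"
    by measurable
  then show ?case by (simp add: case_prod_unfold)
qed

lemma torus_map_torus_proj [simp]: "torus_map E (torus_proj x) = torus_proj (E x)"
  using linear_E E_int by (intro torus_map_proj) auto

lemma torus_map_branch:
  assumes "a \<in> digits"
  shows "torus_map E (torus_proj (branch x a)) = torus_proj x"
proof -
  have "torus_map E (torus_proj (branch x a)) = torus_proj (x + a)"
    by (simp only: branch_def torus_proj_vfrac torus_map_torus_proj E_iE)
  also have "\<dots> = torus_proj x" using digits_int[OF assms] by (simp add: torus_proj_eq_iff)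
  finally show ?thesis .
qed

context
  fixes g :: "'u torus \<Rightarrow> real ^ 'd"
  assumes g: "continuous_on UNIV g"
begin

lemma measurable_g [measurable]: "g \<in> borel_measurable borel"
  using g by (rule borel_measurable_continuous_onI)

lemma summable_height: "summable (\<lambda>i. (C ^^ i) (g (p i)))"
proof -
  obtain B where B: "\<And>p. norm (g p) \<le> B" using bounded_on_torus[OF g] by blast
  have "norm ((C ^^ i) (g (p i))) \<le> rate ^ i * B" for i
    using norm_Cpow[of i "g (p i)"] B[of "p i"] rate(1)
    by (meson mult_left_mono order_trans zero_le_power)
  then show ?thesis by (rule summable_comparison_test'[OF summable_rate])
qed

lemma height_bounded:
  obtains B where "B \<ge> 0" "\<And>x \<omega>. norm (height g x \<omega>) \<le> B"
proof -
  obtain B where B: "B \<ge> 0" "\<And>p. norm (g p) \<le> B" using bounded_on_torus[OF g] by blast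
  have le: "norm ((C ^^ i) (g p)) \<le> rate ^ i * B" for i p
    using norm_Cpow[of i "g p"] B(2)[of p] rate(1)
    by (meson mult_left_mono order_trans zero_le_power)
  have "norm (height g x \<omega>) \<le> (\<Sum>i. rate ^ i * B)" for x \<omega>
    unfolding height_def using le by (intro norm_suminf_le summable_rate)
  moreover have "0 \<le> (\<Sum>i. rate ^ i * B)" using rate(1) B(1) by (intro suminf_nonneg summable_rate) simp
  ultimately show thesis using that by blast
qed

text \<open>The equation that makes the graph measure invariant: prefixing the digit stream by \<open>a\<close> is the same as
  applying the skew product at the preimage selected by \<open>a\<close>.\<close>

lemma height_Stream:
  "height g x (a ## \<omega>) = g (torus_proj (branch x a)) + C (height g (branch x a) \<omega>)"
proof -
  let ?f = "\<lambda>i. (C ^^ i) (g (torus_proj (backward i x (a ## \<omega>))))"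
  have "height g x (a ## \<omega>) = ?f 0 + (\<Sum>i. ?f (Suc i))"
    unfolding height_def using summable_height by (subst suminf_split_head) auto
  also have "(\<Sum>i. ?f (Suc i)) = (\<Sum>i. C ((C ^^ i) (g (torus_proj (backward i (branch x a) \<omega>)))))"
    by simp
  also have "\<dots> = C (height g (branch x a) \<omega>)"
    unfolding height_def using linear_C
    by (intro bounded_linear.suminf[symmetric] summable_height) (simp add: linear_linear)
  finally show ?thesis by simp
qed

lemma measurable_height [measurable]: "(\<lambda>(x, \<omega>). height g x \<omega>) \<in> borel_measurable (borel \<Otimes>\<^sub>M Str)"
proof (rule borel_measurable_LIMSEQ_metric)
  fix n
  have [measurable]: "(C ^^ i) \<in> borel_measurable borel" for i
    by (intro borel_measurable_continuous_onI continuous_Cpow)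
  show "(\<lambda>z. \<Sum>i<n. (C ^^ i) (g (torus_proj ((\<lambda>(x, \<omega>). backward i x \<omega>) z)))) \<in> borel_measurable (borel \<Otimes>\<^sub>M Str)"
    by measurable
next
  fix z :: "(real ^ 'u) \<times> (real ^ 'u) stream"
  show "(\<lambda>n. \<Sum>i<n. (C ^^ i) (g (torus_proj ((\<lambda>(x, \<omega>). backward i x \<omega>) z)))) \<longlonglongrightarrow> (\<lambda>(x, \<omega>). height g x \<omega>) z"
    using summable_LIMSEQ[OF summable_height] by (simp add: case_prod_unfold height_def)
qed

lemma continuous_torus_map: "continuous_on UNIV (torus_map E)"
  using linear_E E_int
  by (subst continuous_on_torus_iff)
    (auto simp: linear_linear
      intro!: continuous_on_compose2[OF continuous_torus_proj] linear_continuous_on)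

lemma continuous_skew_product: "continuous_on UNIV (skew_product E C g)"
  unfolding skew_product_def case_prod_unfold
  by (intro continuous_intros continuous_on_compose2[OF continuous_torus_map]
      continuous_on_compose2[OF continuous_C] continuous_on_compose2[OF g]) auto

lemma measurable_skew_product [measurable]: "skew_product E C g \<in> borel \<rightarrow>\<^sub>M borel"
  by (rule borel_measurable_continuous_onI[OF continuous_skew_product])

lemma measurable_graph: "(\<lambda>(x, \<omega>). (torus_proj x, height g x \<omega>)) \<in> cube_lebesgue \<Otimes>\<^sub>M Str \<rightarrow>\<^sub>M borel"
proof -
  have "(\<lambda>z. (torus_proj (fst z), (\<lambda>(x, \<omega>). height g x \<omega>) z)) \<in> cube_lebesgue \<Otimes>\<^sub>M Str \<rightarrow>\<^sub>M borel \<Otimes>\<^sub>M borel"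
    by measurable
  then show ?thesis by (simp add: borel_prod case_prod_unfold)
qed

lemma prob_space_graph_measure: "prob_space (graph_measure g)"
  unfolding graph_measure_def by (rule QStr.prob_space_distr[OF measurable_graph])

lemma sets_graph_measure [simp]: "sets (graph_measure g) = sets borel"
  by (simp add: graph_measure_def)

lemma nn_integral_graph_measure:
  assumes [measurable]: "f \<in> borel_measurable borel"
  shows "(\<integral>\<^sup>+z. f z \<partial>graph_measure g) =
    (\<integral>\<^sup>+x. \<integral>\<^sup>+\<omega>. f (torus_proj x, height g x \<omega>) \<partial>Str \<partial>cube_lebesgue)"
proof -
  note [measurable] = measurable_graph
  have "(\<integral>\<^sup>+z. f z \<partial>graph_measure g) =
     (\<integral>\<^sup>+z. f ((\<lambda>(x, \<omega>). (torus_proj x, height g x \<omega>)) z) \<partial>(cube_lebesgue \<Otimes>\<^sub>M Str))"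
    unfolding graph_measure_def by (rule nn_integral_distr) auto
  also have "\<dots> = (\<integral>\<^sup>+x. \<integral>\<^sup>+\<omega>. f ((\<lambda>(x, \<omega>). (torus_proj x, height g x \<omega>)) (x, \<omega>)) \<partial>Str \<partial>cube_lebesgue)"
    by (rule Str.nn_integral_fst[symmetric]) measurable
  finally show ?thesis by simp
qed

text \<open>The transfer formula for inverse branches, read as a statement about laws: a uniformly chosen preimage
  of a uniform point is uniform.\<close>

lemma nn_integral_branch:
  fixes F :: "real ^ 'u \<Rightarrow> ennreal"
  assumes [measurable]: "F \<in> borel_measurable borel"
  shows "(\<integral>\<^sup>+x. F x \<partial>cube_lebesgue) = (\<integral>\<^sup>+x. (\<Sum>a\<in>digits. F (branch x a)) / of_nat (card digits) \<partial>cube_lebesgue)"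
proof -
  have per: "periodic (\<lambda>x :: real ^ 'u. F (vfrac x))"
  proof -
    have "vfrac (x + v) = vfrac x" if "v \<in> int_lattice" for x v :: "real ^ 'u"
    proof -
      have "vfrac (x + v) - vfrac x = (vfrac (x + v) - (x + v)) + (x - vfrac x) + v" by simp
      also have "\<dots> \<in> int_lattice" using that vfrac_diff int_lattice_add by blast
      finally show ?thesis using unit_cube_unique vfrac_in_unit_cube by blast
    qed
    then show ?thesis by (simp add: periodic_def)
  qed
  have "vfrac x = x" if "x \<in> unit_cube" for x :: "real ^ 'u"
    using that unit_cube_unique vfrac_in_unit_cube vfrac_diff by blast
  then have "(\<integral>\<^sup>+x. F x \<partial>cube_lebesgue) = (\<integral>\<^sup>+x. F (vfrac x) \<partial>cube_lebesgue)"
    by (intro nn_integral_cong_AE eventually_mono[OF AE_cube_in_unit_cube]) simp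
  also have "\<dots> = of_nat (card digits) * (\<integral>\<^sup>+x. F (vfrac x) \<partial>cube_lebesgue) / of_nat (card digits)"
    using card_digits_ge_2 by (subst mult_divide_eq_ennreal[symmetric, of "of_nat (card digits)"]) (auto simp: mult.commute)
  also have "\<dots> = (\<Sum>a\<in>digits. \<integral>\<^sup>+x. F (branch x a) \<partial>cube_lebesgue) / of_nat (card digits)"
    by (subst nn_integral_inverse_branches[OF per, symmetric]) (auto simp: branch_def)
  also have "\<dots> = (\<integral>\<^sup>+x. (\<Sum>a\<in>digits. F (branch x a)) / of_nat (card digits) \<partial>cube_lebesgue)"
  proof -
    have [measurable]: "(\<lambda>x. F (branch x a)) \<in> borel_measurable borel" for a
      unfolding branch_def by measurable
    show ?thesis by (subst nn_integral_divide) (auto simp: nn_integral_sum)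
  qed
  finally show ?thesis .
qed

text \<open>Replace \<open>x\<close> by a random preimage of \<open>x\<close>. By \<open>height_Stream\<close> the image under the skew product is then the
  graph point over \<open>x\<close> for a stream with one more digit, and adding a digit in front of a stream of
  independent digits does not change its law.\<close>

theorem graph_measure_invariant: "distr (graph_measure g) borel (skew_product E C g) = graph_measure g"
proof (rule measure_eqI)
  fix A assume "A \<in> sets (distr (graph_measure g) borel (skew_product E C g))"
  then have A[measurable]: "A \<in> sets borel" by simp
  let ?T = "skew_product E C g" and ?i = "indicator A :: _ \<Rightarrow> ennreal"
  define F where "F x = (\<integral>\<^sup>+\<omega>. ?i (?T (torus_proj x, height g x \<omega>)) \<partial>Str)" for x
  note [measurable] = measurable_graph
  have "(\<lambda>(x, \<omega>). ?i (?T (torus_proj x, height g x \<omega>))) \<in> borel_measurable (cube_lebesgue \<Otimes>\<^sub>M Str)"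
  proof -
    have "(\<lambda>z. ?i (?T ((\<lambda>(x, \<omega>). (torus_proj x, height g x \<omega>)) z))) \<in> borel_measurable (cube_lebesgue \<Otimes>\<^sub>M Str)"
      by measurable
    then show ?thesis by (simp add: case_prod_unfold)
  qed
  then have F[measurable]: "F \<in> borel_measurable borel"
    unfolding F_def using Str.borel_measurable_nn_integral by (simp add: measurable_cong_sets[OF sets_cube_lebesgue refl])
  have m: "(\<lambda>\<omega>. ?i (torus_proj x, height g x \<omega>)) \<in> borel_measurable Str" for x
  proof -
    have "(\<lambda>\<omega>. ?i ((\<lambda>(x, \<omega>). (torus_proj x, height g x \<omega>)) (x, \<omega>))) \<in> borel_measurable Str"
      by measurable
    then show ?thesis by simp
  qed
  have "emeasure (distr (graph_measure g) borel ?T) A = (\<integral>\<^sup>+z. ?i z \<partial>distr (graph_measure g) borel ?T)"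
    by simp
  also have "\<dots> = (\<integral>\<^sup>+z. ?i (?T z) \<partial>graph_measure g)"
    by (rule nn_integral_distr) (auto simp: measurable_cong_sets[OF sets_graph_measure refl])
  also have "\<dots> = (\<integral>\<^sup>+x. F x \<partial>cube_lebesgue)"
    unfolding F_def by (rule nn_integral_graph_measure) measurable
  also have "\<dots> = (\<integral>\<^sup>+x. (\<Sum>a\<in>digits. F (branch x a)) / of_nat (card digits) \<partial>cube_lebesgue)"
    by (rule nn_integral_branch[OF F])
  also have "\<dots> = (\<integral>\<^sup>+x. \<integral>\<^sup>+\<omega>. ?i (torus_proj x, height g x \<omega>) \<partial>Str \<partial>cube_lebesgue)"
  proof (rule nn_integral_cong)
    fix x :: "real ^ 'u"
    have "?T (torus_proj (branch x a), height g (branch x a) \<omega>) = (torus_proj x, height g x (a ## \<omega>))"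
      if "a \<in> digits" for a \<omega>
      using torus_map_branch[OF that] by (simp add: skew_product_def height_Stream add.commute)
    then have *: "F (branch x a) = (\<integral>\<^sup>+\<omega>. ?i (torus_proj x, height g x (a ## \<omega>)) \<partial>Str)"
      if "a \<in> digits" for a using that by (simp add: F_def)
    have [measurable]: "(\<lambda>a. \<integral>\<^sup>+\<omega>. ?i (torus_proj x, height g x (a ## \<omega>)) \<partial>Str) \<in> borel_measurable borel"
    proof -
      have "(\<lambda>z. (\<lambda>\<omega>. ?i (torus_proj x, height g x \<omega>)) (fst z ## snd z)) \<in> borel_measurable (digit_measure \<Otimes>\<^sub>M Str)"
        using m[of x] by measurable
      then have "(\<lambda>a. \<integral>\<^sup>+\<omega>. ?i (torus_proj x, height g x (a ## \<omega>)) \<partial>Str) \<in> borel_measurable digit_measure"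
        by (intro Str.borel_measurable_nn_integral) (simp add: case_prod_unfold)
      then show ?thesis by (simp add: measurable_cong_sets[OF sets_digit_measure refl])
    qed
    show "(\<Sum>a\<in>digits. F (branch x a)) / of_nat (card digits) = (\<integral>\<^sup>+\<omega>. ?i (torus_proj x, height g x \<omega>) \<partial>Str)"
      by (subst D.nn_integral_stream_space[OF m]) (simp add: * nn_integral_digit_measure)
  qed
  also have "\<dots> = emeasure (graph_measure g) A"
    by (subst nn_integral_graph_measure[symmetric]) auto
  finally show "emeasure (distr (graph_measure g) borel ?T) A = emeasure (graph_measure g) A" .
qed simp

end

end

section \<open>Bounded continuous functions determine measures on the cylinder\<close>

definition cyl_proj :: "(real ^ 'n) \<times> 'b \<Rightarrow> ('n :: finite) torus \<times> ('b :: topological_space)" where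
  "cyl_proj = map_prod torus_proj id"

lemma cyl_proj_simp [simp]: "cyl_proj (x, y) = (torus_proj x, y)"
  by (simp add: cyl_proj_def)

lemma surj_cyl_proj: "range cyl_proj = UNIV"
  unfolding cyl_proj_def by (rule map_prod_surj) (rule torus_proj_surj, simp)

lemma continuous_cyl_proj: "continuous_on UNIV cyl_proj"
  unfolding cyl_proj_def map_prod_def case_prod_unfold id_def
  by (intro continuous_intros continuous_on_compose2[OF continuous_torus_proj]) auto

lemma open_cyl_proj_image:
  assumes "open U" shows "open (cyl_proj ` U)"
proof (rule open_prod_intro)
  fix z assume "z \<in> cyl_proj ` U"
  then obtain x y where z: "(x, y) \<in> U" "z = (torus_proj x, y)" by auto
  obtain A B where AB: "open A" "open B" "(x, y) \<in> A \<times> B" "A \<times> B \<subseteq> U"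
    by (rule open_prod_elim[OF assms z(1)])
  show "\<exists>A B. open A \<and> open B \<and> z \<in> A \<times> B \<and> A \<times> B \<subseteq> cyl_proj ` U"
  proof (intro exI conjI)
    show "open (torus_proj ` A)" "open B" using AB open_torus_proj_image by auto
    show "z \<in> torus_proj ` A \<times> B" using AB z by auto
    show "torus_proj ` A \<times> B \<subseteq> cyl_proj ` U" using AB(4) by (force intro!: image_eqI[of _ cyl_proj])
  qed
qed

lemma continuous_on_cylinder:
  assumes "continuous_on UNIV (\<lambda>z. h (cyl_proj z))"
  shows "continuous_on UNIV h"
proof -
  have "open (h -` V)" if "open V" for V
  proof -
    have "open (cyl_proj -` (h -` V))"
      using assms that by (auto simp: continuous_on_open_vimage vimage_def)
    then have "open (cyl_proj ` (cyl_proj -` (h -` V)))" by (rule open_cyl_proj_image)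
    then show ?thesis by (simp only: surj_image_vimage_eq[OF surj_cyl_proj])
  qed
  then show ?thesis by (simp add: continuous_on_open_vimage)
qed

text \<open>The distance to the complement of the lifted set is invariant under the lattice, so it descends to
  the cylinder and truncated multiples of it increase to the indicator.\<close>

lemma open_cylinder_approx:
  fixes U :: "(('u :: finite) torus \<times> (real ^ 'd)) set"
  assumes U: "open U" "U \<noteq> UNIV"
  obtains h :: "nat \<Rightarrow> 'u torus \<times> (real ^ 'd) \<Rightarrow> real"
  where "\<And>n. continuous_on UNIV (h n)" "\<And>n z. 0 \<le> h n z" "\<And>n z. h n z \<le> 1"
    "\<And>z. (\<lambda>n. h n z) \<longlonglongrightarrow> indicator U z"
proof -
  define F where "F = - (cyl_proj -` U)"
  have "closed F" unfolding F_def using U(1) continuous_cyl_proj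
    by (auto simp: continuous_on_open_vimage closed_def)
  have "F \<noteq> {}"
  proof -
    obtain z where "z \<notin> U" using U(2) by blast
    moreover obtain w where "z = cyl_proj w" using surj_cyl_proj by blast
    ultimately show ?thesis unfolding F_def by blast
  qed
  have shift: "(a + (v, 0) \<in> F) = (a \<in> F)" if "v \<in> int_lattice" for a and v
  proof -
    have "torus_proj (x + v) = torus_proj x" for x using that by (simp add: torus_proj_eq_iff)
    then show ?thesis by (cases a) (simp add: F_def)
  qed
  have inv: "infdist (x + v, y) F = infdist (x, y) F" if v: "v \<in> int_lattice" for x v y
  proof -
    have "(\<lambda>a. dist (x + v, y) a) ` F = (\<lambda>a. dist (x, y) a) ` F"
    proof (intro equalityI subsetI)
      fix t assume "t \<in> (\<lambda>a. dist (x + v, y) a) ` F"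
      then obtain a where a: "a \<in> F" "t = dist (x + v, y) a" by auto
      have "a + (- v, 0) \<in> F" using shift[of "- v" a] v a by simp
      moreover have "t = dist (x, y) (a + (- v, 0))"
        by (cases a) (simp add: a(2) dist_Pair_Pair dist_norm algebra_simps)
      ultimately show "t \<in> (\<lambda>a. dist (x, y) a) ` F" by blast
    next
      fix t assume "t \<in> (\<lambda>a. dist (x, y) a) ` F"
      then obtain a where a: "a \<in> F" "t = dist (x, y) a" by auto
      have "a + (v, 0) \<in> F" using shift[of v a] v a by simp
      moreover have "t = dist (x + v, y) (a + (v, 0))"
        by (cases a) (simp add: a(2) dist_Pair_Pair dist_norm algebra_simps)
      ultimately show "t \<in> (\<lambda>a. dist (x + v, y) a) ` F" by blast
    qed
    then show ?thesis using \<open>F \<noteq> {}\<close> by (simp add: infdist_notempty)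
  qed
  \<comment> \<open>The representative of a torus point is arbitrary, but by \<open>inv\<close> the distance does not depend on it.\<close>
  define h where "h n z = min 1 (real n * infdist (rep_torus (fst z), snd z) F)" for n :: nat and z
  have h_proj: "h n (cyl_proj w) = min 1 (real n * infdist w F)" for n w
  proof -
    obtain x y where w: "w = (x, y)" by (cases w)
    have "rep_torus (torus_proj x) - x \<in> int_lattice" by (simp flip: torus_proj_eq_iff)
    from inv[OF this, of x y] show ?thesis by (simp add: h_def w)
  qed
  show thesis
  proof (rule that[of h])
    show "continuous_on UNIV (h n)" for n
      by (rule continuous_on_cylinder) (auto simp: h_proj intro!: continuous_intros)
    show "0 \<le> h n z" "h n z \<le> 1" for n z by (simp_all add: h_def infdist_nonneg)
    fix z :: "'u torus \<times> (real ^ 'd)"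
    obtain w where w: "z = cyl_proj w" using surj_cyl_proj by blast
    show "(\<lambda>n. h n z) \<longlonglongrightarrow> indicator U z"
    proof (cases "z \<in> U")
      case True
      then have "w \<notin> F" by (simp add: F_def w)
      then have pos: "infdist w F > 0"
        by (rule infdist_pos_not_in_closed[OF \<open>closed F\<close> \<open>F \<noteq> {}\<close>])
      obtain N where N: "1 < real N * infdist w F" using reals_Archimedean3[OF pos] by blast
      have "h n z = 1" if "n \<ge> N" for n
      proof -
        have "real N * infdist w F \<le> real n * infdist w F" using that pos by (intro mult_right_mono) auto
        then show ?thesis using N by (simp add: w h_proj)
      qed
      then have "eventually (\<lambda>n. h n z = 1) sequentially" by (auto simp: eventually_sequentially)
      then show ?thesis using True by (simp add: tendsto_eventually)
    next
      case False
      then have "w \<in> F" by (simp add: F_def w)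
      then have "h n z = 0" for n by (simp add: w h_proj)
      then show ?thesis using False by simp
    qed
  qed
qed

lemma cylinder_measure_eqI:
  fixes M N :: "(('u :: finite) torus \<times> (real ^ 'd)) measure"
  assumes "prob_space M" "prob_space N" and sets: "sets M = sets borel" "sets N = sets borel"
    and eq: "\<And>h :: _ \<Rightarrow> real. continuous_on UNIV h \<Longrightarrow> bounded (range h) \<Longrightarrow> integral\<^sup>L M h = integral\<^sup>L N h"
  shows "M = N"
proof -
  interpret M: prob_space M by fact
  interpret N: prob_space N by fact
  have sp: "space M = UNIV" "space N = UNIV" using sets[THEN sets_eq_imp_space_eq] by auto
  have lim: "(\<lambda>n. integral\<^sup>L K (h n)) \<longlonglongrightarrow> measure K U"
    if K: "prob_space K" "sets K = sets borel" and h: "\<And>n. continuous_on UNIV (h n)" "\<And>n z. 0 \<le> h n z" "\<And>n z. h n z \<le> 1"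
    "\<And>z. (\<lambda>n. h n z) \<longlonglongrightarrow> indicator U z" and U: "open U"
    for K :: "('u torus \<times> (real ^ 'd)) measure" and h :: "nat \<Rightarrow> _ \<Rightarrow> real" and U
  proof -
    interpret prob_space K by fact
    have [measurable]: "U \<in> sets K" using U K(2) by simp
    have m: "f \<in> borel_measurable borel \<Longrightarrow> f \<in> borel_measurable K" for f :: "_ \<Rightarrow> real"
      using K(2) measurable_cong_sets by blast
    have "(\<lambda>n. integral\<^sup>L K (h n)) \<longlonglongrightarrow> integral\<^sup>L K (indicator U)"
      by (rule integral_dominated_convergence[where w = "\<lambda>_. 1"])
        (use h m[OF borel_measurable_continuous_onI[OF h(1)]] in auto)
    then show ?thesis using sets_eq_imp_space_eq[OF K(2)] by simp
  qed
  have U: "emeasure M U = emeasure N U" if op: "open U" for U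
  proof (cases "U = UNIV")
    case True
    then show ?thesis using M.emeasure_space_1 N.emeasure_space_1 sp by simp
  next
    case False
    obtain h :: "nat \<Rightarrow> _ \<Rightarrow> real" where h: "\<And>n. continuous_on UNIV (h n)" "\<And>n z. 0 \<le> h n z" "\<And>n z. h n z \<le> 1"
      "\<And>z. (\<lambda>n. h n z) \<longlonglongrightarrow> indicator U z"
      using open_cylinder_approx[OF op False] by blast
    have "integral\<^sup>L M (h n) = integral\<^sup>L N (h n)" for n
      using h by (intro eq) (auto simp: bounded_iff intro!: exI[of _ 1])
    then have "measure M U = measure N U"
      using lim[OF assms(1) sets(1) h op] lim[OF assms(2) sets(2) h op] LIMSEQ_unique by simp
    then show ?thesis by (simp add: M.emeasure_eq_measure N.emeasure_eq_measure)
  qed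
  show ?thesis
  proof (rule measure_eqI_generator_eq[where E = "{U. open U}" and \<Omega> = UNIV and A = "\<lambda>_. UNIV"])
    show "Int_stable {U :: ('u torus \<times> (real ^ 'd)) set. open U}" by (auto simp: Int_stable_def)
  qed (use U sets M.emeasure_finite in \<open>auto simp: borel_def\<close>)
qed

section \<open>Trigonometric polynomials on the torus\<close>

text \<open>A single family with arbitrary phases replaces sines and cosines; one product formula then shows that
  its span is closed under multiplication.\<close>

definition tcos :: "real ^ 'n \<Rightarrow> real \<Rightarrow> ('n :: finite) torus \<Rightarrow> real" where
  "tcos v \<theta> p = cos (2 * pi * (v \<bullet> rep_torus p) + \<theta>)"

lemma inner_int_lattice: "v \<in> int_lattice \<Longrightarrow> w \<in> int_lattice \<Longrightarrow> v \<bullet> w \<in> \<int>"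
  unfolding inner_vec_def int_lattice_def by (auto intro!: Ints_sum Ints_mult)

lemma tcos_torus_proj:
  assumes "v \<in> int_lattice"
  shows "tcos v \<theta> (torus_proj x) = cos (2 * pi * (v \<bullet> x) + \<theta>)"
proof -
  let ?w = "rep_torus (torus_proj x) - x"
  have "?w \<in> int_lattice" by (simp flip: torus_proj_eq_iff)
  then have "v \<bullet> ?w \<in> \<int>" using assms inner_int_lattice by blast
  then obtain k where k: "v \<bullet> ?w = of_int k" by (auto elim: Ints_cases)
  then have "2 * pi * (v \<bullet> rep_torus (torus_proj x)) + \<theta> = (2 * pi * (v \<bullet> x) + \<theta>) + 2 * pi * of_int k"
    by (simp add: algebra_simps inner_diff_right)
  then show ?thesis
    unfolding tcos_def by (simp only: cos_add[of _ "2 * pi * of_int k"] cos_int_2pin sin_int_2pin mult_1_right mult_zero_right diff_zero)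
qed

lemma continuous_tcos: "v \<in> int_lattice \<Longrightarrow> continuous_on UNIV (tcos v \<theta>)"
  by (subst continuous_on_torus_iff) (auto simp: tcos_torus_proj intro!: continuous_intros)

lemma abs_tcos_le: "\<bar>tcos v \<theta> p\<bar> \<le> 1"
  by (simp add: tcos_def)

lemma tcos_mult:
  assumes "v \<in> int_lattice" "w \<in> int_lattice"
  shows "tcos v \<theta> p * tcos w \<eta> p = (1 / 2) * tcos (v + w) (\<theta> + \<eta>) p + (1 / 2) * tcos (v - w) (\<theta> - \<eta>) p"
  unfolding tcos_def cos_times_cos by (simp add: inner_add_left inner_diff_left algebra_simps)

lemma tcos_separates:
  fixes p q :: "('n :: finite) torus"
  assumes "p \<noteq> q"
  obtains v \<theta> where "v \<in> int_lattice" "tcos v \<theta> p \<noteq> tcos v \<theta> q"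
proof -
  let ?x = "rep_torus p" and ?y = "rep_torus q"
  have "?x - ?y \<notin> int_lattice"
    using assms torus_proj_eq_iff[of ?x ?y] by simp
  then obtain i where i: "?x $ i - ?y $ i \<notin> \<int>" by (auto simp: int_lattice_def)
  let ?v = "axis i 1 :: real ^ 'n" and ?t = "- (2 * pi * ?x $ i)"
  have "tcos ?v ?t p = 1" by (simp add: tcos_def inner_axis')
  moreover have "tcos ?v ?t q \<noteq> 1"
  proof
    assume "tcos ?v ?t q = 1"
    then have "cos (2 * pi * ?y $ i + ?t) = 1" by (simp add: tcos_def inner_axis')
    then obtain k :: int where "2 * pi * ?y $ i + ?t = real_of_int k * 2 * pi"
      using cos_one_2pi_int by metis
    then have "2 * pi * (?x $ i - ?y $ i) = 2 * pi * real_of_int (- k)" by (simp add: algebra_simps)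
    then have "?x $ i - ?y $ i = real_of_int (- k)"
      by (simp only: mult_cancel_left mult_eq_0_iff pi_neq_zero) simp
    then show False using i by (metis Ints_of_int)
  qed
  ultimately show thesis using that[of ?v ?t] axis_int_lattice by auto
qed

instance torus :: (finite) t2_space
proof
  fix p q :: "'a torus" assume "p \<noteq> q"
  then obtain v \<theta> where v: "v \<in> int_lattice" "tcos v \<theta> p \<noteq> tcos v \<theta> q" by (rule tcos_separates)
  then obtain A B where AB: "open A" "open B" "tcos v \<theta> p \<in> A" "tcos v \<theta> q \<in> B" "A \<inter> B = {}"
    using hausdorff by metis
  have "open (tcos v \<theta> -` V)" if "open V" for V
    using continuous_tcos[OF v(1)] that by (auto simp: continuous_on_open_vimage)
  then show "\<exists>U V. open U \<and> open V \<and> p \<in> U \<and> q \<in> V \<and> U \<inter> V = {}"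
    using AB by (intro exI[of _ "tcos v \<theta> -` A"] exI[of _ "tcos v \<theta> -` B"]) auto
qed

inductive trig_poly :: "(('n :: finite) torus \<Rightarrow> real) \<Rightarrow> bool" where
  tcos: "v \<in> int_lattice \<Longrightarrow> trig_poly (\<lambda>p. c * tcos v \<theta> p)"
| add: "trig_poly f \<Longrightarrow> trig_poly g \<Longrightarrow> trig_poly (\<lambda>p. f p + g p)"

lemma trig_poly_const: "trig_poly (\<lambda>_. c)"
  using trig_poly.tcos[of 0 c 0] by (simp add: tcos_def)

lemma trig_poly_mult:
  assumes "trig_poly f" "trig_poly g" shows "trig_poly (\<lambda>p. f p * g p)"
  using assms
proof (induction arbitrary: g)
  case (tcos v c \<theta> g)
  note v = tcos.hyps
  show ?case using tcos.prems
  proof (induction)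
    case (tcos w d \<eta>)
    have "(\<lambda>p. c * tcos v \<theta> p * (d * tcos w \<eta> p)) =
        (\<lambda>p. (c * d / 2) * tcos (v + w) (\<theta> + \<eta>) p + (c * d / 2) * tcos (v - w) (\<theta> - \<eta>) p)"
    proof
      fix p
      have "c * tcos v \<theta> p * (d * tcos w \<eta> p) = c * d * (tcos v \<theta> p * tcos w \<eta> p)" by simp
      then show "c * tcos v \<theta> p * (d * tcos w \<eta> p) =
        (c * d / 2) * tcos (v + w) (\<theta> + \<eta>) p + (c * d / 2) * tcos (v - w) (\<theta> - \<eta>) p"
        unfolding tcos_mult[OF v tcos] by (simp add: algebra_simps)
    qed
    then show ?case
      by (simp only:) (intro trig_poly.intros int_lattice_add int_lattice_diff v tcos)
  next
    case (add f g)
    then show ?case by (simp add: distrib_left trig_poly.add)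
  qed
next
  case (add f1 f2)
  then show ?case by (simp add: distrib_right trig_poly.add)
qed

lemma trig_poly_continuous: "trig_poly f \<Longrightarrow> continuous_on UNIV f"
  by (induction rule: trig_poly.induct) (auto intro!: continuous_intros continuous_tcos)

lemma trig_poly_dense:
  fixes h :: "('n :: finite) torus \<Rightarrow> real"
  assumes "continuous_on UNIV h" "0 < e"
  obtains f where "trig_poly f" "\<And>p. \<bar>h p - f p\<bar> < e"
proof -
  have "\<exists>f. trig_poly f \<and> (\<forall>p\<in>UNIV. \<bar>h p - f p\<bar> < e)"
  proof (rule Stone_Weierstrass_HOL)
    fix p q :: "'n torus" assume "p \<in> UNIV \<and> q \<in> UNIV \<and> p \<noteq> q"
    then obtain v \<theta> where "v \<in> int_lattice" "tcos v \<theta> p \<noteq> tcos v \<theta> q" by (elim conjE tcos_separates)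
    then show "\<exists>f. trig_poly f \<and> f p \<noteq> f q"
      by (intro exI[of _ "\<lambda>p. 1 * tcos v \<theta> p"] conjI trig_poly.tcos) auto
  qed (use assms compact_torus trig_poly_const trig_poly_mult trig_poly_continuous in \<open>auto intro: trig_poly.add\<close>)
  then show thesis using that by auto
qed

section \<open>Almost every point of the torus is generic\<close>

text \<open>Between consecutive squares \<open>m\<^sup>2\<close> and \<open>(m+1)\<^sup>2\<close> a partial sum changes by at most \<open>2 m\<close>, which is negligible
  against \<open>m\<^sup>2\<close>.\<close>

lemma bounded_partial_sums_average:
  fixes X :: "nat \<Rightarrow> real"
  assumes X: "\<And>k. \<bar>X k\<bar> \<le> 1"
    and sq: "(\<lambda>j. (\<Sum>k<(Suc j)^2. X k) / real ((Suc j)^2)) \<longlonglongrightarrow> 0"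
  shows "(\<lambda>n. (\<Sum>k<n. X k) / real n) \<longlonglongrightarrow> 0"
proof -
  define S where "S n = (\<Sum>k<n. X k)" for n
  define m where "m n = nat \<lfloor>sqrt (real n)\<rfloor>" for n
  have mlim: "filterlim m at_top sequentially"
    unfolding filterlim_at_top
  proof
    fix Z
    have "Z \<le> m n" if "Z^2 \<le> n" for n
    proof -
      have "real Z \<le> sqrt (real n)" using that by (metis of_nat_le_iff of_nat_power real_le_rsqrt)
      then show ?thesis unfolding m_def by (simp add: le_nat_floor)
    qed
    then show "eventually (\<lambda>n. Z \<le> m n) sequentially" by (auto simp: eventually_sequentially)
  qed
  have m_le: "(m n)^2 \<le> n" for n
  proof -
    have "real (m n) \<le> sqrt (real n)" unfolding m_def by simp
    then have "(real (m n))^2 \<le> real n" by (metis of_nat_0_le_iff real_sqrt_ge_0_iff real_sqrt_pow2 power_mono)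
    then show ?thesis by (metis of_nat_le_iff of_nat_power)
  qed
  have m_gt: "n < (m n + 1)^2" for n
  proof -
    have "sqrt (real n) < real (m n + 1)" unfolding m_def by linarith
    then have "(sqrt (real n))^2 < (real (m n + 1))^2" by (intro power_strict_mono) auto
    then have "real n < (real (m n + 1))^2" by simp
    then show ?thesis by (metis of_nat_less_iff of_nat_power)
  qed
  have Sdiff: "\<bar>S n - S k\<bar> \<le> real (n - k)" if "k \<le> n" for n k
  proof -
    have "S n - S k = (\<Sum>i\<in>{k..<n}. X i)"
      using that sum.atLeastLessThan_concat[of 0 k n X] by (simp add: S_def lessThan_atLeast0)
    also have "\<bar>\<dots>\<bar> \<le> (\<Sum>i\<in>{k..<n}. \<bar>X i\<bar>)" by (rule sum_abs)
    also have "\<dots> \<le> (\<Sum>i\<in>{k..<n}. 1)" by (intro sum_mono X)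
    finally show ?thesis by simp
  qed
  have bound: "\<bar>S n / real n\<bar> \<le> \<bar>S ((m n)^2) / real ((m n)^2)\<bar> + 2 * (1 / real (m n))" if "n \<ge> 1" for n
  proof -
    have m1: "m n \<ge> 1" using m_gt[of n] that by (cases "m n") auto
    have "n - (m n)^2 \<le> 2 * m n" using m_gt[of n] by (simp add: power2_eq_square)
    then have "real (n - (m n)^2) \<le> 2 * real (m n)" by linarith
    then have "\<bar>S n\<bar> \<le> \<bar>S ((m n)^2)\<bar> + 2 * real (m n)"
      using Sdiff[OF m_le[of n]] by linarith
    then have "\<bar>S n\<bar> / real n \<le> (\<bar>S ((m n)^2)\<bar> + 2 * real (m n)) / real n"
      by (intro divide_right_mono) auto
    also have "\<dots> \<le> (\<bar>S ((m n)^2)\<bar> + 2 * real (m n)) / real ((m n)^2)"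
    proof (rule divide_left_mono)
      show "real ((m n)^2) \<le> real n" using m_le[of n] by (simp only: of_nat_le_iff)
      show "0 < real n * real ((m n)^2)" using that m1 by (intro mult_pos_pos) auto
    qed simp
    also have "\<dots> = \<bar>S ((m n)^2)\<bar> / real ((m n)^2) + 2 * (1 / real (m n))"
      using m1 by (simp add: add_divide_distrib power2_eq_square)
    finally show ?thesis by simp
  qed
  have "(\<lambda>j. S (j^2) / real (j^2)) \<longlonglongrightarrow> 0"
    using sq unfolding S_def[symmetric] by (subst (asm) filterlim_sequentially_Suc)
  from tendsto_rabs_zero[OF filterlim_compose[OF this mlim]]
  have 1: "(\<lambda>n. \<bar>S ((m n)^2) / real ((m n)^2)\<bar>) \<longlonglongrightarrow> 0" .
  have 2: "(\<lambda>n. 1 / real (m n)) \<longlonglongrightarrow> 0"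
    by (rule filterlim_compose[OF lim_1_over_n mlim])
  have "(\<lambda>n. S n / real n) \<longlonglongrightarrow> 0"
  proof (rule Lim_null_comparison)
    show "(\<lambda>n. \<bar>S ((m n)^2) / real ((m n)^2)\<bar> + 2 * (1 / real (m n))) \<longlonglongrightarrow> 0"
      using tendsto_add[OF 1 tendsto_mult_left[OF 2, of 2]] by simp
    show "\<forall>\<^sub>F n in sequentially. norm (S n / real n) \<le> \<bar>S ((m n)^2) / real ((m n)^2)\<bar> + 2 * (1 / real (m n))"
      using bound unfolding real_norm_def eventually_sequentially by blast
  qed
  then show ?thesis by (simp add: S_def)
qed

text \<open>Along \<open>n = j\<^sup>2\<close> the second moments of the averages are summable, so these averages tend to \<open>0\<close> almost
  surely; boundedness fills the gaps.\<close>

lemma (in prob_space) L2_law_of_large_numbers: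
  fixes X :: "nat \<Rightarrow> 'a \<Rightarrow> real"
  assumes [measurable]: "\<And>k. X k \<in> borel_measurable M"
    and X: "\<And>k p. \<bar>X k p\<bar> \<le> 1"
    and L2: "\<And>n. (\<integral>p. (\<Sum>k<n. X k p)^2 \<partial>M) \<le> real n"
  shows "AE p in M. (\<lambda>n. (\<Sum>k<n. X k p) / real n) \<longlonglongrightarrow> 0"
proof -
  define Y where "Y j p = ((\<Sum>k<(Suc j)^2. X k p) / real ((Suc j)^2))^2" for j p
  have [measurable]: "Y j \<in> borel_measurable M" for j unfolding Y_def by measurable
  have Sb: "\<bar>\<Sum>k<n. X k p\<bar> \<le> real n" for n p
  proof -
    have "\<bar>\<Sum>k<n. X k p\<bar> \<le> (\<Sum>k<n. \<bar>X k p\<bar>)" by (rule sum_abs)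
    also have "\<dots> \<le> (\<Sum>k<n. 1)" by (intro sum_mono X)
    finally show ?thesis by simp
  qed
  have YI: "(\<integral>\<^sup>+p. ennreal (Y j p) \<partial>M) \<le> ennreal (1 / (real (Suc j))^2)" for j
  proof -
    let ?n = "(Suc j)^2"
    have int: "integrable M (\<lambda>p. (\<Sum>k<?n. X k p)^2)"
    proof (rule integrable_const_bound[of _ "(real ?n)^2"])
      have "\<bar>\<Sum>k<?n. X k p\<bar> \<le> real ?n" for p by (rule Sb)
      then have "\<bar>\<Sum>k<?n. X k p\<bar>^2 \<le> (real ?n)^2" for p by (intro power_mono) auto
      then show "AE p in M. norm ((\<Sum>k<?n. X k p)^2) \<le> (real ?n)^2" by simp
    qed simp
    have "(\<integral>\<^sup>+p. ennreal (Y j p) \<partial>M) = (\<integral>\<^sup>+p. ennreal ((\<Sum>k<?n. X k p)^2 / (real ?n)^2) \<partial>M)"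
      by (simp add: Y_def power_divide)
    also have "\<dots> = ennreal (\<integral>p. (\<Sum>k<?n. X k p)^2 / (real ?n)^2 \<partial>M)"
      using int by (intro nn_integral_eq_integral) auto
    also have "\<dots> = ennreal ((\<integral>p. (\<Sum>k<?n. X k p)^2 \<partial>M) / (real ?n)^2)" by simp
    also have "\<dots> \<le> ennreal (real ?n / (real ?n)^2)"
      by (intro ennreal_leI divide_right_mono L2) simp
    also have "real ?n / (real ?n)^2 = 1 / (real (Suc j))^2"
    proof -
      have "x^2 / (x^2)^2 = 1 / x^2" if "x \<noteq> 0" for x :: real
        using that by (simp add: power2_eq_square)
      from this[of "real (Suc j)"] show ?thesis by simp
    qed
    finally show ?thesis .
  qed
  have "(\<integral>\<^sup>+p. (\<Sum>j. ennreal (Y j p)) \<partial>M) = (\<Sum>j. \<integral>\<^sup>+p. ennreal (Y j p) \<partial>M)"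
    by (rule nn_integral_suminf) measurable
  also have "\<dots> \<le> (\<Sum>j. ennreal (1 / (real (Suc j))^2))" by (intro suminf_le YI) auto
  also have "\<dots> = ennreal (\<Sum>j. 1 / (real (Suc j))^2)"
  proof (rule suminf_ennreal2)
    have "summable (\<lambda>j. inverse ((real (Suc j))^2))"
      by (subst summable_Suc_iff) (rule inverse_power_summable, simp)
    then show "summable (\<lambda>j. 1 / (real (Suc j))^2)" by (simp add: inverse_eq_divide)
  qed simp
  also have "\<dots> < \<infinity>" by simp
  finally have "AE p in M. (\<Sum>j. ennreal (Y j p)) \<noteq> \<infinity>"
    by (intro nn_integral_PInf_AE) (auto simp: less_top)
  then show ?thesis
  proof eventually_elim
    case (elim p)
    have "summable (\<lambda>j. Y j p)"
      using elim by (intro summable_suminf_not_top) (auto simp: Y_def top_ennreal_def)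
    then have "(\<lambda>j. Y j p) \<longlonglongrightarrow> 0" by (rule summable_LIMSEQ_zero)
    then have "(\<lambda>j. sqrt (Y j p)) \<longlonglongrightarrow> 0" using tendsto_real_sqrt by fastforce
    then have "(\<lambda>j. \<bar>(\<Sum>k<(Suc j)^2. X k p) / real ((Suc j)^2)\<bar>) \<longlonglongrightarrow> 0"
      by (simp add: Y_def real_sqrt_abs)
    then have "(\<lambda>j. (\<Sum>k<(Suc j)^2. X k p) / real ((Suc j)^2)) \<longlonglongrightarrow> 0"
      by (rule tendsto_rabs_zero_cancel)
    then show ?case by (rule bounded_partial_sums_average[rotated]) (rule X)
  qed
qed

lemma sets_torus_lebesgue [simp, measurable_cong]: "sets torus_lebesgue = sets borel"
  by (simp add: torus_lebesgue_def)

interpretation torus: prob_space "torus_lebesgue :: ('n :: finite) torus measure"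
  by (rule prob_space_torus_lebesgue)

lemma integrable_torus_continuous:
  fixes h :: "('n :: finite) torus \<Rightarrow> real"
  assumes "continuous_on UNIV h" shows "integrable torus_lebesgue h"
proof -
  obtain B where "\<And>p. norm (h p) \<le> B" using bounded_on_torus[OF assms] by blast
  then show ?thesis
    using borel_measurable_continuous_onI[OF assms]
    by (intro torus.integrable_const_bound[of _ B]) (auto simp: measurable_cong_sets[OF sets_torus_lebesgue refl])
qed

text \<open>Translation by half a period in a coordinate that occurs in \<open>v\<close> changes the sign of the function and
  preserves Lebesgue measure.\<close>

lemma integral_tcos:
  fixes v :: "real ^ 'n"
  assumes v: "v \<in> int_lattice" "v \<noteq> 0"
  shows "(\<integral>p. tcos v \<theta> p \<partial>torus_lebesgue) = 0"
proof -
  obtain i where i: "v $ i \<noteq> 0" using v(2) by (auto simp: vec_eq_iff)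
  \<comment> \<open>Half of the period of the function in direction \<open>i\<close>.\<close>
  let ?c = "axis i (1 / (2 * v $ i)) :: real ^ 'n"
  let ?f = "\<lambda>x. ennreal (1 + tcos v \<theta> (torus_proj x))"
  have int: "integrable torus_lebesgue (tcos v \<theta>)"
    by (rule integrable_torus_continuous[OF continuous_tcos[OF v(1)]])
  have [measurable]: "tcos v \<theta> \<in> borel_measurable borel"
    by (rule borel_measurable_continuous_onI[OF continuous_tcos[OF v(1)]])
  have nonneg: "0 \<le> 1 + tcos v \<theta> p" "0 \<le> 1 - tcos v \<theta> p" for p
    using abs_tcos_le[of v \<theta> p] by (auto simp: abs_le_iff)
  have flip: "tcos v \<theta> (torus_proj (?c + x)) = - tcos v \<theta> (torus_proj x)" for x
  proof -
    have "2 * pi * (v \<bullet> (?c + x)) + \<theta> = (2 * pi * (v \<bullet> x) + \<theta>) + pi"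
      using i by (simp add: inner_add_right inner_axis algebra_simps)
    then show ?thesis unfolding tcos_torus_proj[OF v(1)] by (simp only: cos_periodic_pi)
  qed
  have "(\<integral>\<^sup>+p. ennreal (1 + tcos v \<theta> p) \<partial>torus_lebesgue) = (\<integral>\<^sup>+x. ?f x \<partial>cube_lebesgue)"
    unfolding torus_lebesgue_eq_distr by (rule nn_integral_distr) measurable
  also have "\<dots> = (\<integral>\<^sup>+x. ?f (?c + x) \<partial>cube_lebesgue)"
    by (rule cube_lebesgue_translate[symmetric]) (rule periodic_torus_proj, measurable)
  also have "\<dots> = (\<integral>\<^sup>+x. ennreal (1 - tcos v \<theta> (torus_proj x)) \<partial>cube_lebesgue)"
    by (simp only: flip) simp
  also have "\<dots> = (\<integral>\<^sup>+p. ennreal (1 - tcos v \<theta> p) \<partial>torus_lebesgue)"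
    unfolding torus_lebesgue_eq_distr by (rule nn_integral_distr[symmetric]) measurable
  finally have "ennreal (\<integral>p. 1 + tcos v \<theta> p \<partial>torus_lebesgue) = ennreal (\<integral>p. 1 - tcos v \<theta> p \<partial>torus_lebesgue)"
    using int nonneg by (subst (asm) (1 2) nn_integral_eq_integral) auto
  then have "(\<integral>p. 1 + tcos v \<theta> p \<partial>torus_lebesgue) = (\<integral>p. 1 - tcos v \<theta> p \<partial>torus_lebesgue)"
    using nonneg by (subst (asm) ennreal_inj) (auto intro!: integral_nonneg)
  then show ?thesis using int by simp
qed

context toral_expansion
begin

abbreviation "Et \<equiv> adjoint E"

lemma Et_int: "v \<in> int_lattice \<Longrightarrow> Et v \<in> int_lattice"
proof -
  assume v: "v \<in> int_lattice"
  have "Et v $ i \<in> \<int>" for i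
  proof -
    have "Et v $ i = axis i 1 \<bullet> Et v" by (simp add: inner_axis')
    also have "\<dots> = E (axis i 1) \<bullet> v" by (rule adjoint_works[OF linear_E])
    also have "\<dots> \<in> \<int>" using inner_int_lattice E_int axis_int_lattice v by blast
    finally show ?thesis .
  qed
  then show ?thesis by (simp add: int_lattice_def)
qed

text \<open>The transpose expands as well, so the frequencies of a character along the orbit of \<open>E\<close> grow strictly.
  Distinct times therefore give orthogonal functions.\<close>

lemma norm_Et_greater: "w \<noteq> 0 \<Longrightarrow> norm w < norm (Et w)"
proof -
  assume w: "w \<noteq> 0"
  have "(norm w)^2 = E (iE w) \<bullet> w" by (simp add: power2_norm_eq_inner)
  also have "\<dots> = iE w \<bullet> Et w" by (rule adjoint_works[OF linear_E, symmetric])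
  also have "\<dots> \<le> norm (iE w) * norm (Et w)" by (rule norm_cauchy_schwarz)
  finally have le: "(norm w)^2 \<le> norm (iE w) * norm (Et w)" .
  show ?thesis
  proof (rule ccontr)
    assume "\<not> norm w < norm (Et w)"
    then have "norm (iE w) * norm (Et w) \<le> norm (iE w) * norm w" by (intro mult_left_mono) auto
    also have "\<dots> < norm w * norm w" using norm_iE_less[OF w] w by (intro mult_strict_right_mono) auto
    finally show False using le by (simp add: power2_eq_square)
  qed
qed

lemma Et_pow_int: "v \<in> int_lattice \<Longrightarrow> (Et ^^ k) v \<in> int_lattice"
  by (induction k) (auto intro: Et_int)

lemma norm_Et_pow_strict:
  assumes "v \<noteq> 0" "j < k" shows "norm ((Et ^^ j) v) < norm ((Et ^^ k) v)"
proof -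
  have nz: "(Et ^^ k) v \<noteq> 0" for k
  proof (induction k)
    case (Suc k)
    then have "0 < norm (Et ((Et ^^ k) v))" using norm_Et_greater[OF Suc] norm_ge_zero[of "(Et ^^ k) v"] by linarith
    then show ?case by auto
  qed (use assms in simp)
  have "strict_mono (\<lambda>k. norm ((Et ^^ k) v))"
    using norm_Et_greater[OF nz] by (simp add: strict_mono_Suc_iff)
  from strict_monoD[OF this assms(2)] show ?thesis .
qed

lemma tcos_torus_map:
  assumes "v \<in> int_lattice"
  shows "tcos v \<theta> ((torus_map E ^^ k) p) = tcos ((Et ^^ k) v) \<theta> p"
  using assms
proof (induction k arbitrary: v)
  case (Suc k)
  obtain x where x: "(torus_map E ^^ k) p = torus_proj x" by (metis torus_proj_rep)
  have "tcos v \<theta> ((torus_map E ^^ Suc k) p) = tcos (Et v) \<theta> ((torus_map E ^^ k) p)"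
    using Suc.prems Et_int linear_E E_int
    by (simp add: x torus_map_proj image_subset_iff tcos_torus_proj adjoint_works[OF linear_E] inner_commute[of _ x] inner_commute[of _ "E x"])
  also have "\<dots> = tcos ((Et ^^ k) (Et v)) \<theta> p" by (rule Suc.IH) (rule Et_int[OF Suc.prems])
  finally show ?case by (simp add: funpow_swap1)
qed simp

definition generic :: "'u torus \<Rightarrow> bool" where
  "generic p \<longleftrightarrow> (\<forall>h :: 'u torus \<Rightarrow> real. continuous_on UNIV h \<longrightarrow>
     (\<lambda>n. (\<Sum>k<n. h ((torus_map E ^^ k) p)) / real n) \<longlonglongrightarrow> (\<integral>q. h q \<partial>torus_lebesgue))"

lemma AE_tcos_average:
  assumes v: "v \<in> int_lattice" "v \<noteq> 0"
  shows "AE p in torus_lebesgue. (\<lambda>n. (\<Sum>k<n. tcos v \<theta> ((torus_map E ^^ k) p)) / real n) \<longlonglongrightarrow> 0"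
  unfolding tcos_torus_map[OF v(1)]
proof (rule torus.L2_law_of_large_numbers)
  let ?w = "\<lambda>k. (Et ^^ k) v"
  let ?X = "\<lambda>k. tcos (?w k) \<theta> :: 'u torus \<Rightarrow> real"
  have w: "?w k \<in> int_lattice" for k by (rule Et_pow_int[OF v(1)])
  show "?X k \<in> borel_measurable torus_lebesgue" for k
    using borel_measurable_continuous_onI[OF continuous_tcos[OF w]]
    by (simp add: measurable_cong_sets[OF sets_torus_lebesgue refl])
  show "\<bar>?X k p\<bar> \<le> 1" for k p by (rule abs_tcos_le)
  have cont: "continuous_on UNIV (\<lambda>p. ?X j p * ?X k p)" for j k
    by (intro continuous_intros continuous_tcos w)
  have orth: "(\<integral>p. ?X j p * ?X k p \<partial>torus_lebesgue) = 0" if "j \<noteq> k" for j k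
  proof -
    have "norm (?w j) \<noteq> norm (?w k)"
      using norm_Et_pow_strict[OF v(2)] that by (metis less_irrefl linorder_neqE_nat)
    then have "?w j \<noteq> ?w k" "?w j \<noteq> - ?w k" by (auto simp: norm_minus_cancel)
    then have nz: "?w j - ?w k \<noteq> 0" "?w j + ?w k \<noteq> 0" by (auto simp: eq_neg_iff_add_eq_0)
    show ?thesis
      unfolding tcos_mult[OF w w]
      using integral_tcos[OF int_lattice_add[OF w w] nz(2)] integral_tcos[OF int_lattice_diff[OF w w] nz(1)]
        integrable_torus_continuous[OF continuous_tcos[OF int_lattice_add[OF w w]]]
        integrable_torus_continuous[OF continuous_tcos[OF int_lattice_diff[OF w w]]]
      by (subst Bochner_Integration.integral_add) auto
  qed
  fix n
  have "(\<integral>p. (\<Sum>k<n. ?X k p)^2 \<partial>torus_lebesgue) = (\<integral>p. (\<Sum>j<n. \<Sum>k<n. ?X j p * ?X k p) \<partial>torus_lebesgue)"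
    by (simp add: power2_eq_square sum_product)
  also have "\<dots> = (\<Sum>j<n. \<Sum>k<n. \<integral>p. ?X j p * ?X k p \<partial>torus_lebesgue)"
    by (simp add: Bochner_Integration.integral_sum integrable_torus_continuous[OF cont])
  also have "\<dots> = (\<Sum>j<n. \<Sum>k<n. if k = j then \<integral>p. ?X j p * ?X j p \<partial>torus_lebesgue else 0)"
    using orth by (intro sum.cong refl) auto
  also have "\<dots> = (\<Sum>j<n. \<integral>p. ?X j p * ?X j p \<partial>torus_lebesgue)" by simp
  also have "\<dots> \<le> (\<Sum>j<n. 1)"
  proof (rule sum_mono)
    fix j
    have "(\<integral>p. ?X j p * ?X j p \<partial>torus_lebesgue) \<le> (\<integral>p. 1 \<partial>(torus_lebesgue :: 'u torus measure))"
    proof (rule integral_mono[OF integrable_torus_continuous[OF cont[of j j]]])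
      fix p :: "'u torus"
      have "\<bar>?X j p\<bar> * \<bar>?X j p\<bar> \<le> 1 * 1" by (intro mult_mono abs_tcos_le) auto
      then show "?X j p * ?X j p \<le> 1" by simp
    qed simp
    then show "(\<integral>p. ?X j p * ?X j p \<partial>torus_lebesgue) \<le> 1" by (simp add: torus.prob_space)
  qed
  finally show "(\<integral>p. (\<Sum>k<n. ?X k p)^2 \<partial>torus_lebesgue) \<le> real n" by simp
qed

text \<open>The law of large numbers for the orthogonal functions of \<open>AE_tcos_average\<close> covers countably many
  frequencies at once; trigonometric polynomials are uniformly dense.\<close>

theorem AE_generic: "AE p in torus_lebesgue. generic p"
proof -
  have "AE p in torus_lebesgue. \<forall>v\<in>int_lattice - {0}. \<forall>\<theta>\<in>{0, - (pi / 2)}.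
      (\<lambda>n. (\<Sum>k<n. tcos v \<theta> ((torus_map E ^^ k) p)) / real n) \<longlonglongrightarrow> 0"
    using countable_int_lattice
    by (subst AE_ball_countable) (auto intro!: AE_tcos_average simp: AE_ball_countable)
  then show ?thesis
  proof eventually_elim
    case (elim p)
    let ?o = "\<lambda>k. (torus_map E ^^ k) p"
    have trig: "(\<lambda>n. (\<Sum>k<n. f (?o k)) / real n) \<longlonglongrightarrow> (\<integral>q. f q \<partial>torus_lebesgue)" if "trig_poly f" for f
      using that
    proof (induction rule: trig_poly.induct)
      case (tcos v c \<theta>)
      show ?case
      proof (cases "v = 0")
        case True
        then have eq: "tcos v \<theta> q = cos \<theta>" for q by (simp add: tcos_def)
        have "\<forall>\<^sub>F n in sequentially. (\<Sum>k<n. c * tcos v \<theta> (?o k)) / real n = c * cos \<theta>"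
          unfolding eq eventually_sequentially by (intro exI[of _ 1]) auto
        then show ?thesis unfolding eq by (subst tendsto_eventually) (simp_all add: torus.prob_space)
      next
        case False
        \<comment> \<open>The phases \<open>0\<close> and \<open>- \<pi>/2\<close> span all phases of a frequency, so countably many null sets suffice.\<close>
        have split: "tcos v \<theta> q = cos \<theta> * tcos v 0 q - sin \<theta> * tcos v (- (pi / 2)) q" for q
        proof -
          have "cos (2 * pi * (v \<bullet> rep_torus q) + - (pi / 2)) = sin (2 * pi * (v \<bullet> rep_torus q))"
            by (simp add: cos_diff)
          then show ?thesis by (simp add: tcos_def cos_add mult.commute)
        qed
        have l: "(\<lambda>n. (\<Sum>k<n. tcos v 0 (?o k)) / real n) \<longlonglongrightarrow> 0"
          "(\<lambda>n. (\<Sum>k<n. tcos v (- (pi / 2)) (?o k)) / real n) \<longlonglongrightarrow> 0"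
          using elim tcos False by auto
        have "(\<lambda>n. c * (cos \<theta> * ((\<Sum>k<n. tcos v 0 (?o k)) / real n) -
            sin \<theta> * ((\<Sum>k<n. tcos v (- (pi / 2)) (?o k)) / real n))) \<longlonglongrightarrow> c * (cos \<theta> * 0 - sin \<theta> * 0)"
          by (intro tendsto_intros l)
        moreover have "(\<Sum>k<n. c * tcos v \<theta> (?o k)) / real n = c * (cos \<theta> * ((\<Sum>k<n. tcos v 0 (?o k)) / real n) -
            sin \<theta> * ((\<Sum>k<n. tcos v (- (pi / 2)) (?o k)) / real n))" for n
          by (simp add: split[abs_def] sum_subtractf sum_distrib_left[symmetric] diff_divide_distrib right_diff_distrib)
        ultimately show ?thesis using tcos False by (simp add: integral_tcos)
      qed
    next
      case (add f g)
      from tendsto_add[OF add.IH] show ?case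
        using integrable_torus_continuous[OF trig_poly_continuous[OF add.hyps(1)]]
          integrable_torus_continuous[OF trig_poly_continuous[OF add.hyps(2)]]
        by (simp add: sum.distrib add_divide_distrib)
    qed
    show ?case unfolding generic_def
    proof (intro allI impI)
      fix h :: "'u torus \<Rightarrow> real" assume h: "continuous_on UNIV h"
      show "(\<lambda>n. (\<Sum>k<n. h (?o k)) / real n) \<longlonglongrightarrow> (\<integral>q. h q \<partial>torus_lebesgue)"
      proof (rule LIMSEQ_I)
        fix e :: real assume "0 < e"
        then have e3: "0 < e / 3" by simp
        obtain f where f: "trig_poly f" "\<And>p. \<bar>h p - f p\<bar> < e / 3" using trig_poly_dense[OF h e3] by blast
        obtain N where N: "\<And>n. n \<ge> N \<Longrightarrow> \<bar>(\<Sum>k<n. f (?o k)) / real n - (\<integral>q. f q \<partial>torus_lebesgue)\<bar> < e / 3"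
          using LIMSEQ_D[OF trig[OF f(1)] e3] by auto
        have i: "integrable torus_lebesgue f" "integrable torus_lebesgue h"
          using integrable_torus_continuous trig_poly_continuous f h by blast+
        have "\<bar>(\<integral>q. f q \<partial>torus_lebesgue) - (\<integral>q. h q \<partial>torus_lebesgue)\<bar> \<le> (\<integral>q. \<bar>f q - h q\<bar> \<partial>torus_lebesgue)"
          using i integral_abs_bound[of torus_lebesgue "\<lambda>q. f q - h q"] by simp
        also have "\<dots> \<le> (\<integral>q. e / 3 \<partial>(torus_lebesgue :: 'u torus measure))"
          using i f(2) by (intro integral_mono) (auto simp: abs_minus_commute less_imp_le)
        finally have c: "\<bar>(\<integral>q. f q \<partial>torus_lebesgue) - (\<integral>q. h q \<partial>torus_lebesgue)\<bar> \<le> e / 3"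
          by (simp add: torus.prob_space)
        have b: "\<bar>(\<Sum>k<n. h (?o k)) / real n - (\<Sum>k<n. f (?o k)) / real n\<bar> \<le> e / 3" if "n \<ge> 1" for n
        proof -
          have "\<bar>(\<Sum>k<n. h (?o k)) - (\<Sum>k<n. f (?o k))\<bar> \<le> (\<Sum>k<n. \<bar>h (?o k) - f (?o k)\<bar>)"
            by (simp add: sum_subtractf[symmetric])
          also have "\<dots> \<le> (\<Sum>k<n. e / 3)" using f(2) by (intro sum_mono) (simp add: less_imp_le)
          finally have "\<bar>(\<Sum>k<n. h (?o k)) - (\<Sum>k<n. f (?o k))\<bar> / real n \<le> e / 3"
            using that by (simp add: divide_le_eq mult.commute)
          then show ?thesis by (simp add: diff_divide_distrib[symmetric])
        qed
        show "\<exists>no. \<forall>n\<ge>no. norm ((\<Sum>k<n. h (?o k)) / real n - (\<integral>q. h q \<partial>torus_lebesgue)) < e"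
        proof (intro exI[of _ "max N 1"] allI impI)
          fix n assume n: "max N 1 \<le> n"
          then show "norm ((\<Sum>k<n. h (?o k)) / real n - (\<integral>q. h q \<partial>torus_lebesgue)) < e"
            using N[of n] b[of n] c unfolding real_norm_def by linarith
        qed
      qed
    qed
  qed
qed

end

lemma space_torus_lebesgue [simp]: "space torus_lebesgue = UNIV"
  by (simp add: torus_lebesgue_def)

section \<open>The invariant measure is the SRB measure\<close>

lemma sum_shift_bound:
  fixes a :: "nat \<Rightarrow> real"
  assumes "\<And>k. \<bar>a k\<bar> \<le> H"
  shows "\<bar>(\<Sum>k<n. a (k + L)) - (\<Sum>k<n. a k)\<bar> \<le> 2 * real L * H"
proof -
  have "(\<Sum>k<n. a (k + L)) = (\<Sum>k\<in>{L..<n + L}. a k)"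
    using sum.shift_bounds_nat_ivl[of a 0 L n] by (simp add: lessThan_atLeast0)
  also have "\<dots> = (\<Sum>k<n + L. a k) - (\<Sum>k<L. a k)"
    using sum.atLeastLessThan_concat[of 0 L "n + L" a] by (simp add: lessThan_atLeast0)
  also have "(\<Sum>k<n + L. a k) = (\<Sum>k<n. a k) + (\<Sum>k\<in>{n..<n + L}. a k)"
    using sum.atLeastLessThan_concat[of 0 n "n + L" a] by (simp add: lessThan_atLeast0)
  finally have "\<bar>(\<Sum>k<n. a (k + L)) - (\<Sum>k<n. a k)\<bar> = \<bar>(\<Sum>k\<in>{n..<n + L}. a k) - (\<Sum>k<L. a k)\<bar>" by simp
  also have "\<dots> \<le> \<bar>\<Sum>k\<in>{n..<n + L}. a k\<bar> + \<bar>\<Sum>k<L. a k\<bar>" by simp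
  also have "\<bar>\<Sum>k\<in>{n..<n + L}. a k\<bar> \<le> (\<Sum>k\<in>{n..<n + L}. H)"
    using assms by (intro order_trans[OF sum_abs] sum_mono)
  also have "\<bar>\<Sum>k<L. a k\<bar> \<le> (\<Sum>k<L. H)"
    using assms by (intro order_trans[OF sum_abs] sum_mono)
  finally show ?thesis by (simp add: mult_ac)
qed

lemma uniformly_continuous_cylinder:
  fixes h :: "('u :: finite) torus \<times> (real ^ 'd) \<Rightarrow> real"
  assumes "continuous_on UNIV h" "0 < e"
  obtains \<delta> where "0 < \<delta>"
    "\<And>p y y'. norm y \<le> K \<Longrightarrow> norm y' \<le> K \<Longrightarrow> norm (y - y') < \<delta> \<Longrightarrow> \<bar>h (p, y) - h (p, y')\<bar> < e"
proof -
  have "uniformly_continuous_on (cbox 0 1 \<times> cball 0 K) (\<lambda>z. h (cyl_proj z))"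
    by (intro compact_uniformly_continuous compact_Times compact_cbox compact_cball
        continuous_on_compose2[OF assms(1)] continuous_on_subset[OF continuous_cyl_proj]) auto
  then obtain \<delta> where \<delta>: "0 < \<delta>"
    "\<And>z z'. z \<in> cbox 0 1 \<times> cball 0 K \<Longrightarrow> z' \<in> cbox 0 1 \<times> cball 0 K \<Longrightarrow> dist z' z < \<delta> \<Longrightarrow>
      dist (h (cyl_proj z')) (h (cyl_proj z)) < e"
    using assms(2) unfolding uniformly_continuous_on_def by meson
  show thesis
  proof (rule that[OF \<delta>(1)])
    fix p :: "'u torus" and y y' :: "real ^ 'd"
    assume y: "norm y \<le> K" "norm y' \<le> K" "norm (y - y') < \<delta>"
    have "p \<in> torus_proj ` cbox 0 1" by (simp add: torus_proj_image_cbox)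
    then obtain x where x: "x \<in> cbox 0 1" "p = torus_proj x" by blast
    have "dist (h (cyl_proj (x, y))) (h (cyl_proj (x, y'))) < e"
      using x y by (intro \<delta>(2)) (auto simp: dist_Pair_Pair dist_norm)
    then show "\<bar>h (p, y) - h (p, y')\<bar> < e" by (simp add: x dist_real_def)
  qed
qed

lemma AE_cylinder_fst:
  fixes P :: "('u :: finite) torus \<Rightarrow> bool"
  assumes "AE p in torus_lebesgue. P p"
  shows "AE z in (cylinder_volume :: ('u torus \<times> (real ^ 'd)) measure). P (fst z)"
proof -
  obtain N where N: "{p \<in> space torus_lebesgue. \<not> P p} \<subseteq> N" "N \<in> null_sets torus_lebesgue"
    using assms by (auto elim!: AE_E3 simp: eventually_ae_filter)
  show ?thesis
  proof (rule AE_I')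
    have "emeasure (torus_lebesgue \<Otimes>\<^sub>M (lborel :: (real ^ 'd) measure)) (N \<times> UNIV) = 0"
      using N(2) by (subst lborel.emeasure_pair_measure_Times) auto
    then show "N \<times> UNIV \<in> null_sets (cylinder_volume :: ('u torus \<times> (real ^ 'd)) measure)"
      using N(2) unfolding cylinder_volume_def by (intro null_setsI) auto
    show "{z \<in> space (cylinder_volume :: ('u torus \<times> (real ^ 'd)) measure). \<not> P (fst z)} \<subseteq> N \<times> UNIV"
      using N(1) by (auto simp: space_torus_lebesgue)
  qed
qed

text \<open>Supplies a point from which the empirical measures converge to two given limits, so that the SRB
  measure is unique.\<close>

lemma cylinder_volume_nonzero:
  "\<not> (AE z in (cylinder_volume :: (('u :: finite) torus \<times> (real ^ 'd)) measure). False)"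
proof
  assume "AE z in (cylinder_volume :: ('u torus \<times> (real ^ 'd)) measure). False"
  then have "emeasure (cylinder_volume :: ('u torus \<times> (real ^ 'd)) measure) (space cylinder_volume) = 0"
    by (simp add: AE_iff_measurable[OF sets.top])
  moreover have "emeasure (cylinder_volume :: ('u torus \<times> (real ^ 'd)) measure) (space cylinder_volume) = \<infinity>"
  proof -
    have "emeasure (torus_lebesgue :: 'u torus measure) UNIV = 1" using torus.emeasure_space_1 by simp
    then show ?thesis
      unfolding cylinder_volume_def space_pair_measure
      by (subst lborel.emeasure_pair_measure_Times) auto
  qed
  ultimately show False by simp
qed

context skew_system
begin

context
  fixes g :: "'u torus \<Rightarrow> real ^ 'd"
  assumes g: "continuous_on UNIV g"
begin

abbreviation "T \<equiv> skew_product E C g"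

lemma fst_T_pow: "fst ((T ^^ k) z) = (torus_map E ^^ k) (fst z)"
  by (induction k) (auto simp: skew_product_def case_prod_unfold)

lemma T_pow_diff: "(T ^^ k) (p, y) = (fst ((T ^^ k) (p, 0)), snd ((T ^^ k) (p, 0)) + (C ^^ k) y)"
proof (induction k)
  case (Suc k)
  then show ?case using linear_add[OF linear_C] by (simp add: skew_product_def case_prod_unfold add_ac)
qed simp

lemma T_pow_bounded:
  obtains R where "0 \<le> R" "\<And>k z. norm (snd ((T ^^ k) z)) \<le> norm (snd z) + R"
proof -
  obtain B where B: "B \<ge> 0" "\<And>p. norm (g p) \<le> B" using bounded_on_torus[OF g] by blast
  let ?R = "B / (1 - rate)"
  have R: "0 \<le> ?R" "rate * ?R + B = ?R" using rate B(1) by (auto simp: field_simps)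
  have "norm (snd ((T ^^ k) z)) \<le> norm (snd z) + ?R" for k z
  proof (induction k)
    case (Suc k)
    let ?w = "(T ^^ k) z"
    have "norm (snd ((T ^^ Suc k) z)) \<le> norm (C (snd ?w)) + norm (g (fst ?w))"
      by (simp add: skew_product_def case_prod_unfold norm_triangle_ineq)
    also have "\<dots> \<le> rate * norm (snd ?w) + B" by (intro add_mono rate(3) B(2))
    also have "\<dots> \<le> rate * (norm (snd z) + ?R) + B" using Suc rate(1) by (intro add_right_mono mult_left_mono)
    also have "\<dots> = rate * norm (snd z) + ?R" using R(2) by (simp add: distrib_left)
    also have "\<dots> \<le> 1 * norm (snd z) + ?R" using rate by (intro add_right_mono mult_right_mono) auto
    finally show ?case by simp
  qed (use R in simp)
  then show thesis using that R(1) by blast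
qed

lemma continuous_T_pow: "continuous_on UNIV (T ^^ k)"
proof (induction k)
  case (Suc k)
  have "continuous_on UNIV (T \<circ> (T ^^ k))"
    using continuous_on_compose[OF Suc] continuous_on_subset[OF continuous_skew_product[OF g]] by blast
  then show ?case by simp
qed (simp add: id_def continuous_on_id)

lemma graph_measure_invariant_pow: "distr (graph_measure g) borel (T ^^ k) = graph_measure g"
proof (induction k)
  case 0
  show ?case by (simp add: id_def) (rule distr_id2, simp add: sets_graph_measure[OF g])
next
  case (Suc k)
  have [measurable]: "T ^^ k \<in> borel \<rightarrow>\<^sub>M borel" "T \<in> borel \<rightarrow>\<^sub>M borel"
    by (rule borel_measurable_continuous_onI[OF continuous_T_pow])
      (rule measurable_skew_product[OF g])
  have "distr (graph_measure g) borel (T ^^ Suc k) = distr (distr (graph_measure g) borel (T ^^ k)) borel T"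
    by (subst distr_distr) (auto simp: measurable_cong_sets[OF sets_graph_measure[OF g] refl] comp_def)
  then show ?case unfolding Suc graph_measure_invariant[OF g] .
qed

lemma integral_graph_measure:
  fixes f :: "'u torus \<times> (real ^ 'd) \<Rightarrow> real"
  assumes [measurable]: "f \<in> borel_measurable borel"
  shows "(\<integral>z. f z \<partial>graph_measure g) = (\<integral>w. f (torus_proj (fst w), height g (fst w) (snd w)) \<partial>(cube_lebesgue \<Otimes>\<^sub>M Str))"
  unfolding graph_measure_def using measurable_graph[OF g]
  by (subst integral_distr) (auto simp: case_prod_unfold)

lemma integral_torus_as_product:
  fixes f :: "'u torus \<Rightarrow> real"
  assumes [measurable]: "f \<in> borel_measurable borel"
  shows "(\<integral>p. f p \<partial>torus_lebesgue) = (\<integral>w. f (torus_proj (fst w)) \<partial>(cube_lebesgue \<Otimes>\<^sub>M Str))"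
proof -
  have "(\<integral>p. f p \<partial>torus_lebesgue) = (\<integral>x. f (torus_proj x) \<partial>cube_lebesgue)"
    unfolding torus_lebesgue_eq_distr by (subst integral_distr) auto
  also have "\<dots> = (\<integral>x. f (torus_proj x) \<partial>distr (cube_lebesgue \<Otimes>\<^sub>M Str) cube_lebesgue fst)"
    by (subst Str.distr_pair_fst) simp
  also have "\<dots> = (\<integral>w. f (torus_proj (fst w)) \<partial>(cube_lebesgue \<Otimes>\<^sub>M Str))"
    by (subst integral_distr) auto
  finally show ?thesis .
qed

text \<open>After \<open>L\<close> further steps the height depends on the starting height only by an amount that changes \<open>h\<close> by at most \<open>e\<close>. Hence \<open>h\<close> along an orbit is
  close to a continuous function on the torus, evaluated \<open>L\<close> steps earlier along the base orbit, and the
  same comparison under the invariant measure identifies the limit.\<close>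

lemma fibre_average_estimate:
  fixes h :: "'u torus \<times> (real ^ 'd) \<Rightarrow> real"
  assumes h: "continuous_on UNIV h" "\<And>z. \<bar>h z\<bar> \<le> H" and e: "0 < e"
  obtains L where "\<And>k. \<bar>h ((T ^^ (k + L)) z) - h ((T ^^ L) ((torus_map E ^^ k) (fst z), 0))\<bar> \<le> e"
    "\<bar>(\<integral>q. h ((T ^^ L) (q, 0)) \<partial>torus_lebesgue) - (\<integral>w. h w \<partial>graph_measure g)\<bar> \<le> e"
proof -
  obtain R where R: "0 \<le> R" "\<And>k z. norm (snd ((T ^^ k) z)) \<le> norm (snd z) + R" using T_pow_bounded by blast
  obtain B where B: "0 \<le> B" "\<And>x \<omega>. norm (height g x \<omega>) \<le> B" using height_bounded[OF g] by blast
  \<comment> \<open>Bounds every height along the orbit of \<open>z\<close> and every height under the graph measure.\<close>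
  define K where "K = norm (snd z) + R + B"
  have K: "0 \<le> K" unfolding K_def using R B by simp
  obtain \<delta> where \<delta>: "0 < \<delta>"
    "\<And>p y y'. norm y \<le> K + R \<Longrightarrow> norm y' \<le> K + R \<Longrightarrow> norm (y - y') < \<delta> \<Longrightarrow> \<bar>h (p, y) - h (p, y')\<bar> < e"
    using uniformly_continuous_cylinder[OF h(1) e, of "K + R"] by blast
  have "(\<lambda>L. rate ^ L * K) \<longlonglongrightarrow> 0 * K" using rate by (intro tendsto_mult_right LIMSEQ_power_zero) auto
  then have "eventually (\<lambda>L. rate ^ L * K < \<delta>) sequentially"
    using \<delta>(1) by (intro order_tendstoD(2)) auto
  then obtain L where L: "rate ^ L * K < \<delta>" by (auto dest: eventually_happens)
  have close: "\<bar>h ((T ^^ L) (p, y)) - h ((T ^^ L) (p, 0))\<bar> \<le> e" if y: "norm y \<le> K" for p y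
  proof -
    let ?w = "(T ^^ L) (p, 0)"
    have "norm ((C ^^ L) y) < \<delta>"
    proof -
      have "norm ((C ^^ L) y) \<le> rate ^ L * norm y" by (rule norm_Cpow)
      also have "\<dots> \<le> rate ^ L * K" using y rate(1) by (intro mult_left_mono) auto
      finally show ?thesis using L by simp
    qed
    moreover have "norm (snd ?w + (C ^^ L) y) \<le> K + R"
      using R(2)[of L "(p, y)"] y by (subst (asm) T_pow_diff) simp
    moreover have "norm (snd ?w) \<le> K + R" using R(2)[of L "(p, 0)"] K by simp
    ultimately have "\<bar>h (fst ?w, snd ?w + (C ^^ L) y) - h (fst ?w, snd ?w)\<bar> < e"
      by (intro \<delta>(2)) auto
    then show ?thesis by (subst T_pow_diff) simp
  qed
  have cont: "continuous_on UNIV (\<lambda>w. h ((T ^^ L) w))"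
    by (rule continuous_on_compose2[OF h(1) continuous_T_pow]) auto
  have cont0: "continuous_on UNIV (\<lambda>q. h ((T ^^ L) (q, 0)))"
    by (rule continuous_on_compose2[OF cont]) (auto intro!: continuous_intros)
  note [measurable] = borel_measurable_continuous_onI[OF cont] borel_measurable_continuous_onI[OF cont0]
    borel_measurable_continuous_onI[OF h(1)] borel_measurable_continuous_onI[OF continuous_T_pow]
  let ?P = "cube_lebesgue \<Otimes>\<^sub>M Str :: ((real ^ 'u) \<times> (real ^ 'u) stream) measure"
  let ?F = "\<lambda>w. h ((T ^^ L) (torus_proj (fst w), height g (fst w) (snd w)))"
  let ?G = "\<lambda>w. h ((T ^^ L) (torus_proj (fst w), 0))"
  have Fm: "?F \<in> borel_measurable ?P"
  proof -
    note [measurable] = measurable_graph[OF g]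
    have "(\<lambda>w. h ((T ^^ L) ((\<lambda>(x, \<omega>). (torus_proj x, height g x \<omega>)) w))) \<in> borel_measurable ?P" by measurable
    then show ?thesis by (simp add: case_prod_unfold)
  qed
  have Gm: "?G \<in> borel_measurable ?P"
  proof -
    have "(\<lambda>w. (\<lambda>q. h ((T ^^ L) (q, 0))) (torus_proj (fst w))) \<in> borel_measurable ?P" by measurable
    then show ?thesis by simp
  qed
  have iF: "integrable ?P ?F"
    by (rule QStr.integrable_const_bound[OF AE_I2 Fm]) (unfold real_norm_def, rule h(2))
  have iG: "integrable ?P ?G"
    by (rule QStr.integrable_const_bound[OF AE_I2 Gm]) (unfold real_norm_def, rule h(2))
  have "(\<integral>w. h w \<partial>graph_measure g) = (\<integral>w. h w \<partial>distr (graph_measure g) borel (T ^^ L))"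
    by (simp add: graph_measure_invariant_pow)
  also have "\<dots> = (\<integral>w. h ((T ^^ L) w) \<partial>graph_measure g)"
    by (subst integral_distr) (auto simp: measurable_cong_sets[OF sets_graph_measure[OF g] refl])
  also have "\<dots> = integral\<^sup>L ?P ?F" by (subst integral_graph_measure) auto
  finally have I1: "(\<integral>w. h w \<partial>graph_measure g) = integral\<^sup>L ?P ?F" .
  have I2: "(\<integral>q. h ((T ^^ L) (q, 0)) \<partial>torus_lebesgue) = integral\<^sup>L ?P ?G"
    by (subst integral_torus_as_product) auto
  have "\<bar>integral\<^sup>L ?P ?G - integral\<^sup>L ?P ?F\<bar> \<le> (\<integral>w. \<bar>?G w - ?F w\<bar> \<partial>?P)"
    using iF iG integral_abs_bound[of ?P "\<lambda>w. ?G w - ?F w"] by simp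
  also have "\<dots> \<le> (\<integral>w. e \<partial>?P)"
  proof (rule integral_mono)
    fix w
    have "norm (height g (fst w) (snd w)) \<le> K" unfolding K_def using B(2)[of "fst w" "snd w"] R(1) by (simp add: add_increasing)
    then show "\<bar>?G w - ?F w\<bar> \<le> e" using close by (subst abs_minus_commute)
  qed (use iF iG in auto)
  also have "\<dots> = e" by (simp add: QStr.prob_space)
  finally have 2: "\<bar>(\<integral>q. h ((T ^^ L) (q, 0)) \<partial>torus_lebesgue) - (\<integral>w. h w \<partial>graph_measure g)\<bar> \<le> e"
    unfolding I1 I2 .
  show thesis
  proof (rule that[OF _ 2])
    fix k
    have "(T ^^ (k + L)) z = (T ^^ L) (fst ((T ^^ k) z), snd ((T ^^ k) z))"
      by (simp add: add.commute[of k L] funpow_add)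
    moreover have "norm (snd ((T ^^ k) z)) \<le> K" using R(2)[of k z] B(1) by (simp add: K_def)
    ultimately show "\<bar>h ((T ^^ (k + L)) z) - h ((T ^^ L) ((torus_map E ^^ k) (fst z), 0))\<bar> \<le> e"
      using close[of "snd ((T ^^ k) z)" "fst ((T ^^ k) z)"] by (simp add: fst_T_pow)
  qed
qed

lemma generic_weakly_converges:
  assumes "generic (fst z)"
  shows "weakly_converges (empirical_measure T z) (graph_measure g)"
  unfolding weakly_converges_def
proof (intro allI impI, elim conjE)
  fix h :: "'u torus \<times> (real ^ 'd) \<Rightarrow> real"
  assume h: "continuous_on UNIV h" "bounded (range h)"
  then obtain H where H: "\<And>z. \<bar>h z\<bar> \<le> H" by (auto simp: bounded_iff)
  have H0: "0 \<le> H" using H[of z] by linarith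
  note hm = borel_measurable_continuous_onI[OF h(1)]
  show "(\<lambda>n. integral\<^sup>L (empirical_measure T z n) h) \<longlonglongrightarrow> integral\<^sup>L (graph_measure g) h"
    unfolding integral_empirical_measure[OF hm]
  proof (rule LIMSEQ_I)
    fix e :: real assume "0 < e"
    then have e5: "0 < e / 5" by simp
    obtain L where L: "\<And>k. \<bar>h ((T ^^ (k + L)) z) - h ((T ^^ L) ((torus_map E ^^ k) (fst z), 0))\<bar> \<le> e / 5"
      "\<bar>(\<integral>q. h ((T ^^ L) (q, 0)) \<partial>torus_lebesgue) - (\<integral>w. h w \<partial>graph_measure g)\<bar> \<le> e / 5"
      using fibre_average_estimate[OF h(1) H e5, of z] by blast
    let ?\<Psi> = "\<lambda>q. h ((T ^^ L) (q, 0))"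
    have "continuous_on UNIV (\<lambda>w. h ((T ^^ L) w))"
      by (rule continuous_on_compose2[OF h(1) continuous_T_pow]) auto
    then have "continuous_on UNIV ?\<Psi>"
      by (rule continuous_on_compose2) (auto intro!: continuous_intros)
    then have "(\<lambda>n. (\<Sum>k<n. ?\<Psi> ((torus_map E ^^ k) (fst z))) / real n) \<longlonglongrightarrow> (\<integral>q. ?\<Psi> q \<partial>torus_lebesgue)"
      using assms unfolding generic_def by blast
    from LIMSEQ_D[OF this e5] obtain N1 where N1: "\<And>n. n \<ge> N1 \<Longrightarrow>
        \<bar>(\<Sum>k<n. ?\<Psi> ((torus_map E ^^ k) (fst z))) / real n - (\<integral>q. ?\<Psi> q \<partial>torus_lebesgue)\<bar> < e / 5" by auto
    have "(\<lambda>n. (2 * real L * H) * (1 / real n)) \<longlonglongrightarrow> (2 * real L * H) * 0" by (intro tendsto_mult_left lim_1_over_n)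
    from LIMSEQ_D[OF this e5] obtain N2 where N2: "\<And>n. n \<ge> N2 \<Longrightarrow> 2 * real L * H / real n < e / 5"
      using H0 by auto
    show "\<exists>no. \<forall>n\<ge>no. norm ((\<Sum>k<n. h ((T ^^ k) z)) / real n - integral\<^sup>L (graph_measure g) h) < e"
    proof (intro exI allI impI)
      fix n assume n: "max (max N1 N2) 1 \<le> n"
      then have n0: "real n > 0" by simp
      have a: "\<bar>(\<Sum>k<n. h ((T ^^ (k + L)) z)) / real n - (\<Sum>k<n. h ((T ^^ k) z)) / real n\<bar> < e / 5"
      proof -
        have "\<bar>(\<Sum>k<n. h ((T ^^ (k + L)) z)) - (\<Sum>k<n. h ((T ^^ k) z))\<bar> / real n \<le> 2 * real L * H / real n"
          using sum_shift_bound[where a = "\<lambda>k. h ((T ^^ k) z)" and n = n and L = L, OF H] n0 by (intro divide_right_mono) auto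
        also have "\<dots> < e / 5" using N2 n by simp
        finally show ?thesis by (simp add: diff_divide_distrib[symmetric])
      qed
      have b: "\<bar>(\<Sum>k<n. h ((T ^^ (k + L)) z)) / real n - (\<Sum>k<n. ?\<Psi> ((torus_map E ^^ k) (fst z))) / real n\<bar> \<le> e / 5"
      proof -
        have "\<bar>(\<Sum>k<n. h ((T ^^ (k + L)) z)) - (\<Sum>k<n. ?\<Psi> ((torus_map E ^^ k) (fst z)))\<bar> \<le>
            (\<Sum>k<n. \<bar>h ((T ^^ (k + L)) z) - ?\<Psi> ((torus_map E ^^ k) (fst z))\<bar>)"
          unfolding sum_subtractf[symmetric] by (rule sum_abs)
        also have "\<dots> \<le> (\<Sum>k<n. e / 5)" by (intro sum_mono L(1))
        finally have "\<bar>(\<Sum>k<n. h ((T ^^ (k + L)) z)) - (\<Sum>k<n. ?\<Psi> ((torus_map E ^^ k) (fst z)))\<bar> / real n \<le> e / 5"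
          using n0 by (simp add: divide_le_eq mult.commute)
        then show ?thesis by (simp add: diff_divide_distrib[symmetric])
      qed
      have c: "\<bar>(\<Sum>k<n. ?\<Psi> ((torus_map E ^^ k) (fst z))) / real n - (\<integral>q. ?\<Psi> q \<partial>torus_lebesgue)\<bar> < e / 5"
        using N1 n by simp
      show "norm ((\<Sum>k<n. h ((T ^^ k) z)) / real n - integral\<^sup>L (graph_measure g) h) < e"
        using a b c L(2) unfolding real_norm_def by linarith
    qed
  qed
qed

theorem SRB_measure_eq: "SRB_measure T = graph_measure g"
  unfolding SRB_measure_def
proof (rule the_equality)
  have ae: "AE z in cylinder_volume. weakly_converges (empirical_measure T z) (graph_measure g)"
    using AE_cylinder_fst[OF AE_generic] by eventually_elim (rule generic_weakly_converges)
  then show "is_SRB_measure T (graph_measure g)"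
    unfolding is_SRB_measure_def
    using sets_graph_measure[OF g] prob_space_graph_measure[OF g] graph_measure_invariant[OF g] by simp
  fix \<mu> assume \<mu>: "is_SRB_measure T \<mu>"
  then have "AE z in cylinder_volume. weakly_converges (empirical_measure T z) \<mu>"
    by (simp add: is_SRB_measure_def)
  with ae have both: "AE z in cylinder_volume. weakly_converges (empirical_measure T z) (graph_measure g) \<and>
      weakly_converges (empirical_measure T z) \<mu>" by eventually_elim simp
  have "\<exists>z. weakly_converges (empirical_measure T z) (graph_measure g) \<and>
      weakly_converges (empirical_measure T z) \<mu>"
  proof (rule ccontr)
    assume no: "\<not> ?thesis"
    from both have "AE z in (cylinder_volume :: ('u torus \<times> (real ^ 'd)) measure). False"
      by eventually_elim (use no in blast)
    then show False using cylinder_volume_nonzero by blast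
  qed
  then obtain z where z: "weakly_converges (empirical_measure T z) (graph_measure g)"
      "weakly_converges (empirical_measure T z) \<mu>" by blast
  show "\<mu> = graph_measure g"
  proof (rule cylinder_measure_eqI)
    fix h :: "'u torus \<times> (real ^ 'd) \<Rightarrow> real"
    assume "continuous_on UNIV h" "bounded (range h)"
    then show "integral\<^sup>L \<mu> h = integral\<^sup>L (graph_measure g) h"
      using z unfolding weakly_converges_def by (blast intro: LIMSEQ_unique)
  qed (use \<mu> sets_graph_measure[OF g] prob_space_graph_measure[OF g] in \<open>simp_all add: is_SRB_measure_def\<close>)
qed

end

end

section \<open>Trigonometric polynomials are smooth and concentrate at points\<close>

text \<open>Directional derivatives only shift the phase by a quarter turn, so the class is closed under them.\<close>

lemma trig_poly_derivative:
  assumes "trig_poly f"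
  shows "\<exists>f'. (\<forall>x. ((\<lambda>x. f (torus_proj x)) has_derivative f' x) (at x)) \<and>
    (\<forall>v. \<exists>g. trig_poly g \<and> (\<forall>x. f' x v = g (torus_proj x)))"
  using assms
proof induction
  case (tcos v c \<theta>)
  show ?case
  proof (intro exI[of _ "\<lambda>x w. c * (- sin (2 * pi * (v \<bullet> x) + \<theta>) * (2 * pi * (v \<bullet> w)))"] conjI allI)
    fix x
    show "((\<lambda>x. c * tcos v \<theta> (torus_proj x)) has_derivative
        (\<lambda>w. c * (- sin (2 * pi * (v \<bullet> x) + \<theta>) * (2 * pi * (v \<bullet> w))))) (at x)"
      unfolding tcos_torus_proj[OF tcos] by (auto intro!: derivative_eq_intros)
  next
    fix w
    have "c * (- sin (2 * pi * (v \<bullet> x) + \<theta>) * (2 * pi * (v \<bullet> w))) =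
        (c * (2 * pi * (v \<bullet> w))) * tcos v (\<theta> + pi / 2) (torus_proj x)" for x
    proof -
      have "cos (2 * pi * (v \<bullet> x) + (\<theta> + pi / 2)) = - sin (2 * pi * (v \<bullet> x) + \<theta>)"
        by (simp only: minus_sin_cos_eq add.assoc of_real_eq_id id_apply)
      then show ?thesis by (simp only: tcos_torus_proj[OF tcos] mult_ac)
    qed
    then show "\<exists>g. trig_poly g \<and> (\<forall>x. c * (- sin (2 * pi * (v \<bullet> x) + \<theta>) * (2 * pi * (v \<bullet> w))) = g (torus_proj x))"
      by (intro exI[of _ "\<lambda>q. (c * (2 * pi * (v \<bullet> w))) * tcos v (\<theta> + pi / 2) q"] conjI allI trig_poly.tcos[OF tcos])
  qed
next
  case (add f g)
  then obtain f' g' where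
    f: "\<And>x. ((\<lambda>x. f (torus_proj x)) has_derivative f' x) (at x)"
      "\<And>v. \<exists>h. trig_poly h \<and> (\<forall>x. f' x v = h (torus_proj x))" and
    g: "\<And>x. ((\<lambda>x. g (torus_proj x)) has_derivative g' x) (at x)"
      "\<And>v. \<exists>h. trig_poly h \<and> (\<forall>x. g' x v = h (torus_proj x))"
    by blast
  show ?case
  proof (intro exI[of _ "\<lambda>x v. f' x v + g' x v"] conjI allI)
    show "((\<lambda>x. f (torus_proj x) + g (torus_proj x)) has_derivative (\<lambda>v. f' x v + g' x v)) (at x)" for x
      by (intro has_derivative_add f g)
    fix v
    obtain h1 h2 where "trig_poly h1" "\<And>x. f' x v = h1 (torus_proj x)" "trig_poly h2" "\<And>x. g' x v = h2 (torus_proj x)"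
      using f(2) g(2) by metis
    then show "\<exists>h. trig_poly h \<and> (\<forall>x. f' x v + g' x v = h (torus_proj x))"
      by (intro exI[of _ "\<lambda>p. h1 p + h2 p"]) (auto intro: trig_poly.add)
  qed
qed

lemma trig_poly_Cinf:
  fixes w :: "'b :: euclidean_space"
  assumes "trig_poly f"
  shows "torus_Cinf (\<lambda>p. f p *\<^sub>R w)"
proof -
  have "Ck k (\<lambda>x. f (torus_proj x) *\<^sub>R w)" for k
    using assms
  proof (induction k arbitrary: f)
    case 0
    then have "continuous_on UNIV (\<lambda>x. f (torus_proj x))"
      using trig_poly_continuous continuous_on_torus_iff by blast
    then show ?case by (simp add: continuous_on_scaleR)
  next
    case (Suc k)
    obtain f' where f': "\<And>x. ((\<lambda>x. f (torus_proj x)) has_derivative f' x) (at x)"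
      "\<And>v. \<exists>g. trig_poly g \<and> (\<forall>x. f' x v = g (torus_proj x))"
      using trig_poly_derivative[OF Suc.prems] by blast
    show ?case unfolding Ck.simps
    proof (intro exI[of _ "\<lambda>x v. f' x v *\<^sub>R w"] conjI allI)
      show "((\<lambda>x. f (torus_proj x) *\<^sub>R w) has_derivative (\<lambda>v. f' x v *\<^sub>R w)) (at x)" for x
        by (rule has_derivative_scaleR_left[OF f'(1)])
      fix v
      obtain g where "trig_poly g" "\<And>x. f' x v = g (torus_proj x)" using f'(2) by blast
      then show "Ck k (\<lambda>x. f' x v *\<^sub>R w)" using Suc.IH by simp
    qed
  qed
  then show ?thesis by (simp add: torus_Cinf_def torus_Ck_def comp_def)
qed

text \<open>A trigonometric polynomial with values in \<open>[0,1]\<close> that equals \<open>1\<close> only at \<open>p\<close>; its powers converge pointwise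
  to the indicator of \<open>{p}\<close>.\<close>

definition bump :: "('n :: finite) torus \<Rightarrow> 'n torus \<Rightarrow> real" where
  "bump p q = (\<Prod>i\<in>UNIV. (1 + tcos (axis i 1) (- (2 * pi * rep_torus p $ i)) q) / 2)"

lemma trig_poly_prod:
  assumes "finite I" "\<And>i. i \<in> I \<Longrightarrow> trig_poly (f i)"
  shows "trig_poly (\<lambda>p. \<Prod>i\<in>I. f i p)"
  using assms by (induction) (auto intro: trig_poly_const trig_poly_mult)

lemma trig_poly_power: "trig_poly f \<Longrightarrow> trig_poly (\<lambda>p. f p ^ n)"
  by (induction n) (auto intro: trig_poly_const trig_poly_mult)

lemma trig_poly_bump: "trig_poly (bump p)"
proof -
  have "trig_poly (\<lambda>q. 1 / 2 + (1 / 2) * tcos (axis i 1) (- (2 * pi * rep_torus p $ i)) q)" for i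
    by (intro trig_poly.add trig_poly_const trig_poly.tcos axis_int_lattice)
  then have "trig_poly (\<lambda>q. \<Prod>i\<in>UNIV. 1 / 2 + (1 / 2) * tcos (axis i 1) (- (2 * pi * rep_torus p $ i)) q)"
    by (intro trig_poly_prod) auto
  moreover have "bump p = (\<lambda>q. \<Prod>i\<in>UNIV. 1 / 2 + (1 / 2) * tcos (axis i 1) (- (2 * pi * rep_torus p $ i)) q)"
    by (simp add: bump_def fun_eq_iff add_divide_distrib)
  ultimately show ?thesis by simp
qed

lemma bump_bounds: "0 \<le> bump p q" "bump p q \<le> 1"
proof -
  have "0 \<le> (1 + tcos v \<theta> q) / 2" "(1 + tcos v \<theta> q) / 2 \<le> 1" for v \<theta>
    using abs_tcos_le[of v \<theta> q] by (auto simp: abs_le_iff)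
  then show "0 \<le> bump p q" "bump p q \<le> 1"
    unfolding bump_def by (auto intro!: prod_nonneg prod_le_1)
qed

lemma bump_self: "bump p p = 1"
  unfolding bump_def by (simp add: tcos_def inner_axis')

lemma bump_less_1:
  fixes p q :: "('n :: finite) torus"
  assumes "q \<noteq> p" shows "bump p q < 1"
proof -
  let ?x = "rep_torus p" and ?y = "rep_torus q"
  let ?f = "\<lambda>i. (1 + tcos (axis i 1) (- (2 * pi * ?x $ i)) q) / 2"
  have f: "0 \<le> ?f i" "?f i \<le> 1" for i
    using abs_tcos_le[of "axis i 1" "- (2 * pi * ?x $ i)" q] by (auto simp: abs_le_iff)
  have "?x - ?y \<notin> int_lattice"
    using assms torus_proj_eq_iff[of ?x ?y] by simp
  then obtain i where i: "?x $ i - ?y $ i \<notin> \<int>" by (auto simp: int_lattice_def)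
  have "tcos (axis i 1) (- (2 * pi * ?x $ i)) q \<noteq> 1"
  proof
    assume "tcos (axis i 1) (- (2 * pi * ?x $ i)) q = 1"
    then have "cos (2 * pi * ?y $ i + - (2 * pi * ?x $ i)) = 1" by (simp add: tcos_def inner_axis')
    then obtain k :: int where "2 * pi * ?y $ i + - (2 * pi * ?x $ i) = real_of_int k * 2 * pi"
      using cos_one_2pi_int by metis
    then have "2 * pi * (?x $ i - ?y $ i) = 2 * pi * real_of_int (- k)" by (simp add: algebra_simps)
    then have "?x $ i - ?y $ i = real_of_int (- k)"
      by (simp only: mult_cancel_left mult_eq_0_iff pi_neq_zero) simp
    then show False using i by (metis Ints_of_int)
  qed
  then have "?f i < 1" using f(2)[of i] by (auto simp: less_le)
  have "bump p q = ?f i * (\<Prod>j\<in>UNIV - {i}. ?f j)"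
    unfolding bump_def by (rule prod.remove) auto
  also have "\<dots> \<le> ?f i * 1" using f by (intro mult_left_mono prod_le_1) auto
  finally show ?thesis using \<open>?f i < 1\<close> by simp
qed

lemma bump_power_tendsto: "(\<lambda>n. bump p q ^ n) \<longlonglongrightarrow> of_bool (q = p)"
proof (cases "q = p")
  case True
  then show ?thesis by (simp add: bump_self)
next
  case False
  have "norm (bump p q) < 1" using bump_less_1[OF False] bump_bounds(1)[of p q] by simp
  then show ?thesis using False by (simp add: LIMSEQ_power_zero)
qed

section \<open>Pairs of backward orbits\<close>

text \<open>Used for the set of times at which a backward orbit revisits its first point, with least period \<open>k\<close>.\<close>

lemma arithmetic_progression_set:
  fixes A :: "nat set"
  assumes k: "1 \<le> k" and A0: "0 \<in> A"
    and down: "\<And>i. i \<in> A \<Longrightarrow> k \<le> i \<Longrightarrow> i - k \<in> A" and small: "\<And>i. i \<in> A \<Longrightarrow> i < k \<Longrightarrow> i = 0"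
    and b: "b \<in> A" "b + k \<notin> A"
  shows "\<exists>n. A = (\<lambda>j. j * k) ` {..n}"
proof -
  have mult: "\<exists>j. i = j * k" if "i \<in> A" for i
    using that
  proof (induction i rule: less_induct)
    case (less i)
    show ?case
    proof (cases "i < k")
      case True
      then show ?thesis using small less.prems by (intro exI[of _ 0]) auto
    next
      case False
      then obtain j where "i - k = j * k" using less.IH[of "i - k"] down less.prems k by auto
      then show ?thesis using False by (intro exI[of _ "Suc j"]) auto
    qed
  qed
  have descend: "(j + l) * k \<in> A \<Longrightarrow> j * k \<in> A" for j l
  proof (induction l)
    case (Suc l)
    then show ?case using down[of "(j + Suc l) * k"] by simp
  qed simp
  obtain n where n: "b = n * k" using mult b(1) by blast
  have "i \<in> A \<longleftrightarrow> (\<exists>j\<le>n. i = j * k)" for i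
  proof
    assume i: "i \<in> A"
    then obtain j where j: "i = j * k" using mult by blast
    have "j \<le> n"
    proof (rule ccontr)
      assume "\<not> j \<le> n"
      then obtain l where "j = Suc n + l" by (metis less_eq_Suc_le le_Suc_ex not_le)
      then have "Suc n * k \<in> A" using descend[of "Suc n" l] i j by simp
      then show False using b(2) n by (simp add: add.commute)
    qed
    then show "\<exists>j\<le>n. i = j * k" using j by blast
  next
    assume "\<exists>j\<le>n. i = j * k"
    then obtain j where "j \<le> n" "i = j * k" by blast
    then show "i \<in> A" using descend[of j "n - j"] b(1) n by simp
  qed
  then show ?thesis by (intro exI[of _ n]) auto
qed

lemma abs_diff_le_twice_bound:
  fixes \<psi> :: "'b \<Rightarrow> real"
  assumes "\<And>p. \<bar>\<psi> p\<bar> \<le> B"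
  shows "\<bar>\<psi> p - \<psi> q\<bar> \<le> 2 * B"
  using assms[of p] assms[of q] by linarith

context skew_system
begin

definition weighted :: "(nat \<Rightarrow> real) \<Rightarrow> real ^ 'd \<Rightarrow> real ^ 'd" where
  "weighted c w = (\<Sum>i. c i *\<^sub>R (C ^^ i) w)"

lemma norm_weighted_term: "\<bar>c i\<bar> \<le> K \<Longrightarrow> norm (c i *\<^sub>R (C ^^ i) w) \<le> rate ^ i * (K * norm w)"
proof -
  assume c: "\<bar>c i\<bar> \<le> K"
  have "norm (c i *\<^sub>R (C ^^ i) w) \<le> K * (rate ^ i * norm w)"
    unfolding norm_scaleR using c by (intro mult_mono norm_Cpow) auto
  then show ?thesis by (simp add: mult_ac)
qed

lemma summable_weighted:
  assumes "\<And>i. \<bar>c i\<bar> \<le> K" shows "summable (\<lambda>i. c i *\<^sub>R (C ^^ i) w)"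
  by (rule summable_comparison_test'[OF summable_rate[of "K * norm w"]])
    (rule norm_weighted_term[OF assms])

lemma linear_weighted:
  assumes "\<And>i. \<bar>c i\<bar> \<le> K" shows "linear (weighted c)"
proof (rule linearI)
  show "weighted c (v + w) = weighted c v + weighted c w" for v w
    unfolding weighted_def using linear_Cpow
    by (subst suminf_add[OF summable_weighted[OF assms] summable_weighted[OF assms]])
      (simp add: linear_add scaleR_add_right)
  show "weighted c (r *\<^sub>R v) = r *\<^sub>R weighted c v" for r v
  proof -
    have "weighted c (r *\<^sub>R v) = (\<Sum>i. r *\<^sub>R (c i *\<^sub>R (C ^^ i) v))"
      unfolding weighted_def by (simp add: linear_scale[OF linear_Cpow] mult.commute)
    also have "\<dots> = r *\<^sub>R weighted c v"
      unfolding weighted_def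
      by (rule bounded_linear.suminf[OF bounded_linear_scaleR_right summable_weighted[of c, OF assms], symmetric])
    finally show ?thesis .
  qed
qed

text \<open>Tannery's theorem, with the geometric majorant given by the contraction rate.\<close>

lemma weighted_tendsto:
  assumes F: "F \<noteq> bot" and lim: "\<And>i. ((\<lambda>x. c x i) \<longlongrightarrow> d i) F"
    and c: "\<And>x i. \<bar>c x i\<bar> \<le> K" and d: "\<And>i. \<bar>d i\<bar> \<le> K"
  shows "((\<lambda>x. weighted (c x) w) \<longlongrightarrow> weighted d w) F"
proof -
  let ?a = "\<lambda>i x. \<bar>c x i - d i\<bar> * (rate ^ i * norm w)"
  have cd: "\<bar>c x i - d i\<bar> \<le> 2 * K" for x i using c[of x i] d[of i] by linarith
  have ab: "norm (?a i x) \<le> rate ^ i * (2 * K * norm w)" for i x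
  proof -
    have "norm (?a i x) = \<bar>c x i - d i\<bar> * (rate ^ i * norm w)" using rate(1) by (simp add: abs_mult)
    also have "\<dots> \<le> 2 * K * (rate ^ i * norm w)" using rate(1) by (intro mult_right_mono cd) auto
    finally show ?thesis by (simp add: mult_ac)
  qed
  have "((\<lambda>x. \<Sum>i. ?a i x) \<longlongrightarrow> (\<Sum>i. 0)) F"
  proof (rule tannerys_theorem[THEN conjunct2, THEN conjunct2])
    show "((\<lambda>x. ?a i x) \<longlongrightarrow> 0) F" for i
      using tendsto_mult_right[OF tendsto_rabs[OF tendsto_diff[OF lim tendsto_const[of "d i"]]], of i "rate ^ i * norm w"] by simp
    show "\<forall>\<^sub>F (i, x) in at_top \<times>\<^sub>F F. norm (?a i x) \<le> rate ^ i * (2 * K * norm w)"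
      by (intro always_eventually) (use ab in auto)
  qed (use F summable_rate in auto)
  then have lim0: "((\<lambda>x. \<Sum>i. ?a i x) \<longlongrightarrow> 0) F" by simp
  have "norm (weighted (c x) w - weighted d w) \<le> (\<Sum>i. ?a i x)" for x
  proof -
    have "weighted (c x) w - weighted d w = (\<Sum>i. (c x i - d i) *\<^sub>R (C ^^ i) w)"
      unfolding weighted_def
      by (subst suminf_diff[OF summable_weighted[of "c x", OF c] summable_weighted[of d, OF d]]) (simp add: scaleR_diff_left)
    also have "norm \<dots> \<le> (\<Sum>i. ?a i x)"
    proof (rule norm_suminf_le)
      show "norm ((c x i - d i) *\<^sub>R (C ^^ i) w) \<le> ?a i x" for i
        unfolding norm_scaleR by (intro mult_left_mono norm_Cpow) auto
      show "summable (\<lambda>i. ?a i x)"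
        by (rule summable_comparison_test'[OF summable_rate]) (rule ab)
    qed
    finally show ?thesis .
  qed
  then have "((\<lambda>x. weighted (c x) w - weighted d w) \<longlongrightarrow> 0) F"
    by (intro Lim_null_comparison[OF _ lim0] always_eventually) auto
  then show ?thesis by (rule LIM_zero_cancel)
qed

lemma det_weighted_tendsto:
  assumes F: "F \<noteq> bot" and lim: "\<And>i. ((\<lambda>x. c x i) \<longlongrightarrow> d i) F"
    and c: "\<And>x i. \<bar>c x i\<bar> \<le> K" and d: "\<And>i. \<bar>d i\<bar> \<le> K"
  shows "((\<lambda>x. det (matrix (weighted (c x)))) \<longlongrightarrow> det (matrix (weighted d))) F"
  unfolding det_def matrix_def
  by (simp add: tendsto_sum tendsto_mult_left tendsto_prod tendsto_vec_nth[OF weighted_tendsto[OF assms]])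

lemma Cpow_fixed_eq_0:
  assumes "w = (C ^^ m) w" "1 \<le> m" shows "w = 0"
proof (rule ccontr)
  assume "w \<noteq> 0"
  have "norm w \<le> rate ^ m * norm w" using norm_Cpow[of m w] assms(1) by simp
  moreover have "rate ^ m < 1" using rate assms(2) by (simp add: power_less_one_iff)
  ultimately show False using \<open>w \<noteq> 0\<close> by simp
qed

text \<open>Let \<open>A\<close> be the set of times \<open>i\<close> with \<open>a\<^sub>i = a\<^sub>0\<close> and \<open>k\<close> the least positive one, if any. Applying \<open>E^k\<close> shows that \<open>A\<close> is
  stable under subtracting \<open>k\<close>. If \<open>A\<close> is also stable under adding \<open>k\<close>, the operator \<open>M\<close> satisfies
  \<open>M = 1 + C^k M\<close>. Otherwise \<open>A = {0, k, \<dots>, n k}\<close> and \<open>(1 - C^k) M = 1 - C^((n+1) k)\<close>. In both cases a kernel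
  vector is fixed by a positive power of \<open>C\<close> or vanishes at once.\<close>

lemma weighted_recurrence_injective:
  fixes a :: "nat \<Rightarrow> 'u torus"
  assumes orbit: "\<And>i. torus_map E (a (Suc i)) = a i"
    and w: "weighted (\<lambda>i. of_bool (a i = a 0)) w = 0"
  shows "w = 0"
proof -
  define A where "A = {i. a i = a 0}"
  let ?f = "\<lambda>i. of_bool (i \<in> A) *\<^sub>R (C ^^ i) w"
  have sf: "summable ?f" by (rule summable_weighted[of _ 1]) simp
  have w0: "(\<Sum>i. ?f i) = 0" using w by (simp add: weighted_def A_def)
  have push: "(torus_map E ^^ k) (a (i + k)) = a i" for i k
    by (induction k) (auto simp: funpow_swap1 orbit)
  obtain k where k: "1 \<le> k" "\<And>i. i \<in> A \<Longrightarrow> k \<le> i \<Longrightarrow> i - k \<in> A" "\<And>i. i \<in> A \<Longrightarrow> i < k \<Longrightarrow> i = 0"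
  proof (cases "\<exists>k\<ge>1. k \<in> A")
    case True
    define k where "k = (LEAST k. 1 \<le> k \<and> k \<in> A)"
    have k: "1 \<le> k" "k \<in> A" using LeastI_ex[of "\<lambda>k. 1 \<le> k \<and> k \<in> A"] True unfolding k_def by auto
    have "i = 0" if "i \<in> A" "i < k" for i
      using not_less_Least[of i "\<lambda>k. 1 \<le> k \<and> k \<in> A"] that unfolding k_def by auto
    moreover have "i - k \<in> A" if "i \<in> A" "k \<le> i" for i
    proof -
      have "a (i - k) = (torus_map E ^^ k) (a i)" using push[of k "i - k"] that by simp
      also have "\<dots> = (torus_map E ^^ k) (a k)" using that(1) k(2) by (simp add: A_def)
      also have "\<dots> = a 0" using push[of k 0] by simp
      finally show ?thesis by (simp add: A_def)
    qed
    ultimately show thesis using that k(1) by blast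
  next
    case False
    have only: "i = 0" if "i \<in> A" for i
    proof (rule ccontr)
      assume "i \<noteq> 0"
      then have "1 \<le> i" by simp
      then show False using False that by blast
    qed
    show thesis
    proof (rule that[of 1])
      show "i - 1 \<in> A" if "i \<in> A" "1 \<le> i" for i using only[OF that(1)] that(2) by simp
      show "i = 0" if "i \<in> A" "i < 1" for i using that(2) by simp
    qed simp
  qed
  have A0: "0 \<in> A" by (simp add: A_def)
  show ?thesis
  proof (cases "\<exists>b. b \<in> A \<and> b + k \<notin> A")
    case True
    then obtain b where b: "b \<in> A" "b + k \<notin> A" by blast
    obtain n where n: "A = (\<lambda>j. j * k) ` {..n}"
      using exE[OF arithmetic_progression_set[OF k(1) A0 k(2) k(3) b]] .
    have inj: "inj_on (\<lambda>j. j * k) {..n}" using k(1) by (auto simp: inj_on_def)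
    have "0 = (\<Sum>i\<in>A. (C ^^ i) w)"
      using w0 by (subst (asm) suminf_finite[of A]) (auto simp: n)
    also have "\<dots> = (\<Sum>j\<le>n. (C ^^ (j * k)) w)"
      unfolding n by (rule sum.reindex_cong[OF inj]) auto
    finally have z: "(\<Sum>j\<le>n. (C ^^ (j * k)) w) = 0" by simp
    have "0 = (C ^^ k) (\<Sum>j\<le>n. (C ^^ (j * k)) w)" unfolding z using linear_0[OF linear_Cpow] by simp
    also have "\<dots> = (\<Sum>j\<le>n. (C ^^ (Suc j * k)) w)"
      by (simp add: linear_sum[OF linear_Cpow] funpow_add)
    finally have "w - (C ^^ (Suc n * k)) w = 0"
      using z sum_telescope[of "\<lambda>j. (C ^^ (j * k)) w" n] by (simp add: sum_subtractf)
    then show ?thesis using Cpow_fixed_eq_0[of w "Suc n * k"] k(1) by simp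
  next
    case False
    have iff: "k + i \<in> A \<longleftrightarrow> i \<in> A" for i using False k(2)[of "k + i"] by (auto simp: add.commute)
    have "0 = (\<Sum>i. ?f (i + k)) + (\<Sum>i<k. ?f i)"
      using w0 suminf_split_initial_segment[OF sf, of k] by simp
    also have "(\<Sum>i<k. ?f i) = (\<Sum>i<k. if i = 0 then w else 0)"
    proof (rule sum.cong[OF refl])
      fix i assume "i \<in> {..<k}"
      then show "?f i = (if i = 0 then w else 0)"
        using k(3)[of i] A0 by (cases "i \<in> A") auto
    qed
    also have "\<dots> = w" using k(1) by simp
    also have "(\<Sum>i. ?f (i + k)) = (\<Sum>i. (C ^^ k) (?f i))"
      by (simp add: iff linear_scale[OF linear_Cpow] add.commute[of _ k] funpow_add)
    also have "\<dots> = (C ^^ k) (\<Sum>i. ?f i)"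
      using linear_Cpow by (intro bounded_linear.suminf[symmetric] sf) (simp add: linear_linear)
    also have "\<dots> = 0" unfolding w0 using linear_0[OF linear_Cpow] by simp
    finally show ?thesis by simp
  qed
qed

text \<open>If each orbit met the first point of the other, \<open>E^i\<close> and \<open>E^j\<close> would exchange the two first points for
  some \<open>i > 0\<close>. Both points would be fixed by \<open>E^(i+j)\<close>, but they have the same image under \<open>E\<close>.\<close>

lemma orbit_pair_avoids:
  fixes a b :: "nat \<Rightarrow> 'u torus"
  assumes a: "\<And>i. torus_map E (a (Suc i)) = a i" and b: "\<And>i. torus_map E (b (Suc i)) = b i"
    and ab: "torus_map E (a 0) = torus_map E (b 0)" "a 0 \<noteq> b 0"
  shows "(\<forall>i. b i \<noteq> a 0) \<or> (\<forall>i. a i \<noteq> b 0)"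
proof (rule ccontr)
  let ?t = "torus_map E"
  assume "\<not> ?thesis"
  then obtain i j where ij: "b i = a 0" "a j = b 0" by auto
  have pa: "(?t ^^ k) (a k) = a 0" for k by (induction k) (auto simp: funpow_swap1 a)
  have pb: "(?t ^^ k) (b k) = b 0" for k by (induction k) (auto simp: funpow_swap1 b)
  have 1: "(?t ^^ i) (a 0) = b 0" "(?t ^^ j) (b 0) = a 0" using pa[of j] pb[of i] ij by auto
  have "(?t ^^ (j + i)) (a 0) = a 0" "(?t ^^ (i + j)) (b 0) = b 0" using 1 by (auto simp: funpow_add)
  then have 2: "(?t ^^ (i + j)) (a 0) = a 0" "(?t ^^ (i + j)) (b 0) = b 0" by (simp_all add: add.commute)
  have "i \<noteq> 0" using ij ab(2) by (intro notI) auto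
  then obtain m where "i + j = Suc m" by (cases "i + j") auto
  then have "(?t ^^ (i + j)) (a 0) = (?t ^^ (i + j)) (b 0)" using ab(1) by (simp add: funpow_swap1)
  then show False using 2 ab(2) by simp
qed

definition difference_op :: "('u torus \<Rightarrow> real) \<Rightarrow> (nat \<Rightarrow> (real ^ 'u) \<times> (real ^ 'u)) \<Rightarrow> real ^ 'd \<Rightarrow> real ^ 'd" where
  "difference_op \<psi> \<xi> = weighted (\<lambda>i. \<psi> (torus_proj (fst (\<xi> i))) - \<psi> (torus_proj (snd (\<xi> i))))"

text \<open>Lifts to the unit cube of two backward orbits that start at different preimages of one point of the
  torus. That the starting points differ on the torus is expressed by membership in a set of lattice
  vectors; such sets are closed, which makes the whole set compact.\<close>

definition orbit_pairs :: "(nat \<Rightarrow> (real ^ 'u) \<times> (real ^ 'u)) set" where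
  "orbit_pairs = {\<xi>. (\<forall>i. \<xi> i \<in> cbox 0 1 \<times> cbox 0 1) \<and>
     (\<forall>i. E (fst (\<xi> (Suc i))) - fst (\<xi> i) \<in> int_lattice) \<and>
     (\<forall>i. E (snd (\<xi> (Suc i))) - snd (\<xi> i) \<in> int_lattice) \<and>
     E (fst (\<xi> 0)) - E (snd (\<xi> 0)) \<in> int_lattice - E ` int_lattice}"

lemma compact_orbit_pairs: "compact orbit_pairs"
proof -
  let ?S = "PiE UNIV (\<lambda>_ :: nat. cbox 0 1 \<times> cbox 0 1) :: (nat \<Rightarrow> (real ^ 'u) \<times> (real ^ 'u)) set"
  have "compactin (product_topology (\<lambda>_. euclidean) UNIV) ?S"
    by (subst compactin_PiE) (auto intro: compact_Times compact_cbox)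
  then have S: "compact ?S" by (simp add: euclidean_product_topology)
  have coord: "continuous_on UNIV (\<lambda>\<xi> :: nat \<Rightarrow> (real ^ 'u) \<times> (real ^ 'u). \<xi> i)" for i
    by simp
  have EC: "continuous_on UNIV E" using linear_E by (intro linear_continuous_on) (simp add: linear_linear)
  have c: "continuous_on UNIV (\<lambda>\<xi> :: nat \<Rightarrow> (real ^ 'u) \<times> (real ^ 'u). E (fst (\<xi> i)))"
    "continuous_on UNIV (\<lambda>\<xi> :: nat \<Rightarrow> (real ^ 'u) \<times> (real ^ 'u). E (snd (\<xi> i)))" for i
    using coord[of i] by (auto intro!: continuous_on_compose2[OF EC] continuous_intros)
  have cl: "closed {\<xi>. f \<xi> \<in> L}" if "continuous_on UNIV f" "L \<subseteq> int_lattice"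
    for f :: "(nat \<Rightarrow> (real ^ 'u) \<times> (real ^ 'u)) \<Rightarrow> real ^ 'u" and L
    using continuous_closed_vimage[of L f] that closed_subset_int_lattice[of L]
    by (simp add: vimage_def continuous_on_eq_continuous_at)
  have eq: "orbit_pairs = ?S \<inter> {\<xi>. (\<forall>i. E (fst (\<xi> (Suc i))) - fst (\<xi> i) \<in> int_lattice) \<and>
     (\<forall>i. E (snd (\<xi> (Suc i))) - snd (\<xi> i) \<in> int_lattice) \<and>
     E (fst (\<xi> 0)) - E (snd (\<xi> 0)) \<in> int_lattice - E ` int_lattice}"
    unfolding orbit_pairs_def by (auto simp: PiE_def Pi_def)
  show ?thesis unfolding eq
    by (intro compact_Int_closed[OF S] closed_Collect_conj closed_Collect_all cl)
      (auto intro!: continuous_intros c coord)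
qed

lemma continuous_det_difference_op:
  assumes "continuous_on UNIV \<psi>"
  shows "continuous_on UNIV (\<lambda>\<xi>. det (matrix (difference_op \<psi> \<xi>)))"
  unfolding continuous_on_def
proof
  fix \<xi> :: "nat \<Rightarrow> (real ^ 'u) \<times> (real ^ 'u)"
  obtain B where B: "\<And>p. \<bar>\<psi> p\<bar> \<le> B" using bounded_on_torus[OF assms] by auto
  have c: "continuous_on UNIV (\<lambda>\<xi> :: nat \<Rightarrow> (real ^ 'u) \<times> (real ^ 'u).
      \<psi> (torus_proj (fst (\<xi> i))) - \<psi> (torus_proj (snd (\<xi> i))))" for i
    by (intro continuous_intros continuous_on_compose2[OF assms] continuous_on_compose2[OF continuous_torus_proj]) auto
  show "((\<lambda>\<xi>. det (matrix (difference_op \<psi> \<xi>))) \<longlongrightarrow> det (matrix (difference_op \<psi> \<xi>))) (at \<xi> within UNIV)"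
  proof (cases "at \<xi> within UNIV = bot")
    case False
    show ?thesis unfolding difference_op_def
    proof (rule det_weighted_tendsto[OF False, of _ _ "2 * B"])
      show "((\<lambda>\<xi>. \<psi> (torus_proj (fst (\<xi> i))) - \<psi> (torus_proj (snd (\<xi> i)))) \<longlongrightarrow>
          \<psi> (torus_proj (fst (\<xi> i))) - \<psi> (torus_proj (snd (\<xi> i)))) (at \<xi> within UNIV)" for i
        using c[of i] unfolding continuous_on_def by blast
    qed (rule abs_diff_le_twice_bound[of \<psi> B, OF B])+
  qed simp
qed

text \<open>Concentrate \<open>\<psi>\<close> at the first point of one orbit that the other orbit avoids. The limit operator is
  injective, and the determinant depends continuously on the coefficients.\<close>

lemma exists_nondegenerate_trig_poly:
  assumes "\<xi> \<in> orbit_pairs"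
  shows "\<exists>\<psi>. trig_poly \<psi> \<and> det (matrix (difference_op \<psi> \<xi>)) \<noteq> 0"
proof -
  let ?a = "\<lambda>i. torus_proj (fst (\<xi> i))" and ?b = "\<lambda>i. torus_proj (snd (\<xi> i))"
  note P = assms[unfolded orbit_pairs_def, simplified]
  have a: "torus_map E (?a (Suc i)) = ?a i" and b: "torus_map E (?b (Suc i)) = ?b i" for i
    using P by (auto simp: torus_proj_eq_iff)
  have ab: "torus_map E (?a 0) = torus_map E (?b 0)" using P by (auto simp: torus_proj_eq_iff)
  have "fst (\<xi> 0) - snd (\<xi> 0) \<notin> int_lattice"
  proof
    assume *: "fst (\<xi> 0) - snd (\<xi> 0) \<in> int_lattice"
    have "E (fst (\<xi> 0)) - E (snd (\<xi> 0)) = E (fst (\<xi> 0) - snd (\<xi> 0))" using linear_E by (simp add: linear_diff)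
    then show False using P * by blast
  qed
  then have ne: "?a 0 \<noteq> ?b 0" by (simp add: torus_proj_eq_iff)
  have lim: "((\<lambda>n. det (matrix (difference_op (\<lambda>q. bump p q ^ n) \<xi>))) \<longlongrightarrow>
      det (matrix (weighted (\<lambda>i. of_bool (?a i = p) - of_bool (?b i = p))))) sequentially" for p
    unfolding difference_op_def
  proof (rule det_weighted_tendsto[of _ _ _ 2])
    show "\<bar>bump p (?a i) ^ n - bump p (?b i) ^ n\<bar> \<le> 2" for n i
    proof -
      have "0 \<le> bump p q ^ n" "bump p q ^ n \<le> 1" for q
        using bump_bounds[of p q] by (auto intro: power_le_one)
      from this[of "?a i"] this[of "?b i"] show ?thesis by linarith
    qed
    show "(\<lambda>n. bump p (?a i) ^ n - bump p (?b i) ^ n) \<longlonglongrightarrow> of_bool (?a i = p) - of_bool (?b i = p)" for i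
      by (intro tendsto_diff bump_power_tendsto)
  qed auto
  have nondeg: "det (matrix (weighted c)) \<noteq> 0" if c: "\<And>i. \<bar>c i\<bar> \<le> 2" and "\<And>w. weighted c w = 0 \<Longrightarrow> w = 0" for c
  proof -
    have lin: "linear (weighted c)" by (rule linear_weighted[of c 2, OF c])
    have "inj (weighted c)" unfolding linear_injective_0[OF lin] by (intro allI impI) (rule that(2))
    then show ?thesis using det_nz_iff_inj[OF lin] by blast
  qed
  have "\<exists>p. det (matrix (weighted (\<lambda>i. of_bool (?a i = p) - of_bool (?b i = p)))) \<noteq> 0"
    using orbit_pair_avoids[of ?a ?b, OF a b ab ne]
  proof
    assume "\<forall>i. ?b i \<noteq> ?a 0"
    then have "(\<lambda>i. of_bool (?a i = ?a 0) - of_bool (?b i = ?a 0)) = (\<lambda>i. of_bool (?a i = ?a 0) :: real)" by auto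
    then show ?thesis using weighted_recurrence_injective[of ?a, OF a]
      by (intro exI[of _ "?a 0"] nondeg) auto
  next
    assume "\<forall>i. ?a i \<noteq> ?b 0"
    then have eq: "(\<lambda>i. of_bool (?a i = ?b 0) - of_bool (?b i = ?b 0)) = (\<lambda>i. - of_bool (?b i = ?b 0) :: real)" by auto
    have "weighted (\<lambda>i. - of_bool (?b i = ?b 0)) w = - weighted (\<lambda>i. of_bool (?b i = ?b 0)) w" for w
      unfolding weighted_def by (subst suminf_minus[symmetric, OF summable_weighted[of _ 1]]) auto
    then show ?thesis using weighted_recurrence_injective[of ?b, OF b]
      by (intro exI[of _ "?b 0"] nondeg) (auto simp: eq)
  qed
  then obtain p where "det (matrix (weighted (\<lambda>i. of_bool (?a i = p) - of_bool (?b i = p)))) \<noteq> 0" by blast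
  from tendsto_imp_eventually_ne[OF lim this]
  obtain n where "det (matrix (difference_op (\<lambda>q. bump p q ^ n) \<xi>)) \<noteq> 0"
    by (auto dest: eventually_happens)
  then show ?thesis using trig_poly_power[OF trig_poly_bump] by blast
qed

theorem uniform_transversality:
  obtains \<Psi> \<delta> where "finite \<Psi>" "\<And>\<psi>. \<psi> \<in> \<Psi> \<Longrightarrow> trig_poly \<psi>" "0 < \<delta>"
    "\<And>\<xi>. \<xi> \<in> orbit_pairs \<Longrightarrow> \<exists>\<psi>\<in>\<Psi>. \<delta> \<le> \<bar>det (matrix (difference_op \<psi> \<xi>))\<bar>"
proof -
  let ?D = "\<lambda>\<psi> \<xi>. \<bar>det (matrix (difference_op \<psi> \<xi>))\<bar>"
  define pick where "pick \<xi> = (SOME \<psi>. trig_poly \<psi> \<and> det (matrix (difference_op \<psi> \<xi>)) \<noteq> 0)" for \<xi>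
  have pick: "trig_poly (pick \<xi>)" "0 < ?D (pick \<xi>) \<xi>" if "\<xi> \<in> orbit_pairs" for \<xi>
    using someI_ex[OF exists_nondegenerate_trig_poly[OF that]] unfolding pick_def by auto
  \<comment> \<open>Half of the value at \<open>\<xi>\<close> leaves a positive lower bound on a whole neighbourhood.\<close>
  let ?U = "\<lambda>\<xi>. {\<eta>. ?D (pick \<xi>) \<xi> / 2 < ?D (pick \<xi>) \<eta>}"
  have "open (?U \<xi>)" if "\<xi> \<in> orbit_pairs" for \<xi>
    by (intro open_Collect_less continuous_intros continuous_det_difference_op trig_poly_continuous pick that)
  note op = this
  have cover: "orbit_pairs \<subseteq> (\<Union>\<xi>\<in>orbit_pairs. ?U \<xi>)"
  proof
    fix \<xi> assume \<xi>: "\<xi> \<in> orbit_pairs"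
    then have "\<xi> \<in> ?U \<xi>" using pick(2)[OF \<xi>] by simp
    then show "\<xi> \<in> (\<Union>\<xi>\<in>orbit_pairs. ?U \<xi>)" using \<xi> by blast
  qed
  obtain D where D: "D \<subseteq> orbit_pairs" "finite D" "orbit_pairs \<subseteq> (\<Union>\<xi>\<in>D. ?U \<xi>)"
    by (rule compactE_image[OF compact_orbit_pairs op cover])
  define \<delta> where "\<delta> = Min (insert 1 ((\<lambda>\<xi>. ?D (pick \<xi>) \<xi> / 2) ` D))"
  have \<delta>: "0 < \<delta>" using D(1,2) pick(2) unfolding \<delta>_def by (subst Min_gr_iff) auto
  show thesis
  proof (rule that[of "pick ` D" \<delta>])
    fix \<eta> assume "\<eta> \<in> orbit_pairs"
    then obtain \<xi> where \<xi>: "\<xi> \<in> D" "?D (pick \<xi>) \<xi> / 2 < ?D (pick \<xi>) \<eta>" using D(3) by blast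
    have "\<delta> \<le> ?D (pick \<xi>) \<xi> / 2" unfolding \<delta>_def using D(2) \<xi>(1) by (intro Min_le) auto
    then show "\<exists>\<psi>\<in>pick ` D. \<delta> \<le> ?D \<psi> \<eta>" using \<xi> by (intro bexI[of _ "pick \<xi>"]) auto
  qed (use D pick \<delta> in auto)
qed

end

section \<open>Absolute continuity from bounded energy\<close>

lemma Liminf_finite_frequently:
  fixes e :: "nat \<Rightarrow> ennreal"
  assumes "liminf e < \<infinity>"
  obtains K :: real where "0 \<le> K" "\<exists>\<^sub>F j in sequentially. e j \<le> ennreal K"
proof -
  let ?C = "liminf e + 1"
  have fin: "?C < \<infinity>" using assms by (simp add: less_top)
  have "\<not> (\<forall>\<^sub>F j in sequentially. ?C \<le> e j)"
  proof
    assume "\<forall>\<^sub>F j in sequentially. ?C \<le> e j"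
    then have "?C \<le> liminf e" by (rule Liminf_bounded)
    moreover have "liminf e < ?C" using assms by (cases "liminf e") (auto simp: ennreal_less_iff simp flip: ennreal_plus ennreal_1)
    ultimately show False by simp
  qed
  then have *: "\<exists>\<^sub>F j in sequentially. e j \<le> ?C"
    unfolding frequently_def by (rule contrapos_nn) (erule eventually_mono, simp)
  have "ennreal (enn2real ?C) = ?C" using fin by (intro ennreal_enn2real) simp
  then show thesis using * by (intro that[of "enn2real ?C"]) auto
qed

lemma ennreal_mult_inverse_cancel: "0 < v \<Longrightarrow> ennreal v * (ennreal (1 / v) * X) = X"
  by (simp add: mult.assoc[symmetric] ennreal_mult[symmetric])

lemma ennreal_mult_left_le_imp_le:
  assumes "0 < v" "ennreal v * a \<le> ennreal v * b" shows "a \<le> b"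
proof -
  have eq: "ennreal (1 / v) * (ennreal v * X) = X" for X
    using assms(1) by (simp add: mult.assoc[symmetric] ennreal_mult[symmetric])
  have "ennreal (1 / v) * (ennreal v * a) \<le> ennreal (1 / v) * (ennreal v * b)"
    by (rule mult_left_mono[OF assms(2)]) simp
  then show ?thesis unfolding eq .
qed

text \<open>With \<open>b(w)\<close> the mass of \<open>ball w r\<close>, the left side is at most the integral of \<open>b\<close> over \<open>U\<close>. The elementary
  inequality \<open>b \<le> \<kappa> V + b\<^sup>2 / (\<kappa> V)\<close> replaces the Cauchy--Schwarz inequality, and \<open>\<integral> b\<^sup>2\<close> is at most \<open>V\<close> times the
  energy because two balls of radius \<open>r\<close> meet only if their centres are within \<open>2 r\<close>.\<close>

lemma energy_bound_open:
  fixes L :: "'a :: euclidean_space measure"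
  assumes L: "prob_space L" "sets L = sets borel" and U: "open U" and r: "0 < r" and \<kappa>: "0 < \<kappa>"
  defines "V \<equiv> unit_ball_vol (real DIM('a)) * r ^ DIM('a)"
  shows "ennreal V * emeasure L {y. ball y r \<subseteq> U} \<le> ennreal V * (ennreal \<kappa> * emeasure lborel U) +
    ennreal (1 / \<kappa>) * (\<integral>\<^sup>+y. \<integral>\<^sup>+y'. indicator (cball 0 (2 * r)) (y - y') \<partial>L \<partial>L)"
proof -
  interpret L: prob_space L by fact
  interpret LL: pair_sigma_finite L "lborel :: 'a measure" ..
  note [measurable_cong] = L(2)
  have V: "0 < V" unfolding V_def using r by (intro mult_pos_pos unit_ball_vol_pos) auto
  have Vball: "emeasure lborel (ball y r) = ennreal V" for y :: 'a
    unfolding V_def using r by (intro emeasure_ball) simp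
  have [measurable]: "U \<in> sets borel" using U by simp
  have "closed {y. ball y r \<subseteq> U}"
  proof -
    have "- {y. ball y r \<subseteq> U} = (\<Union>z\<in>- U. ball z r)" by (auto simp: dist_commute)
    then show ?thesis unfolding closed_def by auto
  qed
  then have [measurable]: "{y. ball y r \<subseteq> U} \<in> sets borel" by simp
  have [measurable]: "(\<lambda>(y :: 'a, w). indicator (ball y r) w :: ennreal) \<in> borel_measurable (borel \<Otimes>\<^sub>M borel)"
  proof -
    let ?S = "{p :: 'a \<times> 'a. dist (fst p) (snd p) < r}"
    have "open ?S" by (intro open_Collect_less continuous_intros)
    then have "(indicator ?S :: _ \<Rightarrow> ennreal) \<in> borel_measurable (borel :: ('a \<times> 'a) measure)" by simp
    moreover have "(indicator ?S :: _ \<Rightarrow> ennreal) = (\<lambda>(y, w). indicator (ball y r) w :: ennreal)"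
      by (auto simp: fun_eq_iff split: split_indicator)
    ultimately show ?thesis by (simp only: borel_prod)
  qed
  have [measurable]: "cball (0 :: 'a) (2 * r) \<in> sets borel" by simp
  define b where "b w = (\<integral>\<^sup>+y. indicator (ball y r) w \<partial>L)" for w
  have [measurable]: "b \<in> borel_measurable borel"
    unfolding b_def by measurable
  have b1: "b w \<le> 1" for w
  proof -
    have "b w \<le> (\<integral>\<^sup>+y. 1 \<partial>L)" unfolding b_def by (intro nn_integral_mono) (auto split: split_indicator)
    then show ?thesis using L.emeasure_space_1 by simp
  qed
  have "ennreal V * emeasure L {y. ball y r \<subseteq> U} = (\<integral>\<^sup>+y. ennreal V * indicator {y. ball y r \<subseteq> U} y \<partial>L)"
    by (simp add: nn_integral_cmult)
  also have "\<dots> \<le> (\<integral>\<^sup>+y. \<integral>\<^sup>+w. indicator U w * indicator (ball y r) w \<partial>lborel \<partial>L)"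
  proof (intro nn_integral_mono)
    fix y
    show "ennreal V * indicator {y. ball y r \<subseteq> U} y \<le> (\<integral>\<^sup>+w. indicator U w * indicator (ball y r) w \<partial>lborel)"
    proof (cases "ball y r \<subseteq> U")
      case True
      then have "(\<integral>\<^sup>+w. indicator U w * indicator (ball y r) w \<partial>lborel) = (\<integral>\<^sup>+w. indicator (ball y r) w \<partial>lborel)"
        by (intro nn_integral_cong) (auto split: split_indicator)
      then show ?thesis using True by (simp add: Vball)
    qed simp
  qed
  also have "\<dots> = (\<integral>\<^sup>+w. \<integral>\<^sup>+y. indicator U w * indicator (ball y r) w \<partial>L \<partial>lborel)"
    by (rule LL.Fubini'[symmetric]) measurable
  also have "\<dots> = (\<integral>\<^sup>+w. indicator U w * b w \<partial>lborel)"
    unfolding b_def by (intro nn_integral_cong nn_integral_cmult) measurable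
  also have "\<dots> \<le> (\<integral>\<^sup>+w. ennreal (\<kappa> * V) * indicator U w + ennreal (1 / (\<kappa> * V)) * (b w * b w) \<partial>lborel)"
  proof (intro nn_integral_mono)
    fix w
    obtain \<beta> where \<beta>: "b w = ennreal \<beta>" "0 \<le> \<beta>"
      using b1[of w] by (cases "b w") (auto simp: top_unique)
    have "\<beta> \<le> \<kappa> * V + (1 / (\<kappa> * V)) * (\<beta> * \<beta>)"
    proof (cases "\<beta> \<le> \<kappa> * V")
      case True
      then show ?thesis using V \<kappa> by (simp add: add_increasing2)
    next
      case False
      then have "\<beta> * 1 \<le> \<beta> * (\<beta> / (\<kappa> * V))" using V \<kappa> \<beta> by (intro mult_left_mono) (auto simp: le_divide_eq)
      then show ?thesis using V \<kappa> by (simp add: add_increasing)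
    qed
    then have "b w \<le> ennreal (\<kappa> * V) + ennreal (1 / (\<kappa> * V)) * (b w * b w)"
      using V \<kappa> \<beta> by (simp add: ennreal_mult[symmetric] ennreal_plus[symmetric] del: ennreal_plus)
    then show "indicator U w * b w \<le> ennreal (\<kappa> * V) * indicator U w + ennreal (1 / (\<kappa> * V)) * (b w * b w)"
      by (auto split: split_indicator)
  qed
  also have "\<dots> = ennreal (\<kappa> * V) * emeasure lborel U + ennreal (1 / (\<kappa> * V)) * (\<integral>\<^sup>+w. b w * b w \<partial>lborel)"
    by (simp add: nn_integral_add nn_integral_cmult)
  also have "(\<integral>\<^sup>+w. b w * b w \<partial>lborel) \<le>
      ennreal V * (\<integral>\<^sup>+y. \<integral>\<^sup>+y'. indicator (cball 0 (2 * r)) (y - y') \<partial>L \<partial>L)"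
  proof -
    have "(\<integral>\<^sup>+w. b w * b w \<partial>lborel) = (\<integral>\<^sup>+w. \<integral>\<^sup>+y. indicator (ball y r) w * b w \<partial>L \<partial>lborel)"
      by (subst (1) b_def) (intro nn_integral_cong nn_integral_multc[symmetric], measurable)
    also have "\<dots> = (\<integral>\<^sup>+y. \<integral>\<^sup>+w. indicator (ball y r) w * b w \<partial>lborel \<partial>L)"
      by (rule LL.Fubini') measurable
    also have "\<dots> = (\<integral>\<^sup>+y. \<integral>\<^sup>+w. \<integral>\<^sup>+y'. indicator (ball y r) w * indicator (ball y' r) w \<partial>L \<partial>lborel \<partial>L)"
      unfolding b_def by (intro nn_integral_cong nn_integral_cmult[symmetric]) measurable
    also have "\<dots> = (\<integral>\<^sup>+y. \<integral>\<^sup>+y'. \<integral>\<^sup>+w. indicator (ball y r) w * indicator (ball y' r) w \<partial>lborel \<partial>L \<partial>L)"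
      by (intro nn_integral_cong LL.Fubini') measurable
    also have "\<dots> \<le> (\<integral>\<^sup>+y. \<integral>\<^sup>+y'. ennreal V * indicator (cball 0 (2 * r)) (y - y') \<partial>L \<partial>L)"
    proof (intro nn_integral_mono)
      fix y y' :: 'a
      show "(\<integral>\<^sup>+w. indicator (ball y r) w * indicator (ball y' r) w \<partial>lborel) \<le> ennreal V * indicator (cball 0 (2 * r)) (y - y')"
      proof (cases "norm (y - y') \<le> 2 * r")
        case True
        have "(\<integral>\<^sup>+w. indicator (ball y r) w * indicator (ball y' r) w \<partial>lborel) \<le> (\<integral>\<^sup>+w. indicator (ball y r) w \<partial>lborel)"
          by (intro nn_integral_mono) (auto split: split_indicator)
        then show ?thesis using True by (simp add: Vball)
      next
        case False
        have "indicator (ball y r) w * indicator (ball y' r) w = (0 :: ennreal)" for w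
        proof -
          have "\<not> (dist y w < r \<and> dist y' w < r)"
            using False dist_triangle2[of y y' w] by (auto simp: dist_norm)
          then show ?thesis by (auto split: split_indicator)
        qed
        note zero = this
        show ?thesis unfolding zero by simp
      qed
    qed
    also have "\<dots> = (\<integral>\<^sup>+y. ennreal V * (\<integral>\<^sup>+y'. indicator (cball 0 (2 * r)) (y - y') \<partial>L) \<partial>L)"
      by (intro nn_integral_cong nn_integral_cmult) measurable
    also have "\<dots> = ennreal V * (\<integral>\<^sup>+y. \<integral>\<^sup>+y'. indicator (cball 0 (2 * r)) (y - y') \<partial>L \<partial>L)"
      by (intro nn_integral_cmult) measurable
    finally show ?thesis .
  qed
  finally have "ennreal V * emeasure L {y. ball y r \<subseteq> U} \<le> ennreal (\<kappa> * V) * emeasure lborel U +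
    ennreal (1 / (\<kappa> * V)) * (ennreal V * (\<integral>\<^sup>+y. \<integral>\<^sup>+y'. indicator (cball 0 (2 * r)) (y - y') \<partial>L \<partial>L))"
    by (simp add: mult_left_mono add_left_mono)
  also have "ennreal (1 / (\<kappa> * V)) * (ennreal V * (\<integral>\<^sup>+y. \<integral>\<^sup>+y'. indicator (cball 0 (2 * r)) (y - y') \<partial>L \<partial>L)) =
      ennreal (1 / \<kappa>) * (\<integral>\<^sup>+y. \<integral>\<^sup>+y'. indicator (cball 0 (2 * r)) (y - y') \<partial>L \<partial>L)"
    using V \<kappa> by (simp add: mult.assoc[symmetric] ennreal_mult[symmetric])
  also have "ennreal (\<kappa> * V) * emeasure lborel U = ennreal V * (ennreal \<kappa> * emeasure lborel U)"
    using V \<kappa> by (simp add: ennreal_mult mult_ac)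
  finally show ?thesis .
qed

text \<open>If the energies are at most \<open>K\<close> times the volumes of the balls along a subsequence, then
  \<open>L U \<le> \<kappa> |U| + K / \<kappa>\<close> for every open \<open>U\<close> and every \<open>\<kappa> > 0\<close>. A null set has open neighbourhoods of arbitrarily
  small volume; let the volume tend to \<open>0\<close> and then \<open>\<kappa>\<close> to infinity.\<close>

lemma bounded_energy_absolutely_continuous:
  fixes L :: "'a :: euclidean_space measure"
  assumes L: "prob_space L" "sets L = sets borel"
    and r: "\<And>j. 0 < r j" "decseq r" "r \<longlonglongrightarrow> 0"
    and fin: "liminf (\<lambda>j. ennreal (1 / (unit_ball_vol (real DIM('a)) * r j ^ DIM('a))) *
      (\<integral>\<^sup>+y. \<integral>\<^sup>+y'. indicator (cball 0 (2 * r j)) (y - y') \<partial>L \<partial>L)) < \<infinity>"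
  shows "absolutely_continuous lborel L"
proof -
  interpret L: prob_space L by fact
  let ?V = "\<lambda>j. unit_ball_vol (real DIM('a)) * r j ^ DIM('a)"
  let ?e = "\<lambda>j. (\<integral>\<^sup>+y. \<integral>\<^sup>+y'. indicator (cball 0 (2 * r j)) (y - y') \<partial>L \<partial>L)"
  have V: "0 < ?V j" for j using r(1)[of j] by (intro mult_pos_pos unit_ball_vol_pos) auto
  obtain K where K: "0 \<le> K" "\<exists>\<^sub>F j in sequentially. ennreal (1 / ?V j) * ?e j \<le> ennreal K"
    using Liminf_finite_frequently[OF fin] by blast
  have open_bound: "emeasure L U \<le> ennreal \<kappa> * emeasure lborel U + ennreal (K / \<kappa>)"
    if U: "open U" and \<kappa>: "0 < \<kappa>" for U \<kappa>
  proof -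
    let ?U = "\<lambda>j. {y. ball y (r j) \<subseteq> U}"
    have good: "emeasure L (?U j) \<le> ennreal \<kappa> * emeasure lborel U + ennreal (K / \<kappa>)"
      if j: "ennreal (1 / ?V j) * ?e j \<le> ennreal K" for j
    proof -
      have "?e j = ennreal (?V j) * (ennreal (1 / ?V j) * ?e j)"
        by (rule ennreal_mult_inverse_cancel[OF V, symmetric])
      also have "\<dots> \<le> ennreal (?V j) * ennreal K" by (intro mult_left_mono j) simp
      finally have e: "?e j \<le> ennreal (?V j) * ennreal K" .
      have "ennreal (?V j) * emeasure L (?U j) \<le> ennreal (?V j) * (ennreal \<kappa> * emeasure lborel U) + ennreal (1 / \<kappa>) * ?e j"
        by (rule energy_bound_open[OF L U r(1) \<kappa>])
      also have "\<dots> \<le> ennreal (?V j) * (ennreal \<kappa> * emeasure lborel U) + ennreal (1 / \<kappa>) * (ennreal (?V j) * ennreal K)"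
        by (intro add_left_mono mult_left_mono e) simp
      also have "\<dots> = ennreal (?V j) * (ennreal \<kappa> * emeasure lborel U + ennreal (K / \<kappa>))"
      proof -
        have "ennreal (1 / \<kappa>) * (ennreal (?V j) * ennreal K) = ennreal (?V j) * (ennreal (1 / \<kappa>) * ennreal K)"
          by (simp add: mult_ac)
        also have "ennreal (1 / \<kappa>) * ennreal K = ennreal (K / \<kappa>)"
          using \<kappa> K(1) by (simp add: ennreal_mult[symmetric])
        finally show ?thesis by (simp add: distrib_left)
      qed
      finally show ?thesis by (rule ennreal_mult_left_le_imp_le[OF V])
    qed
    have "incseq ?U"
    proof (rule incseq_SucI)
      fix j
      have "ball y (r (Suc j)) \<subseteq> ball y (r j)" for y
        using decseq_SucD[OF r(2), of j] by (intro subset_ball)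
      then show "?U j \<subseteq> ?U (Suc j)" by blast
    qed
    have "(\<Union>j. ?U j) = U"
    proof (intro equalityI subsetI)
      fix y assume "y \<in> (\<Union>j. ?U j)"
      then show "y \<in> U" using r(1) by (force simp: subset_iff)
    next
      fix y assume "y \<in> U"
      then obtain \<epsilon> where \<epsilon>: "0 < \<epsilon>" "ball y \<epsilon> \<subseteq> U" using U open_contains_ball by blast
      have "\<forall>\<^sub>F j in sequentially. r j < \<epsilon>" using r(3) \<epsilon>(1) by (rule order_tendstoD(2))
      then obtain j where "r j < \<epsilon>" by (auto dest: eventually_happens)
      then have "ball y (r j) \<subseteq> ball y \<epsilon>" by (intro subset_ball) simp
      then show "y \<in> (\<Union>j. ?U j)" using \<epsilon>(2) by blast
    qed
    have "?U j \<in> sets L" for j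
    proof -
      have "- ?U j = (\<Union>z\<in>- U. ball z (r j))" by (auto simp: dist_commute)
      then have "closed (?U j)" unfolding closed_def by auto
      then show ?thesis using L(2) by simp
    qed
    then have "(\<lambda>j. emeasure L (?U j)) \<longlonglongrightarrow> emeasure L (\<Union>j. ?U j)"
      using \<open>incseq ?U\<close> by (intro Lim_emeasure_incseq) auto
    then have lim: "(\<lambda>j. emeasure L (?U j)) \<longlonglongrightarrow> emeasure L U" by (simp add: \<open>(\<Union>j. ?U j) = U\<close>)
    show ?thesis
    proof (rule ccontr)
      assume "\<not> ?thesis"
      then have "\<forall>\<^sub>F j in sequentially. ennreal \<kappa> * emeasure lborel U + ennreal (K / \<kappa>) < emeasure L (?U j)"
        by (intro order_tendstoD(1)[OF lim]) simp
      from frequently_eventually_frequently[OF K(2) this]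
      obtain j where "ennreal (1 / ?V j) * ?e j \<le> ennreal K"
        "ennreal \<kappa> * emeasure lborel U + ennreal (K / \<kappa>) < emeasure L (?U j)"
        by (auto dest: frequently_ex)
      then show False using good[of j] by simp
    qed
  qed
  show ?thesis
    unfolding absolutely_continuous_def
  proof
    fix A :: "'a set" assume A: "A \<in> null_sets lborel"
    have "emeasure L A \<le> 0 + ennreal \<epsilon>" if \<epsilon>: "0 < \<epsilon>" for \<epsilon>
    proof -
      \<comment> \<open>Chosen so that \<open>K / \<kappa> \<le> \<epsilon> / 2\<close>; adding \<open>1\<close> to \<open>K\<close> keeps \<open>\<kappa>\<close> positive.\<close>
      define \<kappa> where "\<kappa> = 2 * (K + 1) / \<epsilon>"
      have \<kappa>: "0 < \<kappa>" using K(1) \<epsilon> by (simp add: \<kappa>_def)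
      have K\<kappa>: "K / \<kappa> \<le> \<epsilon> / 2" using K(1) \<epsilon> by (simp add: \<kappa>_def field_simps)
      define \<eta> where "\<eta> = \<epsilon> / (2 * \<kappa>)"
      have \<eta>: "0 < \<eta>" "\<kappa> * \<eta> = \<epsilon> / 2" using \<epsilon> \<kappa> by (auto simp: \<eta>_def)
      have "A \<in> sets borel" using null_setsD2[OF A] by simp
      from outer_regular_lborel[OF this \<eta>(1)]
      obtain U where U: "open U" "A \<subseteq> U" "emeasure lborel (U - A) < ennreal \<eta>" .
      have "emeasure lborel U \<le> emeasure lborel (U - A) + emeasure lborel A"
        using A U(1,2) by (subst emeasure_Diff_null_set) (auto simp: null_setsD1)
      then have "emeasure lborel U \<le> ennreal \<eta>" using U(3) A by (simp add: null_setsD1)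
      have "emeasure L A \<le> emeasure L U" using U L(2) by (intro emeasure_mono) auto
      also have "\<dots> \<le> ennreal \<kappa> * emeasure lborel U + ennreal (K / \<kappa>)" by (rule open_bound[OF U(1) \<kappa>])
      also have "\<dots> \<le> ennreal \<kappa> * ennreal \<eta> + ennreal (\<epsilon> / 2)"
        by (intro add_mono mult_left_mono ennreal_leI \<open>emeasure lborel U \<le> ennreal \<eta>\<close> K\<kappa>) simp
      also have "\<dots> = ennreal \<epsilon>"
        using \<kappa> \<eta> \<epsilon> by (simp add: ennreal_mult[symmetric] ennreal_plus[symmetric] del: ennreal_plus)
      finally show ?thesis by simp
    qed
    note eps = this
    have "emeasure L A \<le> 0" by (rule ennreal_le_epsilon) (rule eps)
    then have "emeasure L A = 0" by (simp only: le_zero_eq)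
    moreover have "A \<in> sets L" unfolding L(2) using null_setsD2[OF A] by (simp only: sets_lborel)
    ultimately show "A \<in> null_sets L" by (rule null_setsI)
  qed
qed

section \<open>Averaging over a block of parameters\<close>

lemma distr_PiM_Basis_block:
  fixes e :: "'k \<Rightarrow> 'a :: euclidean_space"
  assumes "finite B" and e: "bij_betw e B Basis"
  shows "distr (\<Pi>\<^sub>M k\<in>B. lborel) borel (\<lambda>t. \<Sum>k\<in>B. t k *\<^sub>R e k) = lborel"
proof (rule lborel_eqI[symmetric])
  interpret P: product_sigma_finite "\<lambda>_ :: 'k. lborel :: real measure" ..
  fix l u :: 'a assume le: "\<And>b. b \<in> Basis \<Longrightarrow> l \<bullet> b \<le> u \<bullet> b"
  have eB: "e k \<in> Basis" if "k \<in> B" for k using e that by (auto simp: bij_betw_def)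
  have inner: "(\<Sum>k\<in>B. t k *\<^sub>R e k) \<bullet> e j = t j" if j: "j \<in> B" for t j
  proof -
    have "(\<Sum>k\<in>B. t k *\<^sub>R e k) \<bullet> e j = (\<Sum>k\<in>B. if k = j then t k else 0)"
      unfolding inner_sum_left
    proof (rule sum.cong[OF refl])
      fix k assume "k \<in> B"
      then have "e k = e j \<longleftrightarrow> k = j" using e j by (auto simp: bij_betw_def inj_on_def)
      then show "(t k *\<^sub>R e k) \<bullet> e j = (if k = j then t k else 0)"
        using inner_Basis[OF eB[OF \<open>k \<in> B\<close>] eB[OF j]] by auto
    qed
    then show ?thesis using j assms(1) by simp
  qed
  let ?f = "\<lambda>t. \<Sum>k\<in>B. t k *\<^sub>R e k"
  have [measurable]: "?f \<in> (\<Pi>\<^sub>M k\<in>B. lborel) \<rightarrow>\<^sub>M borel" by measurable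
  have "?f -` box l u \<inter> space (\<Pi>\<^sub>M k\<in>B. lborel) = (\<Pi>\<^sub>E k\<in>B. {l \<bullet> e k<..<u \<bullet> e k})"
  proof -
    have "?f t \<in> box l u \<longleftrightarrow> (\<forall>k\<in>B. t k \<in> {l \<bullet> e k<..<u \<bullet> e k})" for t
    proof -
      have "?f t \<in> box l u \<longleftrightarrow> (\<forall>b\<in>e ` B. l \<bullet> b < ?f t \<bullet> b \<and> ?f t \<bullet> b < u \<bullet> b)"
        using e by (simp add: mem_box bij_betw_def)
      then show ?thesis by (auto simp: inner)
    qed
    then show ?thesis by (auto simp: space_PiM PiE_iff)
  qed
  then have "emeasure (distr (\<Pi>\<^sub>M k\<in>B. lborel) borel ?f) (box l u) = emeasure (\<Pi>\<^sub>M k\<in>B. lborel) (\<Pi>\<^sub>E k\<in>B. {l \<bullet> e k<..<u \<bullet> e k})"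
    by (subst emeasure_distr) auto
  also have "\<dots> = (\<Prod>k\<in>B. emeasure lborel {l \<bullet> e k<..<u \<bullet> e k})"
    using assms(1) by (intro P.emeasure_PiM) auto
  also have "\<dots> = (\<Prod>k\<in>B. ennreal ((u - l) \<bullet> e k))"
    using le eB by (intro prod.cong refl) (simp add: inner_diff_left)
  also have "\<dots> = ennreal (\<Prod>k\<in>B. (u - l) \<bullet> e k)"
    using le eB by (intro prod_ennreal) (simp add: inner_diff_left)
  also have "(\<Prod>k\<in>B. (u - l) \<bullet> e k) = (\<Prod>b\<in>Basis. (u - l) \<bullet> b)"
    using e by (rule prod.reindex_bij_betw)
  finally show "emeasure (distr (\<Pi>\<^sub>M k\<in>B. lborel) borel ?f) (box l u) = (\<Prod>b\<in>Basis. (u - l) \<bullet> b)" .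
qed simp

lemma nn_integral_block:
  fixes e :: "'k \<Rightarrow> real ^ 'd" and A :: "real ^ 'd \<Rightarrow> real ^ 'd"
  assumes "finite B" "bij_betw e B Basis" "linear A" "det (matrix A) \<noteq> 0" and [measurable]: "X \<in> sets borel"
  shows "(\<integral>\<^sup>+t. indicator X (c + (\<Sum>k\<in>B. t k *\<^sub>R A (e k))) \<partial>(\<Pi>\<^sub>M k\<in>B. lborel)) =
    ennreal (1 / \<bar>det (matrix A)\<bar>) * emeasure lborel X"
proof -
  have [measurable]: "A \<in> borel \<rightarrow>\<^sub>M borel"
    using assms(3) by (intro borel_measurable_continuous_onI linear_continuous_on) (simp add: linear_linear)
  have "(\<integral>\<^sup>+t. indicator X (c + (\<Sum>k\<in>B. t k *\<^sub>R A (e k))) \<partial>(\<Pi>\<^sub>M k\<in>B. lborel)) =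
      (\<integral>\<^sup>+t. indicator X (c + A (\<Sum>k\<in>B. t k *\<^sub>R e k)) \<partial>(\<Pi>\<^sub>M k\<in>B. lborel))"
    by (simp add: linear_sum[OF assms(3)] linear_scale[OF assms(3)])
  also have "\<dots> = (\<integral>\<^sup>+\<tau>. indicator X (c + A \<tau>) \<partial>distr (\<Pi>\<^sub>M k\<in>B. lborel) borel (\<lambda>t. \<Sum>k\<in>B. t k *\<^sub>R e k))"
    by (rule nn_integral_distr[symmetric]) measurable
  also have "\<dots> = (\<integral>\<^sup>+\<tau>. indicator X (c + A \<tau>) \<partial>lborel)"
    by (simp only: distr_PiM_Basis_block[OF assms(1,2)])
  also have "\<dots> = ennreal (1 / \<bar>det (matrix A)\<bar>) * (ennreal \<bar>det (matrix A)\<bar> * (\<integral>\<^sup>+\<tau>. indicator X (c + A \<tau>) \<partial>lborel))"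
    using assms(4) by (simp add: mult.assoc[symmetric] ennreal_mult[symmetric])
  also have "ennreal \<bar>det (matrix A)\<bar> * (\<integral>\<^sup>+\<tau>. indicator X (c + A \<tau>) \<partial>lborel) = (\<integral>\<^sup>+\<tau>. indicator X (c + \<tau>) \<partial>lborel)"
    using assms(3,4) det_nz_iff_inj[OF assms(3)] by (intro nn_integral_lborel_linear[where h = "\<lambda>\<tau>. indicator X (c + \<tau>)"]) auto
  also have "\<dots> = emeasure lborel X"
    by (subst nn_integral_lborel_translate) auto
  finally show ?thesis .
qed

definition param_box :: "nat set \<Rightarrow> real \<Rightarrow> (nat \<Rightarrow> real) set" where
  "param_box I M = (\<Pi>\<^sub>E k\<in>I. {- M..M})"

lemma sets_param_box: "finite I \<Longrightarrow> param_box I M \<in> sets (\<Pi>\<^sub>M k\<in>I. lborel)"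
  unfolding param_box_def by (intro sets_PiM_I_finite) auto

lemma emeasure_param_box:
  assumes "finite I" "0 \<le> M"
  shows "emeasure (\<Pi>\<^sub>M k\<in>I. lborel) (param_box I M) = ennreal ((2 * M) ^ card I)"
proof -
  interpret P: product_sigma_finite "\<lambda>_ :: nat. lborel :: real measure" ..
  show ?thesis unfolding param_box_def
    using assms by (subst P.emeasure_PiM) (auto simp: ennreal_power)
qed

text \<open>Fix the parameters outside the block \<open>B\<close>: over the block the sum runs through an affine image of
  Lebesgue measure on \<open>\<real>\<^sup>d\<close>, and the other parameters contribute the volume of their box.\<close>

lemma nn_integral_param_box:
  fixes e :: "nat \<Rightarrow> real ^ 'd" and A :: "real ^ 'd \<Rightarrow> real ^ 'd"
  assumes I: "finite I" "B \<subseteq> I" and M: "0 \<le> M" and e: "bij_betw e B Basis"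
    and A: "linear A" "det (matrix A) \<noteq> 0" "\<And>k. k \<in> B \<Longrightarrow> w k = A (e k)" and [measurable]: "X \<in> sets borel"
  shows "(\<integral>\<^sup>+t. indicator (param_box I M) t * indicator X (c + (\<Sum>k\<in>I. t k *\<^sub>R w k)) \<partial>(\<Pi>\<^sub>M k\<in>I. lborel)) \<le>
    ennreal ((2 * M) ^ card (I - B)) * (ennreal (1 / \<bar>det (matrix A)\<bar>) * emeasure lborel X)"
proof -
  interpret P: product_sigma_finite "\<lambda>_ :: nat. lborel :: real measure" ..
  let ?J = "I - B"
  have fin: "finite ?J" "finite B" using I finite_subset by auto
  have IJ: "I = ?J \<union> B" "?J \<inter> B = {}" using I by auto
  note [measurable] = sets_param_box[OF I(1), of M] sets_param_box[OF fin(1), of M]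
  let ?f = "\<lambda>t. indicator (param_box I M) t * indicator X (c + (\<Sum>k\<in>I. t k *\<^sub>R w k)) :: ennreal"
  have fm: "?f \<in> borel_measurable (\<Pi>\<^sub>M k\<in>I. lborel)" by measurable
  have "(\<integral>\<^sup>+t. ?f t \<partial>(\<Pi>\<^sub>M k\<in>I. lborel)) = (\<integral>\<^sup>+t. ?f t \<partial>(\<Pi>\<^sub>M k\<in>?J \<union> B. lborel))"
    using IJ(1) by simp
  also have "\<dots> = (\<integral>\<^sup>+x. \<integral>\<^sup>+y. ?f (merge ?J B (x, y)) \<partial>(\<Pi>\<^sub>M k\<in>B. lborel) \<partial>(\<Pi>\<^sub>M k\<in>?J. lborel))"
    using fm IJ(1) by (intro P.product_nn_integral_fold[OF IJ(2) fin]) simp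
  also have "\<dots> \<le> (\<integral>\<^sup>+x. \<integral>\<^sup>+y. indicator (param_box ?J M) x *
      indicator X ((c + (\<Sum>k\<in>?J. x k *\<^sub>R w k)) + (\<Sum>k\<in>B. y k *\<^sub>R A (e k))) \<partial>(\<Pi>\<^sub>M k\<in>B. lborel) \<partial>(\<Pi>\<^sub>M k\<in>?J. lborel))"
  proof (intro nn_integral_mono)
    fix x y assume x: "x \<in> space (\<Pi>\<^sub>M k\<in>?J. lborel :: real measure)"
    let ?t = "merge ?J B (x, y)"
    have "x \<in> param_box ?J M" if "?t \<in> param_box I M"
    proof -
      have "x k \<in> {- M..M}" if k: "k \<in> ?J" for k
      proof -
        have "?t k \<in> {- M..M}" using \<open>?t \<in> param_box I M\<close> k unfolding param_box_def by (auto simp: PiE_iff)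
        then show ?thesis using k by (simp add: merge_def)
      qed
      then show ?thesis using x by (auto simp: param_box_def space_PiM PiE_iff)
    qed
    then have ind: "indicator (param_box I M) ?t \<le> (indicator (param_box ?J M) x :: ennreal)"
      by (auto split: split_indicator)
    have "(\<Sum>k\<in>I. ?t k *\<^sub>R w k) = (\<Sum>k\<in>?J. ?t k *\<^sub>R w k) + (\<Sum>k\<in>B. ?t k *\<^sub>R w k)"
      using sum.union_disjoint[OF fin IJ(2), of "\<lambda>k. ?t k *\<^sub>R w k"] IJ(1) by simp
    also have "(\<Sum>k\<in>?J. ?t k *\<^sub>R w k) = (\<Sum>k\<in>?J. x k *\<^sub>R w k)"
      by (intro sum.cong refl) (simp add: merge_def)
    also have "(\<Sum>k\<in>B. ?t k *\<^sub>R w k) = (\<Sum>k\<in>B. y k *\<^sub>R A (e k))"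
      using A(3) by (intro sum.cong refl) (simp add: merge_def)
    finally have "c + (\<Sum>k\<in>I. ?t k *\<^sub>R w k) = (c + (\<Sum>k\<in>?J. x k *\<^sub>R w k)) + (\<Sum>k\<in>B. y k *\<^sub>R A (e k))"
      by (simp only: add.assoc)
    then show "?f ?t \<le> indicator (param_box ?J M) x *
      indicator X ((c + (\<Sum>k\<in>?J. x k *\<^sub>R w k)) + (\<Sum>k\<in>B. y k *\<^sub>R A (e k)))"
      by (simp only:) (intro mult_right_mono ind, simp)
  qed
  also have "\<dots> = (\<integral>\<^sup>+x. indicator (param_box ?J M) x * (ennreal (1 / \<bar>det (matrix A)\<bar>) * emeasure lborel X) \<partial>(\<Pi>\<^sub>M k\<in>?J. lborel))"
  proof (rule nn_integral_cong)
    fix x :: "nat \<Rightarrow> real"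
    have "(\<lambda>y. indicator X ((c + (\<Sum>k\<in>?J. x k *\<^sub>R w k)) + (\<Sum>k\<in>B. y k *\<^sub>R A (e k))) :: ennreal) \<in>
        borel_measurable (\<Pi>\<^sub>M k\<in>B. lborel)"
      by measurable
    then show "(\<integral>\<^sup>+y. indicator (param_box ?J M) x *
      indicator X ((c + (\<Sum>k\<in>?J. x k *\<^sub>R w k)) + (\<Sum>k\<in>B. y k *\<^sub>R A (e k))) \<partial>(\<Pi>\<^sub>M k\<in>B. lborel)) =
      indicator (param_box ?J M) x * (ennreal (1 / \<bar>det (matrix A)\<bar>) * emeasure lborel X)"
      by (simp only: nn_integral_cmult nn_integral_block[OF fin(2) e A(1,2)] \<open>X \<in> sets borel\<close>)
  qed
  also have "\<dots> = ennreal ((2 * M) ^ card ?J) * (ennreal (1 / \<bar>det (matrix A)\<bar>) * emeasure lborel X)"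
    using emeasure_param_box[OF fin(1) M] by (subst nn_integral_multc) auto
  finally show ?thesis .
qed

section \<open>Energy of the fibre laws of a parametrised family\<close>

lemma ennreal_mult3:
  "0 \<le> a \<Longrightarrow> 0 \<le> b \<Longrightarrow> 0 \<le> d \<Longrightarrow> ennreal a * (ennreal b * (ennreal d * v)) = ennreal (a * b * d) * v"
  by (simp add: ennreal_mult mult.assoc)

context skew_system
begin

lemma AE_digit_stream: "AE \<omega> in Str. \<forall>i. \<omega> !! i \<in> digits"
proof -
  have [measurable]: "digits \<in> sets borel" using finite_digits by (rule finite_imp_closed[THEN borel_closed])
  have "AE a in digit_measure. a \<in> digits"
    unfolding digit_measure_def using finite_digits digits_nonempty
    by (subst AE_distr_iff) (auto simp: AE_measure_pmf_iff)
  then have "AE \<omega> in Str. stream_all (\<lambda>a. a \<in> digits) \<omega>"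
    by (intro D.AE_stream_all) measurable
  then show ?thesis by (simp add: sset_range)
qed

lemma backward_Suc: "backward (Suc i) x \<omega> = branch (backward i x \<omega>) (\<omega> !! Suc i)"
  by (induction i arbitrary: x \<omega>) auto

lemma backward_in_cube: "backward i x \<omega> \<in> cbox 0 1"
proof -
  have "branch y a \<in> cbox 0 1" for y a
    using vfrac_in_unit_cube[of "iE (y + a)"]
    by (auto simp: branch_def unit_cube_def mem_box_cart less_imp_le)
  then show ?thesis by (cases i) (auto simp del: backward.simps(2) simp: backward_Suc)
qed

lemma E_branch: 
  obtains v where "v \<in> int_lattice" "E (branch y a) = y + a + E v"
proof
  show "vfrac (iE (y + a)) - iE (y + a) \<in> int_lattice" by (rule vfrac_diff)
  show "E (branch y a) = y + a + E (vfrac (iE (y + a)) - iE (y + a))"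
    by (simp add: branch_def linear_diff[OF linear_E])
qed

lemma E_branch_diff: "a \<in> digits \<Longrightarrow> E (branch y a) - y \<in> int_lattice"
proof -
  assume a: "a \<in> digits"
  obtain v where v: "v \<in> int_lattice" "E (branch y a) = y + a + E v" by (rule E_branch)
  have "E (branch y a) - y = a + E v" using v(2) by simp
  then show ?thesis using int_lattice_add[OF digits_int[OF a] E_int[OF v(1)]] by simp
qed

text \<open>Links the digit streams with the compact set on which transversality is uniform.\<close>

lemma backward_orbit_pair:
  assumes a: "a \<in> digits" and b: "b \<in> digits" and ab: "a \<noteq> b"
    and \<omega>: "\<And>i. \<omega> !! i \<in> digits" and \<omega>': "\<And>i. \<omega>' !! i \<in> digits"
  shows "(\<lambda>i. (backward i x (a ## \<omega>), backward i x (b ## \<omega>'))) \<in> orbit_pairs"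
proof -
  have step: "E (backward (Suc i) x (c ## \<eta>)) - backward i x (c ## \<eta>) \<in> int_lattice"
    if "\<And>i. \<eta> !! i \<in> digits" for i c \<eta>
    unfolding backward_Suc by (rule E_branch_diff) (simp add: that)
  obtain v w where v: "v \<in> int_lattice" "E (branch x a) = x + a + E v"
    and w: "w \<in> int_lattice" "E (branch x b) = x + b + E w" using E_branch by metis
  have "E (branch x a) - E (branch x b) = (a - b) + E (v - w)"
    using v w by (simp add: linear_diff[OF linear_E])
  moreover have "(a - b) + E (v - w) \<in> int_lattice"
    using int_lattice_add[OF int_lattice_diff[OF digits_int[OF a] digits_int[OF b]] E_int[OF int_lattice_diff[OF v(1) w(1)]]] .
  moreover have "(a - b) + E (v - w) \<notin> E ` int_lattice"
  proof
    assume "(a - b) + E (v - w) \<in> E ` int_lattice"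
    then obtain u where u: "u \<in> int_lattice" "(a - b) + E (v - w) = E u" by blast
    have "a - b = E (u - (v - w))" unfolding linear_diff[OF linear_E, of u] u(2)[symmetric] by simp
    then show False using digit_unique[OF a b] int_lattice_diff[OF u(1) int_lattice_diff[OF v(1) w(1)]] ab by blast
  qed
  ultimately have "E (branch x a) - E (branch x b) \<in> int_lattice - E ` int_lattice" by simp
  then show ?thesis
    unfolding orbit_pairs_def using step[OF \<omega>, of _ a] step[OF \<omega>', of _ b]
    by (simp add: backward_in_cube del: backward.simps(2))
qed

lemma nn_integral_Str_digit:
  assumes F: "F \<in> borel_measurable Str"
  shows "(\<integral>\<^sup>+\<omega>. F \<omega> \<partial>Str) = ennreal (1 / real (card digits)) * (\<Sum>a\<in>digits. \<integral>\<^sup>+\<omega>. F (a ## \<omega>) \<partial>Str)"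
proof -
  have "(\<lambda>z. F (fst z ## snd z)) \<in> borel_measurable (digit_measure \<Otimes>\<^sub>M Str)"
    using F by measurable
  then have "(\<lambda>a. \<integral>\<^sup>+\<omega>. F (a ## \<omega>) \<partial>Str) \<in> borel_measurable digit_measure"
    by (intro Str.borel_measurable_nn_integral) (simp add: case_prod_unfold)
  then have m: "(\<lambda>a. \<integral>\<^sup>+\<omega>. F (a ## \<omega>) \<partial>Str) \<in> borel_measurable borel"
    by (simp add: measurable_cong_sets[OF sets_digit_measure refl])
  have "0 < card digits" using card_digits_ge_2 by simp
  then have "X / of_nat (card digits) = ennreal (1 / real (card digits)) * X" for X
    by (simp add: divide_ennreal_def ennreal_of_nat_eq_real_of_nat inverse_ennreal inverse_eq_divide mult.commute)
  then show ?thesis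
    by (simp add: D.nn_integral_stream_space[OF F] nn_integral_digit_measure[OF m])
qed

lemma height_scaled:
  "height (\<lambda>p. \<psi> p *\<^sub>R w) x \<omega> = weighted (\<lambda>i. \<psi> (torus_proj (backward i x \<omega>))) w"
  unfolding height_def weighted_def by (simp add: linear_scale[OF linear_Cpow])

lemma height_difference:
  assumes "continuous_on UNIV \<psi>"
  shows "height (\<lambda>p. \<psi> p *\<^sub>R w) x \<omega> - height (\<lambda>p. \<psi> p *\<^sub>R w) x \<omega>' =
    difference_op \<psi> (\<lambda>i. (backward i x \<omega>, backward i x \<omega>')) w"
proof -
  obtain B where "\<And>p. norm (\<psi> p) \<le> B" using bounded_on_torus[OF assms] by blast
  then have B: "\<bar>\<psi> p\<bar> \<le> B" for p by simp
  show ?thesis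
    unfolding height_scaled difference_op_def weighted_def
    by (subst suminf_diff[OF summable_weighted[of _ B, OF B] summable_weighted[of _ B, OF B]])
      (simp add: scaleR_diff_left)
qed

lemma emeasure_vimage_C:
  assumes "det (matrix C) \<noteq> 0" and [measurable]: "X \<in> sets borel"
  shows "emeasure lborel (C -` X) = ennreal (1 / \<bar>det (matrix C)\<bar>) * emeasure lborel X"
proof -
  have [measurable]: "C \<in> borel \<rightarrow>\<^sub>M borel" by (rule borel_measurable_continuous_onI[OF continuous_C])
  have CX: "C -` X \<in> sets borel" using measurable_sets[of C borel borel X] by simp
  have ind: "indicator (C -` X) = (\<lambda>y. indicator X (C y) :: ennreal)"
    by (simp add: indicator_def fun_eq_iff)
  have "ennreal \<bar>det (matrix C)\<bar> * emeasure lborel (C -` X) = ennreal \<bar>det (matrix C)\<bar> * (\<integral>\<^sup>+y. indicator X (C y) \<partial>lborel)"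
    using CX by (simp flip: ind)
  also have "\<dots> = (\<integral>\<^sup>+y. indicator X y \<partial>lborel)"
    using assms(1) det_nz_iff_inj[OF linear_C] by (intro nn_integral_lborel_linear linear_C) auto
  finally have "ennreal \<bar>det (matrix C)\<bar> * emeasure lborel (C -` X) = emeasure lborel X" by simp
  then show ?thesis using assms(1) by (simp add: mult.assoc[symmetric] ennreal_mult[symmetric] flip: \<open>_ = emeasure lborel X\<close>)
qed

end

text \<open>The index set \<open>I\<close> splits into blocks, one for each \<open>\<psi>\<close>, and \<open>e\<close> enumerates the standard basis within each
  block. Thus the parameters of a block move a height difference by \<open>difference_op \<psi> \<xi>\<close> applied to an
  arbitrary vector of \<open>\<real>\<^sup>d\<close>.\<close>

locale transversal_family = skew_system E C
  for E :: "real ^ 'u \<Rightarrow> real ^ 'u" and C :: "real ^ 'd \<Rightarrow> real ^ 'd" +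
  fixes f :: "'u torus \<Rightarrow> real ^ 'd" and I :: "nat set" and m :: "nat \<Rightarrow> 'u torus \<Rightarrow> real"
    and e :: "nat \<Rightarrow> real ^ 'd" and \<Psi> :: "('u torus \<Rightarrow> real) set" and \<delta> :: real
  assumes f: "continuous_on UNIV f" and I: "finite I"
    and m: "\<And>k. k \<in> I \<Longrightarrow> continuous_on UNIV (m k)"
    and e: "\<And>\<psi>. \<psi> \<in> \<Psi> \<Longrightarrow> bij_betw e {k \<in> I. m k = \<psi>} Basis"
    and \<delta>: "0 < \<delta>"
    and transversal: "\<And>\<xi>. \<xi> \<in> orbit_pairs \<Longrightarrow> \<exists>\<psi>\<in>\<Psi>. \<delta> \<le> \<bar>det (matrix (difference_op \<psi> \<xi>))\<bar>"
    and det_C: "1 < \<bar>det (matrix E)\<bar> * \<bar>det (matrix C)\<bar>"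
begin

abbreviation "Par \<equiv> (\<Pi>\<^sub>M k\<in>I. lborel) :: (nat \<Rightarrow> real) measure"

definition perturbed :: "(nat \<Rightarrow> real) \<Rightarrow> 'u torus \<Rightarrow> real ^ 'd" where
  "perturbed t = (\<lambda>p. f p + (\<Sum>k\<in>I. t k *\<^sub>R (m k p *\<^sub>R e k)))"

text \<open>The height for the perturbed function, written so that its dependence on \<open>t\<close> is visibly affine and
  measurable.\<close>

definition H :: "(nat \<Rightarrow> real) \<Rightarrow> real ^ 'u \<Rightarrow> (real ^ 'u) stream \<Rightarrow> real ^ 'd" where
  "H t x \<omega> = height f x \<omega> + (\<Sum>k\<in>I. t k *\<^sub>R height (\<lambda>p. m k p *\<^sub>R e k) x \<omega>)"

text \<open>The probability that the heights of two independent backward orbits of \<open>x\<close> differ by a vector in \<open>X\<close>.\<close>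

definition energy :: "(nat \<Rightarrow> real) \<Rightarrow> real ^ 'u \<Rightarrow> (real ^ 'd) set \<Rightarrow> ennreal" where
  "energy t x X = (\<integral>\<^sup>+\<omega>. \<integral>\<^sup>+\<omega>'. indicator X (H t x \<omega> - H t x \<omega>') \<partial>Str \<partial>Str)"

sublocale PF: product_sigma_finite "\<lambda>_ :: nat. lborel :: real measure" ..

sublocale Par: sigma_finite_measure Par
  by (rule PF.sigma_finite[OF I])

sublocale ParStr: pair_sigma_finite Par Str ..

sublocale ParCube: pair_sigma_finite Par "cube_lebesgue :: (real ^ 'u) measure" ..

lemma continuous_direction: "k \<in> I \<Longrightarrow> continuous_on UNIV (\<lambda>p. m k p *\<^sub>R e k)"
  by (intro continuous_intros m)

lemma continuous_perturbed: "continuous_on UNIV (perturbed t)"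
  unfolding perturbed_def by (intro continuous_intros f m)

lemma height_perturbed: "height (perturbed t) x \<omega> = H t x \<omega>"
proof -
  let ?p = "\<lambda>i. torus_proj (backward i x \<omega>)"
  have "(C ^^ i) (perturbed t (?p i)) = (C ^^ i) (f (?p i)) + (\<Sum>k\<in>I. t k *\<^sub>R (C ^^ i) (m k (?p i) *\<^sub>R e k))" for i
    unfolding perturbed_def
    by (simp only: linear_add[OF linear_Cpow] linear_sum[OF linear_Cpow] linear_scale[OF linear_Cpow])
  then have "height (perturbed t) x \<omega> = (\<Sum>i. (C ^^ i) (f (?p i)) + (\<Sum>k\<in>I. t k *\<^sub>R (C ^^ i) (m k (?p i) *\<^sub>R e k)))"
    by (simp only: height_def)
  also have "\<dots> = height f x \<omega> + (\<Sum>i. \<Sum>k\<in>I. t k *\<^sub>R (C ^^ i) (m k (?p i) *\<^sub>R e k))"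
    unfolding height_def
    by (intro suminf_add[symmetric] summable_height[OF f] summable_sum summable_scaleR_right summable_height continuous_direction)
  also have "(\<Sum>i. \<Sum>k\<in>I. t k *\<^sub>R (C ^^ i) (m k (?p i) *\<^sub>R e k)) = (\<Sum>k\<in>I. \<Sum>i. t k *\<^sub>R (C ^^ i) (m k (?p i) *\<^sub>R e k))"
    by (intro suminf_sum summable_scaleR_right summable_height continuous_direction)
  also have "\<dots> = (\<Sum>k\<in>I. t k *\<^sub>R height (\<lambda>p. m k p *\<^sub>R e k) x \<omega>)"
    unfolding height_def by (intro sum.cong refl suminf_scaleR_right[symmetric] summable_height continuous_direction)
  finally show ?thesis by (simp only: H_def)
qed

lemma H_Stream: "H t x (a ## \<omega>) = perturbed t (torus_proj (branch x a)) + C (H t (branch x a) \<omega>)"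
  unfolding height_perturbed[symmetric] by (rule height_Stream[OF continuous_perturbed])

lemma measurable_H [measurable (raw)]:
  assumes [measurable]: "F \<in> N \<rightarrow>\<^sub>M Par" "g \<in> N \<rightarrow>\<^sub>M borel" "h \<in> N \<rightarrow>\<^sub>M Str"
  shows "(\<lambda>z. H (F z) (g z) (h z)) \<in> borel_measurable N"
proof -
  have m: "(\<lambda>z. height q (g z) (h z)) \<in> borel_measurable N" if "continuous_on UNIV q" for q
  proof -
    note [measurable] = measurable_height[OF that]
    have "(\<lambda>z. (\<lambda>(x, \<omega>). height q x \<omega>) (g z, h z)) \<in> borel_measurable N" by measurable
    then show ?thesis by simp
  qed
  note [measurable] = m[OF f] m[OF continuous_direction]
  have [measurable]: "(\<lambda>z. F z k) \<in> borel_measurable N" if "k \<in> I" for k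
    using measurable_compose[OF assms(1) measurable_component_singleton[OF that]] by simp
  show ?thesis unfolding H_def by measurable
qed

lemma measurable_energy [measurable (raw)]:
  assumes [measurable]: "F \<in> N \<rightarrow>\<^sub>M Par" "g \<in> N \<rightarrow>\<^sub>M borel" "X \<in> sets borel"
  shows "(\<lambda>z. energy (F z) (g z) X) \<in> borel_measurable N"
  unfolding energy_def by measurable

lemma energy_le_1: "energy t x X \<le> 1"
proof -
  have "energy t x X \<le> (\<integral>\<^sup>+\<omega>. \<integral>\<^sup>+\<omega>'. 1 \<partial>Str \<partial>Str)"
    unfolding energy_def by (intro nn_integral_mono) (auto split: split_indicator)
  then show ?thesis using Str.emeasure_space_1 by simp
qed

definition box_energy :: "real \<Rightarrow> real ^ 'u \<Rightarrow> (real ^ 'd) set \<Rightarrow> ennreal" where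
  "box_energy M x X = (\<integral>\<^sup>+t. indicator (param_box I M) t * energy t x X \<partial>Par)"

text \<open>The two orbits separate at the first step, so transversality provides a block of parameters over which
  the height difference has bounded density. The exponent is enlarged from the number of remaining
  parameters to \<open>card I\<close> to make the constant independent of the block, and the base is raised above \<open>1\<close> for this.\<close>

lemma distinct_digits_bound:
  assumes ab: "a \<in> digits" "b \<in> digits" "a \<noteq> b" and M: "0 \<le> M"
    and \<omega>: "\<And>i. \<omega> !! i \<in> digits" "\<And>i. \<omega>' !! i \<in> digits" and X: "X \<in> sets borel"
  shows "(\<integral>\<^sup>+t. indicator (param_box I M) t * indicator X (H t x (a ## \<omega>) - H t x (b ## \<omega>')) \<partial>Par)
    \<le> ennreal ((2 * M + 1) ^ card I / \<delta>) * emeasure lborel X"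
proof -
  let ?\<xi> = "\<lambda>i. (backward i x (a ## \<omega>), backward i x (b ## \<omega>'))"
  obtain \<psi> where \<psi>: "\<psi> \<in> \<Psi>" "\<delta> \<le> \<bar>det (matrix (difference_op \<psi> ?\<xi>))\<bar>"
    using transversal[OF backward_orbit_pair[OF ab \<omega>, of x]] by blast
  let ?B = "{k \<in> I. m k = \<psi>}" and ?A = "difference_op \<psi> ?\<xi>"
  let ?w = "\<lambda>k. height (\<lambda>p. m k p *\<^sub>R e k) x (a ## \<omega>) - height (\<lambda>p. m k p *\<^sub>R e k) x (b ## \<omega>')"
  let ?c = "height f x (a ## \<omega>) - height f x (b ## \<omega>')"
  have w: "?w k = ?A (e k)" if "k \<in> ?B" for k
    using height_difference[OF m, of k] that by auto
  have "?B \<noteq> {}"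
  proof
    assume "?B = {}"
    then have "e ` {} = (Basis :: (real ^ 'd) set)" using e[OF \<psi>(1)] by (simp only: bij_betw_def)
    then show False using nonempty_Basis[where 'a = "real ^ 'd"] by (simp only: image_empty not_True_eq_False)
  qed
  then have "continuous_on UNIV \<psi>" using m by auto
  then obtain K where "\<And>p. norm (\<psi> p) \<le> K" by (rule bounded_on_torus) blast
  then have K: "\<bar>\<psi> p\<bar> \<le> K" for p by simp
  have A: "linear ?A" unfolding difference_op_def
    by (rule linear_weighted[of _ "2 * K"]) (rule abs_diff_le_twice_bound[of \<psi> K, OF K])
  have det: "det (matrix ?A) \<noteq> 0" using \<psi>(2) \<delta> by auto
  have H: "H t x (a ## \<omega>) - H t x (b ## \<omega>') = ?c + (\<Sum>k\<in>I. t k *\<^sub>R ?w k)" for t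
    by (simp add: H_def scaleR_diff_right sum_subtractf)
  have "(\<integral>\<^sup>+t. indicator (param_box I M) t * indicator X (H t x (a ## \<omega>) - H t x (b ## \<omega>')) \<partial>Par)
    \<le> ennreal ((2 * M) ^ card (I - ?B)) * (ennreal (1 / \<bar>det (matrix ?A)\<bar>) * emeasure lborel X)"
    unfolding H by (rule nn_integral_param_box[OF I _ M e[OF \<psi>(1)] A det w X]) auto
  also have "\<dots> \<le> ennreal ((2 * M + 1) ^ card I) * (ennreal (1 / \<delta>) * emeasure lborel X)"
  proof (intro mult_mono ennreal_leI)
    have "(2 * M) ^ card (I - ?B) \<le> (2 * M + 1) ^ card (I - ?B)" using M by (intro power_mono) auto
    also have "\<dots> \<le> (2 * M + 1) ^ card I" using M I by (intro power_increasing card_mono) auto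
    finally show "(2 * M) ^ card (I - ?B) \<le> (2 * M + 1) ^ card I" .
    show "1 / \<bar>det (matrix ?A)\<bar> \<le> 1 / \<delta>" using \<psi>(2) \<delta> by (intro divide_left_mono) auto
  qed auto
  also have "\<dots> = ennreal ((2 * M + 1) ^ card I / \<delta>) * emeasure lborel X"
    using M \<delta> by (simp add: mult.assoc[symmetric] ennreal_mult[symmetric])
  finally show ?thesis .
qed

text \<open>Condition on the first digits \<open>a\<close>, \<open>b\<close> of the two streams. If they agree, which has probability \<open>1/N\<close>, the
  difference of heights is \<open>C\<close> applied to the difference one step further back; otherwise
  \<open>distinct_digits_bound\<close> applies.\<close>

lemma box_energy_recursion:
  assumes M: "0 \<le> M" and X[measurable]: "X \<in> sets borel" and B: "\<And>y. box_energy M y (C -` X) \<le> B"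
  shows "box_energy M x X \<le> ennreal ((2 * M + 1) ^ card I / \<delta>) * emeasure lborel X + ennreal (1 / real (card digits)) * B"
proof -
  let ?N = "real (card digits)" and ?c = "ennreal ((2 * M + 1) ^ card I / \<delta>) * emeasure lborel X"
  let ?box = "indicator (param_box I M) :: _ \<Rightarrow> ennreal"
  note [measurable] = sets_param_box[OF I, of M]
  have [measurable]: "C \<in> borel \<rightarrow>\<^sub>M borel" by (rule borel_measurable_continuous_onI[OF continuous_C])
  have [measurable]: "C -` X \<in> sets borel" using measurable_sets[of C borel borel X] by simp
  have N: "2 \<le> ?N" using card_digits_ge_2 by simp
  define Z where "Z a b t = (\<integral>\<^sup>+\<omega>. \<integral>\<^sup>+\<omega>'. indicator X (H t x (a ## \<omega>) - H t x (b ## \<omega>')) \<partial>Str \<partial>Str)" for a b t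
  have Zm[measurable]: "Z a b \<in> borel_measurable Par" for a b
    unfolding Z_def by measurable
  have en: "energy t x X = ennreal (1 / ?N) * (ennreal (1 / ?N) * (\<Sum>a\<in>digits. \<Sum>b\<in>digits. Z a b t))"
    if t: "t \<in> space Par" for t
  proof -
    have [measurable]: "(\<lambda>_. t) \<in> N \<rightarrow>\<^sub>M Par" for N :: "'z measure" using t by (rule measurable_const)
    have "energy t x X = ennreal (1 / ?N) * (\<Sum>a\<in>digits. \<integral>\<^sup>+\<omega>. \<integral>\<^sup>+\<omega>'. indicator X (H t x (a ## \<omega>) - H t x \<omega>') \<partial>Str \<partial>Str)"
      unfolding energy_def by (rule nn_integral_Str_digit) measurable
    also have "\<dots> = ennreal (1 / ?N) * (\<Sum>a\<in>digits. ennreal (1 / ?N) * (\<Sum>b\<in>digits. Z a b t))"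
    proof (intro arg_cong2[where f = "(*)"] sum.cong refl)
      fix a
      have "(\<integral>\<^sup>+\<omega>. \<integral>\<^sup>+\<omega>'. indicator X (H t x (a ## \<omega>) - H t x \<omega>') \<partial>Str \<partial>Str) =
        (\<integral>\<^sup>+\<omega>. ennreal (1 / ?N) * (\<Sum>b\<in>digits. \<integral>\<^sup>+\<omega>'. indicator X (H t x (a ## \<omega>) - H t x (b ## \<omega>')) \<partial>Str) \<partial>Str)"
        by (intro nn_integral_cong nn_integral_Str_digit) measurable
      also have "\<dots> = ennreal (1 / ?N) * (\<integral>\<^sup>+\<omega>. (\<Sum>b\<in>digits. \<integral>\<^sup>+\<omega>'. indicator X (H t x (a ## \<omega>) - H t x (b ## \<omega>')) \<partial>Str) \<partial>Str)"
        by (intro nn_integral_cmult) measurable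
      also have "(\<integral>\<^sup>+\<omega>. (\<Sum>b\<in>digits. \<integral>\<^sup>+\<omega>'. indicator X (H t x (a ## \<omega>) - H t x (b ## \<omega>')) \<partial>Str) \<partial>Str) = (\<Sum>b\<in>digits. Z a b t)"
        unfolding Z_def by (intro nn_integral_sum) measurable
      finally show "(\<integral>\<^sup>+\<omega>. \<integral>\<^sup>+\<omega>'. indicator X (H t x (a ## \<omega>) - H t x \<omega>') \<partial>Str \<partial>Str) = ennreal (1 / ?N) * (\<Sum>b\<in>digits. Z a b t)" .
    qed
    finally show ?thesis by (simp only: sum_distrib_left)
  qed
  have diag: "(\<integral>\<^sup>+t. ?box t * Z a a t \<partial>Par) \<le> B" for a
  proof -
    have "Z a a t = energy t (branch x a) (C -` X)" for t
      unfolding Z_def energy_def H_Stream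
      by (intro nn_integral_cong) (simp add: indicator_def linear_diff[OF linear_C])
    then show ?thesis using B[of "branch x a"] by (simp add: box_energy_def)
  qed
  have off: "(\<integral>\<^sup>+t. ?box t * Z a b t \<partial>Par) \<le> ?c" if ab: "a \<in> digits" "b \<in> digits" "a \<noteq> b" for a b
  proof -
    let ?F = "\<lambda>t \<omega> \<omega>'. ?box t * indicator X (H t x (a ## \<omega>) - H t x (b ## \<omega>'))"
    have "(\<integral>\<^sup>+t. ?box t * Z a b t \<partial>Par) = (\<integral>\<^sup>+t. \<integral>\<^sup>+\<omega>. \<integral>\<^sup>+\<omega>'. ?F t \<omega> \<omega>' \<partial>Str \<partial>Str \<partial>Par)"
    proof (rule nn_integral_cong)
      fix t assume t: "t \<in> space Par"
      have [measurable]: "(\<lambda>_. t) \<in> N \<rightarrow>\<^sub>M Par" for N :: "'z measure" using t by (rule measurable_const)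
      have "(\<integral>\<^sup>+\<omega>. \<integral>\<^sup>+\<omega>'. ?F t \<omega> \<omega>' \<partial>Str \<partial>Str) =
          (\<integral>\<^sup>+\<omega>. ?box t * (\<integral>\<^sup>+\<omega>'. indicator X (H t x (a ## \<omega>) - H t x (b ## \<omega>')) \<partial>Str) \<partial>Str)"
        by (intro nn_integral_cong nn_integral_cmult) measurable
      also have "\<dots> = ?box t * Z a b t" unfolding Z_def by (intro nn_integral_cmult) measurable
      finally show "?box t * Z a b t = (\<integral>\<^sup>+\<omega>. \<integral>\<^sup>+\<omega>'. ?F t \<omega> \<omega>' \<partial>Str \<partial>Str)" by simp
    qed
    also have "\<dots> = (\<integral>\<^sup>+\<omega>. \<integral>\<^sup>+t. \<integral>\<^sup>+\<omega>'. ?F t \<omega> \<omega>' \<partial>Str \<partial>Par \<partial>Str)"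
      by (rule ParStr.Fubini'[symmetric]) measurable
    also have "\<dots> = (\<integral>\<^sup>+\<omega>. \<integral>\<^sup>+\<omega>'. \<integral>\<^sup>+t. ?F t \<omega> \<omega>' \<partial>Par \<partial>Str \<partial>Str)"
      by (intro nn_integral_cong ParStr.Fubini'[symmetric]) measurable
    also have "\<dots> \<le> (\<integral>\<^sup>+\<omega>. \<integral>\<^sup>+\<omega>'. ?c \<partial>Str \<partial>Str)"
    proof (rule nn_integral_mono_AE, use AE_digit_stream in eventually_elim)
      fix \<omega> :: "(real ^ 'u) stream" assume \<omega>: "\<forall>i. \<omega> !! i \<in> digits"
      show "(\<integral>\<^sup>+\<omega>'. \<integral>\<^sup>+t. ?F t \<omega> \<omega>' \<partial>Par \<partial>Str) \<le> (\<integral>\<^sup>+\<omega>'. ?c \<partial>Str)"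
      proof (rule nn_integral_mono_AE, use AE_digit_stream in eventually_elim)
        fix \<omega>' :: "(real ^ 'u) stream" assume \<omega>': "\<forall>i. \<omega>' !! i \<in> digits"
        show "(\<integral>\<^sup>+t. ?F t \<omega> \<omega>' \<partial>Par) \<le> ?c"
          by (rule distinct_digits_bound[OF ab M]) (use \<omega> \<omega>' X in auto)
      qed
    qed
    also have "\<dots> = ?c" using Str.emeasure_space_1 by simp
    finally show ?thesis .
  qed
  have "box_energy M x X = (\<integral>\<^sup>+t. ennreal (1 / ?N) * (ennreal (1 / ?N) * (\<Sum>a\<in>digits. \<Sum>b\<in>digits. ?box t * Z a b t)) \<partial>Par)"
    unfolding box_energy_def
    by (intro nn_integral_cong) (simp only: en sum_distrib_left[symmetric] mult.left_commute[of "?box t" for t])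
  also have "\<dots> = ennreal (1 / ?N) * (ennreal (1 / ?N) * (\<integral>\<^sup>+t. (\<Sum>a\<in>digits. \<Sum>b\<in>digits. ?box t * Z a b t) \<partial>Par))"
    by (subst nn_integral_cmult, measurable, subst nn_integral_cmult, measurable)
  also have "(\<integral>\<^sup>+t. (\<Sum>a\<in>digits. \<Sum>b\<in>digits. ?box t * Z a b t) \<partial>Par) = (\<Sum>a\<in>digits. \<Sum>b\<in>digits. \<integral>\<^sup>+t. ?box t * Z a b t \<partial>Par)"
    by (subst nn_integral_sum, measurable, intro sum.cong refl nn_integral_sum, measurable)
  also have "\<dots> \<le> (\<Sum>a\<in>digits. \<Sum>b\<in>digits. (if b = a then B else 0) + ?c)"
  proof (intro sum_mono)
    fix a b assume "a \<in> digits" "b \<in> digits"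
    then show "(\<integral>\<^sup>+t. ?box t * Z a b t \<partial>Par) \<le> (if b = a then B else 0) + ?c"
      using diag[of a] off[of a b] by (cases "b = a") (auto intro: add_increasing2)
  qed
  also have "\<dots> = of_nat (card digits) * B + of_nat (card digits) * (of_nat (card digits) * ?c)"
    using finite_digits by (simp add: sum.distrib distrib_left)
  finally have "box_energy M x X \<le> ennreal (1 / ?N) * (ennreal (1 / ?N) *
      (of_nat (card digits) * B + of_nat (card digits) * (of_nat (card digits) * ?c)))"
    by (simp add: mult_left_mono)
  also have "\<dots> = ennreal (1 / ?N) * B + ?c"
  proof -
    have cancel: "ennreal (1 / ?N) * (of_nat (card digits) * Y) = Y" for Y
      using N by (simp add: ennreal_of_nat_eq_real_of_nat mult.assoc[symmetric] ennreal_mult[symmetric])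
    show ?thesis by (simp only: distrib_left cancel)
  qed
  finally show ?thesis by (simp only: add.commute)
qed

lemma box_energy_iterated:
  assumes M: "0 \<le> M" and "X \<in> sets borel"
  defines "\<rho> \<equiv> 1 / (\<bar>det (matrix E)\<bar> * \<bar>det (matrix C)\<bar>)" and "c \<equiv> (2 * M + 1) ^ card I / \<delta>"
  shows "box_energy M x X \<le> ennreal (c * (\<Sum>j<n. \<rho> ^ j)) * emeasure lborel X + ennreal ((1 / real (card digits)) ^ n * (2 * M) ^ card I)"
  using assms(2)
proof (induction n arbitrary: x X)
  case 0
  have "box_energy M x X \<le> (\<integral>\<^sup>+t. indicator (param_box I M) t * 1 \<partial>Par)"
    unfolding box_energy_def by (intro nn_integral_mono mult_left_mono energy_le_1) simp
  also have "\<dots> = ennreal ((2 * M) ^ card I)"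
    using sets_param_box[OF I, of M] emeasure_param_box[OF I M] by simp
  finally show ?case by simp
next
  case (Suc n)
  let ?N = "real (card digits)" and ?dC = "\<bar>det (matrix C)\<bar>"
  let ?S = "\<Sum>j<n. \<rho> ^ j" and ?v = "emeasure lborel X" and ?D = "(2 * M) ^ card I"
  have N: "0 < ?N" using card_digits_ge_2 by simp
  have dC: "0 < ?dC" using det_C by (auto simp: zero_less_abs_iff)
  have c: "0 \<le> c" unfolding c_def using M \<delta> by simp
  have \<rho>: "0 \<le> \<rho>" "\<rho> = 1 / (?N * ?dC)" by (simp_all add: \<rho>_def card_digits)
  have S: "0 \<le> ?S" using \<rho>(1) by (intro sum_nonneg) simp
  have [measurable]: "C \<in> borel \<rightarrow>\<^sub>M borel" by (rule borel_measurable_continuous_onI[OF continuous_C])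
  have CX: "C -` X \<in> sets borel" using measurable_sets[of C borel borel X] Suc.prems by simp
  have "box_energy M x X \<le> ennreal c * ?v + ennreal (1 / ?N) *
      (ennreal (c * ?S) * emeasure lborel (C -` X) + ennreal ((1 / ?N) ^ n * ?D))"
    unfolding c_def by (rule box_energy_recursion[OF M Suc.prems]) (rule Suc.IH[OF CX, unfolded c_def])
  also have "emeasure lborel (C -` X) = ennreal (1 / ?dC) * ?v"
    using dC by (intro emeasure_vimage_C Suc.prems) auto
  also have "ennreal c * ?v + ennreal (1 / ?N) * (ennreal (c * ?S) * (ennreal (1 / ?dC) * ?v) + ennreal ((1 / ?N) ^ n * ?D))
      = ennreal (c * (\<Sum>j<Suc n. \<rho> ^ j)) * ?v + ennreal ((1 / ?N) ^ Suc n * ?D)"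
  proof -
    have "ennreal (1 / ?N) * (ennreal (c * ?S) * (ennreal (1 / ?dC) * ?v)) = ennreal (1 / ?N * (c * ?S) * (1 / ?dC)) * ?v"
      using N dC c S by (intro ennreal_mult3) auto
    also have "1 / ?N * (c * ?S) * (1 / ?dC) = c * (\<rho> * ?S)" by (simp add: \<rho>(2))
    finally have 1: "ennreal (1 / ?N) * (ennreal (c * ?S) * (ennreal (1 / ?dC) * ?v)) = ennreal (c * (\<rho> * ?S)) * ?v" .
    have 2: "ennreal (1 / ?N) * ennreal ((1 / ?N) ^ n * ?D) = ennreal ((1 / ?N) ^ Suc n * ?D)"
      using N M by (subst ennreal_mult[symmetric]) (auto simp: mult.assoc)
    have "c * (\<Sum>j<Suc n. \<rho> ^ j) = c + c * (\<rho> * ?S)"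
      unfolding sum.lessThan_Suc_shift by (simp add: sum_distrib_left distrib_left)
    then have "ennreal (c * (\<Sum>j<Suc n. \<rho> ^ j)) * ?v = ennreal c * ?v + ennreal (c * (\<rho> * ?S)) * ?v"
      using c \<rho>(1) S by (simp add: ennreal_plus distrib_right)
    then show ?thesis by (simp only: distrib_left 1 2 add.assoc)
  qed
  finally show ?case .
qed

text \<open>The ratio \<open>\<rho>\<close> is below \<open>1\<close>, so the constants in \<open>box_energy_iterated\<close> are bounded by a geometric series,
  while the contribution of streams that agree for \<open>n\<close> steps vanishes as \<open>n\<close> grows.\<close>

lemma box_energy_bound:
  assumes M: "0 \<le> M" and X: "X \<in> sets borel"
  defines "\<rho> \<equiv> 1 / (\<bar>det (matrix E)\<bar> * \<bar>det (matrix C)\<bar>)"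
  shows "box_energy M x X \<le> ennreal ((2 * M + 1) ^ card I / \<delta> * (1 / (1 - \<rho>))) * emeasure lborel X"
proof (rule ennreal_le_epsilon)
  fix \<epsilon> :: real assume \<epsilon>: "0 < \<epsilon>"
  let ?c = "(2 * M + 1) ^ card I / \<delta>" and ?N = "real (card digits)"
  have \<rho>: "0 \<le> \<rho>" "\<rho> < 1" using det_C by (auto simp: \<rho>_def)
  have c: "0 \<le> ?c" using M \<delta> by simp
  have N: "2 \<le> ?N" using card_digits_ge_2 by simp
  have "(\<lambda>n. (1 / ?N) ^ n * (2 * M) ^ card I) \<longlonglongrightarrow> 0 * (2 * M) ^ card I"
    using N by (intro tendsto_mult_right LIMSEQ_power_zero) auto
  then have "\<forall>\<^sub>F n in sequentially. (1 / ?N) ^ n * (2 * M) ^ card I < \<epsilon>"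
    using \<epsilon> by (intro order_tendstoD(2)) auto
  then obtain n where n: "(1 / ?N) ^ n * (2 * M) ^ card I < \<epsilon>" by (auto dest: eventually_happens)
  have "(\<Sum>j<n. \<rho> ^ j) \<le> (\<Sum>j. \<rho> ^ j)"
    using \<rho> by (intro sum_le_suminf summable_geometric) auto
  also have "\<dots> = 1 / (1 - \<rho>)" using \<rho> by (intro suminf_geometric) auto
  finally have S: "(\<Sum>j<n. \<rho> ^ j) \<le> 1 / (1 - \<rho>)" .
  have "box_energy M x X \<le> ennreal (?c * (\<Sum>j<n. \<rho> ^ j)) * emeasure lborel X + ennreal ((1 / ?N) ^ n * (2 * M) ^ card I)"
    unfolding \<rho>_def by (rule box_energy_iterated[OF M X])
  also have "\<dots> \<le> ennreal (?c * (1 / (1 - \<rho>))) * emeasure lborel X + ennreal \<epsilon>"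
    using n S c by (intro add_mono mult_right_mono ennreal_leI mult_left_mono) auto
  finally show "box_energy M x X \<le> ennreal (?c * (1 / (1 - \<rho>))) * emeasure lborel X + ennreal \<epsilon>" .
qed

definition radius :: "nat \<Rightarrow> real" where "radius j = 1 / real (Suc j)"

definition ball_volume :: "nat \<Rightarrow> real" where
  "ball_volume j = unit_ball_vol (real DIM(real ^ 'd)) * radius j ^ DIM(real ^ 'd)"

definition lower_energy :: "(nat \<Rightarrow> real) \<Rightarrow> real ^ 'u \<Rightarrow> ennreal" where
  "lower_energy t x = liminf (\<lambda>j. ennreal (1 / ball_volume j) * energy t x (cball 0 (2 * radius j)))"

lemma radius_pos: "0 < radius j"
  by (simp add: radius_def)

lemma ball_volume_pos: "0 < ball_volume j"
  unfolding ball_volume_def using radius_pos by (intro mult_pos_pos unit_ball_vol_pos) auto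

lemma measurable_lower_energy [measurable (raw)]:
  assumes [measurable]: "F \<in> N \<rightarrow>\<^sub>M Par" "g \<in> N \<rightarrow>\<^sub>M borel"
  shows "(\<lambda>z. lower_energy (F z) (g z)) \<in> borel_measurable N"
proof -
  have [measurable]: "cball (0 :: real ^ 'd) r \<in> sets borel" for r by simp
  show ?thesis unfolding lower_energy_def by measurable
qed

lemma lower_energy_integrable:
  assumes M: "0 \<le> M"
  obtains K :: real where "\<And>x. (\<integral>\<^sup>+t. indicator (param_box I M) t * lower_energy t x \<partial>Par) \<le> ennreal K"
proof -
  let ?\<rho> = "1 / (\<bar>det (matrix E)\<bar> * \<bar>det (matrix C)\<bar>)"
  let ?c = "(2 * M + 1) ^ card I / \<delta> * (1 / (1 - ?\<rho>))"
  let ?K = "?c * 2 ^ DIM(real ^ 'd)"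
  note [measurable] = sets_param_box[OF I, of M]
  have c: "0 \<le> ?c" using M \<delta> det_C by (intro mult_nonneg_nonneg) auto
  have [measurable]: "cball (0 :: real ^ 'd) r \<in> sets borel" for r by simp
  have "(\<integral>\<^sup>+t. indicator (param_box I M) t * lower_energy t x \<partial>Par) \<le> ennreal ?K" for x
  proof -
    let ?u = "\<lambda>j t. ennreal (1 / ball_volume j) * (indicator (param_box I M) t * energy t x (cball 0 (2 * radius j)))"
    have "(\<integral>\<^sup>+t. indicator (param_box I M) t * lower_energy t x \<partial>Par) \<le> (\<integral>\<^sup>+t. liminf (\<lambda>j. ?u j t) \<partial>Par)"
    proof (intro nn_integral_mono)
      fix t show "indicator (param_box I M) t * lower_energy t x \<le> liminf (\<lambda>j. ?u j t)"
        unfolding lower_energy_def by (cases "t \<in> param_box I M") auto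
    qed
    also have "\<dots> \<le> liminf (\<lambda>j. \<integral>\<^sup>+t. ?u j t \<partial>Par)" by (intro nn_integral_liminf) measurable
    also have "\<dots> \<le> liminf (\<lambda>j :: nat. ennreal ?K)"
    proof (intro Liminf_mono always_eventually allI)
      fix j
      have r: "0 \<le> 2 * radius j" using radius_pos[of j] by simp
      have "(\<integral>\<^sup>+t. ?u j t \<partial>Par) = ennreal (1 / ball_volume j) * box_energy M x (cball 0 (2 * radius j))"
        unfolding box_energy_def by (intro nn_integral_cmult) measurable
      also have "\<dots> \<le> ennreal (1 / ball_volume j) * (ennreal ?c * emeasure lborel (cball (0 :: real ^ 'd) (2 * radius j)))"
        by (intro mult_left_mono box_energy_bound[OF M]) auto
      also have "emeasure lborel (cball (0 :: real ^ 'd) (2 * radius j)) = ennreal (2 ^ DIM(real ^ 'd) * ball_volume j)"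
        using emeasure_cball[OF r, of "0 :: real ^ 'd"] by (simp add: ball_volume_def power_mult_distrib mult_ac)
      also have "ennreal (1 / ball_volume j) * (ennreal ?c * ennreal (2 ^ DIM(real ^ 'd) * ball_volume j)) =
          ennreal (1 / ball_volume j * (?c * (2 ^ DIM(real ^ 'd) * ball_volume j)))"
        using ball_volume_pos[of j] c ennreal_mult3[of "1 / ball_volume j" ?c "2 ^ DIM(real ^ 'd) * ball_volume j" 1]
        by (simp only: mult.assoc mult_1_right) simp
      also have "1 / ball_volume j * (?c * (2 ^ DIM(real ^ 'd) * ball_volume j)) = ?K"
        using ball_volume_pos[of j] by simp
      finally show "(\<integral>\<^sup>+t. ?u j t \<partial>Par) \<le> ennreal ?K" .
    qed
    also have "\<dots> = ennreal ?K" by (simp add: Liminf_const)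
    finally show ?thesis .
  qed
  then show thesis using that by blast
qed

text \<open>Every parameter lies in one of countably many boxes; on each of them Fatou's lemma and Tonelli's
  theorem apply.\<close>

lemma AE_lower_energy_finite: "AE t in Par. AE x in cube_lebesgue. lower_energy t x < \<infinity>"
proof -
  have box: "AE t in Par. t \<in> param_box I (real M) \<longrightarrow> (\<integral>\<^sup>+x. lower_energy t x \<partial>cube_lebesgue) \<noteq> \<infinity>" for M :: nat
  proof -
    note [measurable] = sets_param_box[OF I, of "real M"]
    obtain K where K: "\<And>x. (\<integral>\<^sup>+t. indicator (param_box I (real M)) t * lower_energy t x \<partial>Par) \<le> ennreal K"
      using lower_energy_integrable[of "real M"] by auto
    let ?F = "\<lambda>t x. indicator (param_box I (real M)) t * lower_energy t x"
    have "(\<integral>\<^sup>+t. \<integral>\<^sup>+x. ?F t x \<partial>cube_lebesgue \<partial>Par) = (\<integral>\<^sup>+x. \<integral>\<^sup>+t. ?F t x \<partial>Par \<partial>cube_lebesgue)"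
      by (rule ParCube.Fubini'[symmetric]) measurable
    also have "\<dots> \<le> (\<integral>\<^sup>+(x :: real ^ 'u). ennreal K \<partial>cube_lebesgue)" by (intro nn_integral_mono K)
    also have "\<dots> = ennreal K" by (simp add: cube.emeasure_space_1[simplified])
    finally have fin: "(\<integral>\<^sup>+t. \<integral>\<^sup>+x. ?F t x \<partial>cube_lebesgue \<partial>Par) \<noteq> \<infinity>" by (auto simp: top_unique)
    have "AE t in Par. (\<integral>\<^sup>+x. ?F t x \<partial>cube_lebesgue) \<noteq> \<infinity>"
      by (rule nn_integral_PInf_AE[OF _ fin]) measurable
    then show ?thesis by eventually_elim (intro impI, simp)
  qed
  have "AE t in Par. \<forall>M :: nat. t \<in> param_box I (real M) \<longrightarrow> (\<integral>\<^sup>+x. lower_energy t x \<partial>cube_lebesgue) \<noteq> \<infinity>"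
    unfolding AE_all_countable by (rule allI) (rule box)
  moreover have "AE t in Par. t \<in> space Par" by (rule AE_space)
  ultimately show ?thesis
  proof eventually_elim
    case (elim t)
    note [measurable] = measurable_const[OF elim(2)]
    \<comment> \<open>The sum dominates each coordinate, so this \<open>M\<close> gives a box containing \<open>t\<close>.\<close>
    obtain M :: nat where M: "(\<Sum>k\<in>I. \<bar>t k\<bar>) \<le> real M" using real_arch_simple by blast
    have "\<bar>t k\<bar> \<le> real M" if "k \<in> I" for k
      using M member_le_sum[OF that, of "\<lambda>k. \<bar>t k\<bar>"] I by fastforce
    then have "t \<in> param_box I (real M)"
      using elim(2) by (auto simp: param_box_def space_PiM PiE_iff abs_le_iff minus_le_iff)
    then have fin: "(\<integral>\<^sup>+x. lower_energy t x \<partial>cube_lebesgue) \<noteq> \<infinity>" using elim(1) by blast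
    have "(\<lambda>x. lower_energy t x) \<in> borel_measurable (cube_lebesgue :: (real ^ 'u) measure)" by measurable
    from nn_integral_PInf_AE[OF this fin] show ?case by (simp add: less_top)
  qed
qed

lemma fibre_law_absolutely_continuous:
  assumes t: "t \<in> space Par" and fin: "lower_energy t x < \<infinity>"
  shows "absolutely_continuous lborel (distr Str borel (H t x))"
proof (rule bounded_energy_absolutely_continuous)
  note [measurable] = measurable_const[OF t]
  have Hm[measurable]: "H t x \<in> Str \<rightarrow>\<^sub>M borel"
  proof -
    have "(\<lambda>\<omega>. H t x \<omega>) \<in> Str \<rightarrow>\<^sub>M borel" by measurable
    then show ?thesis by simp
  qed
  let ?L = "distr Str borel (H t x)"
  show "prob_space ?L" by (rule Str.prob_space_distr[OF Hm])
  show "0 < radius j" for j by (rule radius_pos)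
  show "decseq radius" unfolding decseq_def radius_def by (auto simp: frac_le)
  show "radius \<longlonglongrightarrow> 0" unfolding radius_def using lim_inverse_n' LIMSEQ_Suc by blast
  have e: "(\<integral>\<^sup>+y. \<integral>\<^sup>+y'. indicator X (y - y') \<partial>?L \<partial>?L) = energy t x X" if [measurable]: "X \<in> sets borel" for X
  proof -
    have "(\<integral>\<^sup>+y. \<integral>\<^sup>+y'. indicator X (y - y') \<partial>?L \<partial>?L) = (\<integral>\<^sup>+y. \<integral>\<^sup>+\<omega>'. indicator X (y - H t x \<omega>') \<partial>Str \<partial>?L)"
      by (intro nn_integral_cong nn_integral_distr) measurable
    also have "\<dots> = energy t x X" unfolding energy_def by (rule nn_integral_distr) measurable
    finally show ?thesis .
  qed
  show "liminf (\<lambda>j. ennreal (1 / (unit_ball_vol (real DIM(real ^ 'd)) * radius j ^ DIM(real ^ 'd))) *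
      (\<integral>\<^sup>+y. \<integral>\<^sup>+y'. indicator (cball 0 (2 * radius j)) (y - y') \<partial>?L \<partial>?L)) < \<infinity>"
    using fin unfolding lower_energy_def ball_volume_def by (subst e) auto
qed simp

text \<open>Almost every vertical section of a null set of the cylinder is null, and the conditional laws of the
  graph measure on the fibres are absolutely continuous.\<close>

lemma graph_measure_absolutely_continuous:
  assumes t: "t \<in> space Par" and fin: "AE x in cube_lebesgue. lower_energy t x < \<infinity>"
  shows "absolutely_continuous cylinder_volume (graph_measure (perturbed t))"
  unfolding absolutely_continuous_def
proof
  fix A :: "('u torus \<times> (real ^ 'd)) set" assume A: "A \<in> null_sets cylinder_volume"
  then have A_sets[measurable]: "A \<in> sets borel" by (auto simp: null_sets_def sets_cylinder_volume)
  note [measurable] = measurable_const[OF t]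
  have A_prod: "A \<in> sets (torus_lebesgue \<Otimes>\<^sub>M (lborel :: (real ^ 'd) measure))"
    using A unfolding cylinder_volume_def by (rule null_setsD2)
  have sec_m: "(\<lambda>p. emeasure (lborel :: (real ^ 'd) measure) (Pair p -` A)) \<in> borel_measurable torus_lebesgue"
    by (rule lborel.measurable_emeasure_Pair[OF A_prod])
  have "(\<integral>\<^sup>+p. emeasure lborel (Pair p -` A) \<partial>torus_lebesgue) = 0"
    using A lborel.emeasure_pair_measure_alt[OF A_prod] unfolding cylinder_volume_def by (simp add: null_setsD1)
  then have "(\<integral>\<^sup>+x. emeasure lborel (Pair (torus_proj x) -` A) \<partial>cube_lebesgue) = 0"
    using sec_m unfolding torus_lebesgue_eq_distr by (subst (asm) nn_integral_distr) auto
  moreover have "(\<lambda>x. emeasure (lborel :: (real ^ 'd) measure) (Pair (torus_proj x) -` A)) \<in> borel_measurable cube_lebesgue"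
    by (rule measurable_compose[OF _ sec_m])
      (simp only: measurable_cong_sets[OF sets_cube_lebesgue sets_torus_lebesgue] measurable_torus_proj)
  ultimately have null: "AE x in cube_lebesgue. emeasure (lborel :: (real ^ 'd) measure) (Pair (torus_proj x) -` A) = 0"
    by (subst (asm) nn_integral_0_iff_AE)
  have "emeasure (graph_measure (perturbed t)) A =
      (\<integral>\<^sup>+x. \<integral>\<^sup>+\<omega>. indicator A (torus_proj x, height (perturbed t) x \<omega>) \<partial>Str \<partial>cube_lebesgue)"
    using A_sets sets_graph_measure[OF continuous_perturbed]
    by (subst nn_integral_graph_measure[OF continuous_perturbed, symmetric]) auto
  also have "\<dots> = (\<integral>\<^sup>+(x :: real ^ 'u). 0 \<partial>cube_lebesgue)"
  proof (rule nn_integral_cong_AE, use fin null in eventually_elim)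
    fix x :: "real ^ 'u"
    assume fx: "lower_energy t x < \<infinity>" and nx: "emeasure (lborel :: (real ^ 'd) measure) (Pair (torus_proj x) -` A) = 0"
    have Hm: "H t x \<in> Str \<rightarrow>\<^sub>M borel"
    proof -
      have "(\<lambda>\<omega>. H t x \<omega>) \<in> Str \<rightarrow>\<^sub>M borel" by measurable
      then show ?thesis by simp
    qed
    have sec: "Pair (torus_proj x) -` A \<in> sets borel"
      using sets_Pair1[OF A_prod, of "torus_proj x"] by simp
    then have "Pair (torus_proj x) -` A \<in> null_sets lborel" using nx by (intro null_setsI) auto
    then have "Pair (torus_proj x) -` A \<in> null_sets (distr Str borel (H t x))"
      using fibre_law_absolutely_continuous[OF t fx] unfolding absolutely_continuous_def by blast
    then have "(\<integral>\<^sup>+y. indicator (Pair (torus_proj x) -` A) y \<partial>distr Str borel (H t x)) = 0"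
      using sec by (simp add: null_setsD1)
    then show "(\<integral>\<^sup>+\<omega>. indicator A (torus_proj x, height (perturbed t) x \<omega>) \<partial>Str) = 0"
      using Hm sec by (subst (asm) nn_integral_distr) (auto simp: height_perturbed indicator_def)
  qed
  finally have "emeasure (graph_measure (perturbed t)) A = 0" by simp
  then show "A \<in> null_sets (graph_measure (perturbed t))"
    using A_sets sets_graph_measure[OF continuous_perturbed] by (intro null_setsI) auto
qed

theorem AE_SRB_absolutely_continuous:
  "AE t in Par. absolutely_continuous cylinder_volume (SRB_measure (skew_product E C (perturbed t)))"
  using AE_lower_energy_finite AE_space
  by eventually_elim
    (simp only: SRB_measure_eq[OF continuous_perturbed], rule graph_measure_absolutely_continuous)

end

section \<open>Absolutely continuous SRB measures for almost every parameter\<close>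

theorem theoremB:
  fixes E :: "real ^ 'u \<Rightarrow> real ^ 'u" and C :: "real ^ 'd \<Rightarrow> real ^ 'd"
  assumes "CARD('d) \<le> CARD('u)"
    and "expanding E"
    and "contracting_for E C"
  shows "\<exists>(s :: nat) (\<phi> :: nat \<Rightarrow> 'u torus \<Rightarrow> real ^ 'd).
    (\<forall>k\<in>{1..s}. torus_Cinf (\<phi> k)) \<and>
    (\<forall>f :: 'u torus \<Rightarrow> real ^ 'd. torus_Ck 2 f \<longrightarrow>
      (AE t in (\<Pi>\<^sub>M k\<in>{1..s}. lborel :: real measure).
        absolutely_continuous cylinder_volume
          (SRB_measure (skew_product E C (\<lambda>x. f x + (\<Sum>k=1..s. t k *\<^sub>R \<phi> k x))))))"
proof -
  interpret skew_system E C
    using assms(2,3) by unfold_locales (auto simp: contracting_for_def)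
  obtain \<Psi> \<delta> where \<Psi>: "finite \<Psi>" "\<And>\<psi>. \<psi> \<in> \<Psi> \<Longrightarrow> trig_poly \<psi>" "0 < \<delta>"
    "\<And>\<xi>. \<xi> \<in> orbit_pairs \<Longrightarrow> \<exists>\<psi>\<in>\<Psi>. \<delta> \<le> \<bar>det (matrix (difference_op \<psi> \<xi>))\<bar>"
    using uniform_transversality by blast
  let ?J = "\<Psi> \<times> (Basis :: (real ^ 'd) set)"
  define s where "s = card ?J"
  have "finite ?J" using \<Psi>(1) by simp
  then obtain h where h: "bij_betw h {1..s} ?J"
    using finite_same_card_bij[of "{1..s}" ?J] by (auto simp: s_def)
  define m where "m k = fst (h k)" for k
  define e where "e k = snd (h k)" for k
  have hk: "m k \<in> \<Psi>" if "k \<in> {1..s}" for k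
    using bij_betwE[OF h] that unfolding m_def by (metis mem_Times_iff)
  have block: "bij_betw e {k \<in> {1..s}. m k = \<psi>} Basis" if \<psi>: "\<psi> \<in> \<Psi>" for \<psi>
    unfolding bij_betw_def
  proof
    show "inj_on e {k \<in> {1..s}. m k = \<psi>}"
    proof (rule inj_onI)
      fix k l assume k: "k \<in> {k \<in> {1..s}. m k = \<psi>}" and l: "l \<in> {k \<in> {1..s}. m k = \<psi>}" and "e k = e l"
      then have "h k = h l" by (simp add: m_def e_def prod_eq_iff)
      then show "k = l" using bij_betw_imp_inj_on[OF h] k l by (auto dest: inj_onD)
    qed
    show "e ` {k \<in> {1..s}. m k = \<psi>} = Basis"
    proof (intro equalityI subsetI)
      fix b assume "b \<in> e ` {k \<in> {1..s}. m k = \<psi>}"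
      then obtain k where "k \<in> {1..s}" "b = e k" by auto
      then show "b \<in> Basis" using bij_betwE[OF h] unfolding e_def by (metis mem_Times_iff)
    next
      fix b :: "real ^ 'd" assume "b \<in> Basis"
      then have "(\<psi>, b) \<in> h ` {1..s}" using \<psi> bij_betw_imp_surj_on[OF h] by simp
      then obtain k where k: "k \<in> {1..s}" "h k = (\<psi>, b)" by (metis imageE)
      then have "m k = \<psi>" "e k = b" by (simp_all add: m_def e_def)
      then show "b \<in> e ` {k \<in> {1..s}. m k = \<psi>}" using k(1) by blast
    qed
  qed
  have det: "1 < \<bar>det (matrix E)\<bar> * \<bar>det (matrix C)\<bar>"
  proof -
    have "inverse \<bar>det (matrix E)\<bar> < \<bar>det (matrix C)\<bar>" using assms(3) by (simp add: contracting_for_def)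
    then have "\<bar>det (matrix E)\<bar> * inverse \<bar>det (matrix E)\<bar> < \<bar>det (matrix E)\<bar> * \<bar>det (matrix C)\<bar>"
      using det_E by (intro mult_strict_left_mono) auto
    then show ?thesis using det_E by simp
  qed
  show ?thesis
  proof (intro exI[of _ s] exI[of _ "\<lambda>k p. m k p *\<^sub>R e k"] conjI ballI allI impI)
    show "torus_Cinf (\<lambda>p. m k p *\<^sub>R e k)" if "k \<in> {1..s}" for k
      by (rule trig_poly_Cinf) (rule \<Psi>(2)[OF hk[OF that]])
    fix f :: "'u torus \<Rightarrow> real ^ 'd" assume "torus_Ck 2 f"
    then have f: "continuous_on UNIV f"
    proof -
      obtain f' where "\<And>x. ((f \<circ> torus_proj) has_derivative f' x) (at x)"
        using \<open>torus_Ck 2 f\<close> by (auto simp: torus_Ck_def numeral_2_eq_2)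
      then have "continuous_on UNIV (f \<circ> torus_proj)"
        using has_derivative_continuous continuous_at_imp_continuous_on by blast
      then show ?thesis by (simp add: continuous_on_torus_iff comp_def)
    qed
    interpret transversal_family E C f "{1..s}" m e \<Psi> \<delta>
    proof unfold_locales
      show "continuous_on UNIV (m k)" if "k \<in> {1..s}" for k
        by (rule trig_poly_continuous) (rule \<Psi>(2)[OF hk[OF that]])
    qed (use f block \<Psi> det in auto)
    show "AE t in (\<Pi>\<^sub>M k\<in>{1..s}. lborel :: real measure).
        absolutely_continuous cylinder_volume
          (SRB_measure (skew_product E C (\<lambda>x. f x + (\<Sum>k=1..s. t k *\<^sub>R m k x *\<^sub>R e k))))"
      using AE_SRB_absolutely_continuous unfolding perturbed_def .
  qed
qed

end
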